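(* Let $G=(G^0,G^1,s,r)$ be a directed graph. Then the graph $C^*$-algebra $C^*(G)$ is residually finite-dimensional (RFD) if and only if $G$ has all of the following properties: (a) $G$ has no infinite receiver; (b) $G$ has no cycle with an exit; (c) $G$ has no infinite backward chain; (d) for each $v\in G^0$, there is a finite path from $v$ to a sink or a cycle or an infinite emitter.
   Context: A directed graph $G=(G^0,G^1,s,r)$ consists of two countable sets $G^0$ (vertices) and $G^1$ (edges) and functions $r,s:G^1\to G^0$ (range and source). The graph $C^*$-algebra $C^*(G)$ is the universal $C^*$-algebra with generators $\{p_v,s_e : v\in G^0, e\in G^1\}$, where the $p_v$ are mutually orthogonal projections, the $s_e$ are partial isometries with mutually orthogonal ranges, and: (1) $s_e^*s_e=p_{r(e)}$ for each $e\in G^1$; (2) $p_v=\sum_{e\in s^{-1}(v)}s_es_e^*$ for each $v\in G^0$ with $0<\sharp(s^{-1}(v))<\infty$; (3) $s_es_e^*\le p_{s(e)}$ for each $e\in G^1$. A $C^*$-algebra is residually finite-dimensional (RFD) if it has a separating family of finite-dimensional representations. A (finite) path is a sequence of edges $\nu=\nu_1\cdots\nu_n$ with $r(\nu_i)=s(\nu_{i+1})$ for all $1\le i<n$; its source is $s(\nu_1)$ and its range is $r(\nu_n)$. Vertices are regarded as paths of length $0$, with $s(v)=r(v)=v$. A sink is a vertex $v$ with $s^{-1}(v)=\emptyset$; an infinite emitter is a vertex $v$ with $s^{-1}(v)$ infinite; an infinite receiver is a vertex $v$ with $r^{-1}(v)$ infinite. A cycle is a path $\mu$ of length $n\ge 1$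 whose source equals its range and whose edges $\mu_1,\dots,\mu_n$ have pairwise distinct sources. A cycle has an exit if there is an edge, not one of the edges of the cycle, whose source is a vertex of the cycle. A finite path from $v$ to a cycle is a finite path with source $v$ whose range is a vertex lying on a cycle. An infinite backward chain is an infinite sequence of distinct edges $\dots e_{-1}e_0e_1\dots$ such that $r(e_i)=s(e_{i+1})$ for all consecutive $i,i+1$ in the index set and each edge $e_i$ of the sequence has a predecessor $e_{i-1}$ in the sequence. The sequence is thus infinite to the left; it may be either infinite to the right (indexed by $\mathbb{Z}$) or have a last edge (indexed by the integers $\le 0$). *)

theory Defs
  imports
    Complex_Main
    "HOL-Algebra.Algebraic_Closure_Type"
    "HOL-Library.Countable_Set"
    "Graph_Theory.Arc_Walk"
    "Jordan_Normal_Form.Schur_Decomposition"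
begin

section \<open>C*-algebras\<close>

text \<open>
  A C*-algebra is a complex vector space (a module in the sense of HOL-Algebra over the ring of
  complex numbers) with a multiplication, an involution and a norm.  It need not be unital: as for
  the modules of HOL-Algebra, the field \<open>one\<close> that the record inherits from rings carries no
  meaning, and nothing below refers to it.
\<close>

record 'a cstar = "(complex, 'a) module" +
  adj :: "'a \<Rightarrow> 'a"
  cnorm :: "'a \<Rightarrow> real"

definition cstar_limit :: "('a, 'b) cstar_scheme \<Rightarrow> (nat \<Rightarrow> 'a) \<Rightarrow> 'a \<Rightarrow> bool" where
  "cstar_limit A u a \<longleftrightarrow> (\<lambda>n. cnorm A (u n \<ominus>\<^bsub>A\<^esub> a)) \<longlonglongrightarrow> 0"

definition cstar_Cauchy :: "('a, 'b) cstar_scheme \<Rightarrow> (nat \<Rightarrow> 'a) \<Rightarrow> bool" where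
  "cstar_Cauchy A u \<longleftrightarrow> (\<forall>e>0. \<exists>N. \<forall>m\<ge>N. \<forall>n\<ge>N. cnorm A (u m \<ominus>\<^bsub>A\<^esub> u n) < e)"

locale cstar_algebra = Module.module "ring_of_type_algebra :: complex ring" A
  for A :: "('a, 'b) cstar_scheme" (structure) +
  assumes mult_closed: "\<lbrakk>x \<in> carrier A; y \<in> carrier A\<rbrakk> \<Longrightarrow> x \<otimes> y \<in> carrier A"
    and mult_assoc:
      "\<lbrakk>x \<in> carrier A; y \<in> carrier A; z \<in> carrier A\<rbrakk> \<Longrightarrow> (x \<otimes> y) \<otimes> z = x \<otimes> (y \<otimes> z)"
    and mult_add_left:
      "\<lbrakk>x \<in> carrier A; y \<in> carrier A; z \<in> carrier A\<rbrakk> \<Longrightarrow> (x \<oplus> y) \<otimes> z = (x \<otimes> z) \<oplus> (y \<otimes> z)"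
    and mult_add_right:
      "\<lbrakk>x \<in> carrier A; y \<in> carrier A; z \<in> carrier A\<rbrakk> \<Longrightarrow> z \<otimes> (x \<oplus> y) = (z \<otimes> x) \<oplus> (z \<otimes> y)"
    and mult_smult_left:
      "\<lbrakk>x \<in> carrier A; y \<in> carrier A\<rbrakk> \<Longrightarrow> (c \<odot> x) \<otimes> y = c \<odot> (x \<otimes> y)"
    and mult_smult_right:
      "\<lbrakk>x \<in> carrier A; y \<in> carrier A\<rbrakk> \<Longrightarrow> x \<otimes> (c \<odot> y) = c \<odot> (x \<otimes> y)"
    and adj_closed: "x \<in> carrier A \<Longrightarrow> adj A x \<in> carrier A"
    and adj_adj: "x \<in> carrier A \<Longrightarrow> adj A (adj A x) = x"
    and adj_add:
      "\<lbrakk>x \<in> carrier A; y \<in> carrier A\<rbrakk> \<Longrightarrow> adj A (x \<oplus> y) = adj A x \<oplus> adj A y"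
    and adj_smult: "x \<in> carrier A \<Longrightarrow> adj A (c \<odot> x) = cnj c \<odot> adj A x"
    and adj_mult:
      "\<lbrakk>x \<in> carrier A; y \<in> carrier A\<rbrakk> \<Longrightarrow> adj A (x \<otimes> y) = adj A y \<otimes> adj A x"
    and norm_nonneg: "x \<in> carrier A \<Longrightarrow> 0 \<le> cnorm A x"
    and norm_eq_0_iff: "x \<in> carrier A \<Longrightarrow> cnorm A x = 0 \<longleftrightarrow> x = \<zero>"
    and norm_triangle:
      "\<lbrakk>x \<in> carrier A; y \<in> carrier A\<rbrakk> \<Longrightarrow> cnorm A (x \<oplus> y) \<le> cnorm A x + cnorm A y"
    and norm_smult: "x \<in> carrier A \<Longrightarrow> cnorm A (c \<odot> x) = cmod c * cnorm A x"
    and norm_mult: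
      "\<lbrakk>x \<in> carrier A; y \<in> carrier A\<rbrakk> \<Longrightarrow> cnorm A (x \<otimes> y) \<le> cnorm A x * cnorm A y"
    and norm_cstar: "x \<in> carrier A \<Longrightarrow> cnorm A (adj A x \<otimes> x) = (cnorm A x)\<^sup>2"
    and complete:
      "\<lbrakk>range u \<subseteq> carrier A; cstar_Cauchy A u\<rbrakk> \<Longrightarrow> \<exists>a\<in>carrier A. cstar_limit A u a"

definition star_hom ::
  "('a, 'c) cstar_scheme \<Rightarrow> ('b, 'd) cstar_scheme \<Rightarrow> ('a \<Rightarrow> 'b) \<Rightarrow> bool" where
  "star_hom A B f \<longleftrightarrow>
     (\<forall>x\<in>carrier A. f x \<in> carrier B) \<and>
     (\<forall>x\<in>carrier A. \<forall>y\<in>carrier A. f (x \<oplus>\<^bsub>A\<^esub> y) = f x \<oplus>\<^bsub>B\<^esub> f y) \<and>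
     (\<forall>c. \<forall>x\<in>carrier A. f (c \<odot>\<^bsub>A\<^esub> x) = c \<odot>\<^bsub>B\<^esub> f x) \<and>
     (\<forall>x\<in>carrier A. \<forall>y\<in>carrier A. f (x \<otimes>\<^bsub>A\<^esub> y) = f x \<otimes>\<^bsub>B\<^esub> f y) \<and>
     (\<forall>x\<in>carrier A. f (adj A x) = adj B (f x))"

definition cstar_subalgebra :: "('a, 'b) cstar_scheme \<Rightarrow> 'a set \<Rightarrow> bool" where
  "cstar_subalgebra A S \<longleftrightarrow>
     S \<subseteq> carrier A \<and> \<zero>\<^bsub>A\<^esub> \<in> S \<and>
     (\<forall>x\<in>S. \<forall>y\<in>S. x \<oplus>\<^bsub>A\<^esub> y \<in> S) \<and>
     (\<forall>c. \<forall>x\<in>S. c \<odot>\<^bsub>A\<^esub> x \<in> S) \<and>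
     (\<forall>x\<in>S. \<forall>y\<in>S. x \<otimes>\<^bsub>A\<^esub> y \<in> S) \<and>
     (\<forall>x\<in>S. adj A x \<in> S) \<and>
     (\<forall>u. \<forall>a\<in>carrier A. range u \<subseteq> S \<and> cstar_limit A u a \<longrightarrow> a \<in> S)"

definition cstar_generated_by :: "('a, 'b) cstar_scheme \<Rightarrow> 'a set \<Rightarrow> bool" where
  "cstar_generated_by A T \<longleftrightarrow>
     T \<subseteq> carrier A \<and> (\<forall>S. cstar_subalgebra A S \<and> T \<subseteq> S \<longrightarrow> S = carrier A)"

definition projection :: "('a, 'b) cstar_scheme \<Rightarrow> 'a \<Rightarrow> bool" where
  "projection A x \<longleftrightarrow> x \<in> carrier A \<and> x \<otimes>\<^bsub>A\<^esub> x = x \<and> adj A x = x"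

definition partial_isometry :: "('a, 'b) cstar_scheme \<Rightarrow> 'a \<Rightarrow> bool" where
  "partial_isometry A x \<longleftrightarrow> x \<in> carrier A \<and> x \<otimes>\<^bsub>A\<^esub> adj A x \<otimes>\<^bsub>A\<^esub> x = x"

text \<open>The range projection, when \<open>x\<close> is a partial isometry.\<close>

definition range_proj :: "('a, 'b) cstar_scheme \<Rightarrow> 'a \<Rightarrow> 'a" where
  "range_proj A x = x \<otimes>\<^bsub>A\<^esub> adj A x"

text \<open>The usual order on projections (\<open>q\<close> is a subprojection of \<open>p\<close>).\<close>

definition proj_le :: "('a, 'b) cstar_scheme \<Rightarrow> 'a \<Rightarrow> 'a \<Rightarrow> bool" where
  "proj_le A q p \<longleftrightarrow> p \<otimes>\<^bsub>A\<^esub> q = q \<and> q \<otimes>\<^bsub>A\<^esub> p = q"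


section \<open>Residual finite-dimensionality\<close>

text \<open>
  A finite-dimensional representation is a *-homomorphism into the bounded operators on a
  finite-dimensional Hilbert space, i.e. into the complex \<open>n \<times> n\<close> matrices for some \<open>n\<close>.
\<close>

definition fd_representation ::
  "('a, 'b) cstar_scheme \<Rightarrow> nat \<Rightarrow> ('a \<Rightarrow> complex mat) \<Rightarrow> bool" where
  "fd_representation A n \<pi> \<longleftrightarrow>
     (\<forall>x\<in>carrier A. \<pi> x \<in> carrier_mat n n) \<and>
     (\<forall>x\<in>carrier A. \<forall>y\<in>carrier A. \<pi> (x \<oplus>\<^bsub>A\<^esub> y) = \<pi> x + \<pi> y) \<and>
     (\<forall>c. \<forall>x\<in>carrier A. \<pi> (c \<odot>\<^bsub>A\<^esub> x) = c \<cdot>\<^sub>m \<pi> x) \<and>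
     (\<forall>x\<in>carrier A. \<forall>y\<in>carrier A. \<pi> (x \<otimes>\<^bsub>A\<^esub> y) = \<pi> x * \<pi> y) \<and>
     (\<forall>x\<in>carrier A. \<pi> (adj A x) = mat_adjoint (\<pi> x))"

definition RFD :: "('a, 'b) cstar_scheme \<Rightarrow> bool" where
  "RFD A \<longleftrightarrow>
     (\<exists>F. (\<forall>(n, \<pi>)\<in>F. fd_representation A n \<pi>) \<and>
          (\<forall>a\<in>carrier A. a \<noteq> \<zero>\<^bsub>A\<^esub> \<longrightarrow> (\<exists>(n, \<pi>)\<in>F. \<pi> a \<noteq> 0\<^sub>m n n)))"


section \<open>Directed graphs\<close>

text \<open>
  Graphs are the digraphs of \<open>Graph_Theory\<close> (loops and parallel edges allowed); the source of an
  edge is its \<open>tail\<close> and its range is its \<open>head\<close>.  Finite paths are arc walks: \<open>awalk u p w\<close> says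
  that \<open>p\<close> is a path with source \<open>u\<close> and range \<open>w\<close>, and the empty walk from a vertex to itself is
  that vertex as a path of length \<open>0\<close>.
\<close>

locale countable_digraph = wf_digraph G for G :: "('v, 'e) pre_digraph" (structure) +
  assumes countable_verts: "countable (verts G)"
    and countable_arcs: "countable (arcs G)"

definition sink :: "('v, 'e) pre_digraph \<Rightarrow> 'v \<Rightarrow> bool" where
  "sink G v \<longleftrightarrow> v \<in> verts G \<and> out_arcs G v = {}"

definition infinite_emitter :: "('v, 'e) pre_digraph \<Rightarrow> 'v \<Rightarrow> bool" where
  "infinite_emitter G v \<longleftrightarrow> v \<in> verts G \<and> infinite (out_arcs G v)"

definition infinite_receiver :: "('v, 'e) pre_digraph \<Rightarrow> 'v \<Rightarrow> bool" where
  "infinite_receiver G v \<longleftrightarrow> v \<in> verts G \<and> infinite (in_arcs G v)"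

definition graph_cycle :: "('v, 'e) pre_digraph \<Rightarrow> 'e list \<Rightarrow> bool" where
  "graph_cycle G \<mu> \<longleftrightarrow>
     \<mu> \<noteq> [] \<and> (\<exists>u. pre_digraph.awalk G u \<mu> u) \<and> distinct (map (tail G) \<mu>)"

definition cycle_verts :: "('v, 'e) pre_digraph \<Rightarrow> 'e list \<Rightarrow> 'v set" where
  "cycle_verts G \<mu> = tail G ` set \<mu>"

definition has_exit :: "('v, 'e) pre_digraph \<Rightarrow> 'e list \<Rightarrow> bool" where
  "has_exit G \<mu> \<longleftrightarrow> (\<exists>f\<in>arcs G. f \<notin> set \<mu> \<and> tail G f \<in> cycle_verts G \<mu>)"

definition infinite_backward_chain ::
  "('v, 'e) pre_digraph \<Rightarrow> int set \<Rightarrow> (int \<Rightarrow> 'e) \<Rightarrow> bool" where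
  "infinite_backward_chain G I e \<longleftrightarrow>
     (I = UNIV \<or> I = {..0}) \<and> e ` I \<subseteq> arcs G \<and> inj_on e I \<and>
     (\<forall>i. i \<in> I \<and> i + 1 \<in> I \<longrightarrow> head G (e i) = tail G (e (i + 1)))"


section \<open>The graph C*-algebra\<close>

definition ck_family ::
  "('v, 'e) pre_digraph \<Rightarrow> ('a, 'b) cstar_scheme \<Rightarrow> ('v \<Rightarrow> 'a) \<Rightarrow> ('e \<Rightarrow> 'a) \<Rightarrow> bool" where
  "ck_family G A p s \<longleftrightarrow>
     (\<forall>v\<in>verts G. projection A (p v)) \<and>
     (\<forall>v\<in>verts G. \<forall>w\<in>verts G. v \<noteq> w \<longrightarrow> p v \<otimes>\<^bsub>A\<^esub> p w = \<zero>\<^bsub>A\<^esub>) \<and>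
     (\<forall>e\<in>arcs G. partial_isometry A (s e)) \<and>
     (\<forall>e\<in>arcs G. \<forall>f\<in>arcs G. e \<noteq> f \<longrightarrow> range_proj A (s e) \<otimes>\<^bsub>A\<^esub> range_proj A (s f) = \<zero>\<^bsub>A\<^esub>) \<and>
     (\<forall>e\<in>arcs G. adj A (s e) \<otimes>\<^bsub>A\<^esub> s e = p (head G e)) \<and>
     (\<forall>v\<in>verts G. out_arcs G v \<noteq> {} \<and> finite (out_arcs G v) \<longrightarrow>
        p v = (\<Oplus>\<^bsub>A\<^esub>e\<in>out_arcs G v. s e \<otimes>\<^bsub>A\<^esub> adj A (s e))) \<and>
     (\<forall>e\<in>arcs G. proj_le A (range_proj A (s e)) (p (tail G e)))"

text \<open>
  \<open>graph_cstar_algebra G A p s\<close>: \<open>A\<close> is the universal C*-algebra \<open>C*(G)\<close> with generators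
  \<open>p v\<close>, \<open>s e\<close>; that is, these generate \<open>A\<close> and satisfy the relations, and every family
  satisfying the relations in a C*-algebra \<open>B\<close> is the image of this one under a *-homomorphism
  (unique on the carrier, as \<open>A\<close> is generated by the family).

  HOL cannot quantify over the type of elements of \<open>B\<close>, so \<open>B\<close> ranges over the C*-algebras carried
  by subsets of one fixed type with the cardinality of the continuum.  For countable \<open>G\<close> this is
  no restriction: a countable family in an arbitrary C*-algebra generates a separable
  C*-subalgebra, which has at most continuum many elements, hence an isomorphic copy on a subset
  of that type.
\<close>

definition graph_cstar_algebra ::
  "('v, 'e) pre_digraph \<Rightarrow> ('a, 'b) cstar_scheme \<Rightarrow> ('v \<Rightarrow> 'a) \<Rightarrow> ('e \<Rightarrow> 'a) \<Rightarrow> bool" where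
  "graph_cstar_algebra G A p s \<longleftrightarrow>
     cstar_algebra A \<and> ck_family G A p s \<and>
     cstar_generated_by A (p ` verts G \<union> s ` arcs G) \<and>
     (\<forall>(B :: (nat \<Rightarrow> complex) cstar) q t. cstar_algebra B \<and> ck_family G B q t \<longrightarrow>
        (\<exists>\<phi>. star_hom A B \<phi> \<and> (\<forall>v\<in>verts G. \<phi> (p v) = q v) \<and> (\<forall>e\<in>arcs G. \<phi> (s e) = t e)))"

end

theory Submission
  imports Defs "HOL-Analysis.L2_Norm"
begin

text \<open>
  Every vertex projection is nonzero in \<open>C*(G)\<close>, as one sees from a representation on \<open>\<ell>\<^sup>2\<close> of a
  countable set on which the edges act by partial injections.  If \<open>C*(G)\<close> is RFD, each vertex
  projection therefore has nonzero trace in some finite-dimensional representation.  The trace of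
  \<open>p v\<close> is at least the sum of the traces of \<open>p (r e)\<close> over finitely many edges \<open>e\<close> leaving \<open>v\<close>, with
  equality over all edges when \<open>v\<close> is regular, and orthogonal nonzero projections in the
  \<open>n \<times> n\<close> matrices number at most \<open>n\<close>; each of the four conditions follows.

  Conversely, let \<open>w\<close> be a sink, an infinite emitter or a vertex on a cycle.  By Koenig's lemma
  only finitely many walks end at \<open>w\<close> without visiting it before, and for each \<open>z\<close> on the unit
  circle they span a finite-dimensional representation in which the cycle at \<open>w\<close>, if any, acts as
  \<open>z\<close>.  These representations determine the norm of a linear combination of monomials
  \<open>s\<^sub>\<alpha> s\<^sub>\<beta>\<^sup>*\<close>.  Indeed, cutting an element \<open>y\<close> of degree at most \<open>D\<close> by the projections
  \<open>p v - \<Sum> s e (s e)\<^sup>*\<close> (finite sums, \<open>v\<close> not on a cycle) and \<open>p u\<close> (\<open>u\<close> on a cycle) yields scalars and Laurent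
  polynomials of degree at most \<open>D\<close>, whose coefficients are bounded by the norms of the images of
  \<open>y\<close>.  So the norm of \<open>y\<close> is at most a constant times \<open>(D + 1)\<close> times the supremum of these norms;
  applied to the powers of \<open>y\<^sup>* y\<close>, the linear factor disappears.
\<close>

section \<open>Bounded operators on \<open>\<ell>\<^sup>2\<close> as matrices\<close>

text \<open>The universal property speaks only of C*-algebras whose elements have the type
  \<open>nat \<Rightarrow> complex\<close>, so every operator algebra used for testing is rebuilt on
  that type: an infinite complex matrix is coded as a sequence. Spectrum and functional calculus are
  bypassed; contractivity of a *-homomorphism into operators rests on a single square root, obtained
  by iteration and transported as a polynomial identity. The harder direction has to bound the norm
  of \<open>A\<close> from above although nothing is known about that norm beyond the axioms. This
  is why the corners are made so small that their elements are explicit. Infinite emitters force the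
  subtracted sums to be finite: no relation expresses their vertex projections through edges, but an
  element of the span involves only finitely many edges, and these form the set \<open>F\<close>
  relative to which everything is cut.\<close>

definition vnorm :: "nat \<Rightarrow> (nat \<Rightarrow> complex) \<Rightarrow> real" where
  "vnorm n x = L2_set (\<lambda>i. cmod (x i)) {..<n}"

text \<open>Only finitely supported vectors are tested, so boundedness makes sense before any series
  is known to converge. The form is bilinear; conjugating \<open>y\<close> does not change
  \<open>vnorm\<close>, so the sesquilinear bound is the same.\<close>

definition op_bound :: "(nat \<Rightarrow> nat \<Rightarrow> complex) \<Rightarrow> real \<Rightarrow> bool" where
  "op_bound M C \<longleftrightarrow>
     (\<forall>m n x y. cmod (\<Sum>i<m. \<Sum>j<n. y i * M i j * x j) \<le> C * (vnorm m y * vnorm n x))"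

definition bounded_op :: "(nat \<Rightarrow> nat \<Rightarrow> complex) \<Rightarrow> bool" where
  "bounded_op M \<longleftrightarrow> (\<exists>C. op_bound M C)"

definition op_norm :: "(nat \<Rightarrow> nat \<Rightarrow> complex) \<Rightarrow> real" where
  "op_norm M = Inf {C. 0 \<le> C \<and> op_bound M C}"

definition op_mult :: "(nat \<Rightarrow> nat \<Rightarrow> complex) \<Rightarrow> (nat \<Rightarrow> nat \<Rightarrow> complex) \<Rightarrow> nat \<Rightarrow> nat \<Rightarrow> complex" where
  "op_mult M N = (\<lambda>i j. \<Sum>k. M i k * N k j)"

definition op_adj :: "(nat \<Rightarrow> nat \<Rightarrow> complex) \<Rightarrow> nat \<Rightarrow> nat \<Rightarrow> complex" where
  "op_adj M = (\<lambda>i j. cnj (M j i))"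

lemma vnorm_nonneg [simp]: "0 \<le> vnorm n x"
  by (simp add: vnorm_def L2_set_nonneg)

lemma vnorm_power2: "(vnorm n x)\<^sup>2 = (\<Sum>i<n. (cmod (x i))\<^sup>2)"
  by (simp add: vnorm_def L2_set_def sum_nonneg)

lemma vnorm_cnj [simp]: "vnorm n (\<lambda>i. cnj (x i)) = vnorm n x"
  by (simp add: vnorm_def)

lemma vnorm_delta: "k < n \<Longrightarrow> vnorm n (\<lambda>i. if i = k then c else 0) = cmod c"
proof -
  assume k: "k < n"
  have "(vnorm n (\<lambda>i. if i = k then c else 0))\<^sup>2 = (\<Sum>i<n. if i = k then (cmod c)\<^sup>2 else 0)"
    unfolding vnorm_power2 by (intro sum.cong) auto
  also have "\<dots> = (cmod c)\<^sup>2" using k by simp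
  finally show ?thesis by (simp add: power2_eq_iff_nonneg)
qed

lemma vnorm_Cauchy_Schwarz: "cmod (\<Sum>i<n. x i * y i) \<le> vnorm n x * vnorm n y"
proof -
  have "cmod (\<Sum>i<n. x i * y i) \<le> (\<Sum>i<n. \<bar>cmod (x i)\<bar> * \<bar>cmod (y i)\<bar>)"
    by (rule order_trans[OF norm_sum]) (simp add: norm_mult)
  also have "\<dots> \<le> vnorm n x * vnorm n y"
    unfolding vnorm_def by (rule L2_set_mult_ineq)
  finally show ?thesis .
qed

lemma op_boundD:
  "op_bound M C \<Longrightarrow> cmod (\<Sum>i<m. \<Sum>j<n. y i * M i j * x j) \<le> C * (vnorm m y * vnorm n x)"
  by (simp add: op_bound_def)

lemma op_bound_mono: "op_bound M C \<Longrightarrow> C \<le> D \<Longrightarrow> op_bound M D"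
  unfolding op_bound_def by (meson mult_right_mono mult_nonneg_nonneg order_trans vnorm_nonneg)

text \<open>Testing the form against the conjugate of the image vector turns it into the squared
  norm of that vector, and one factor cancels.\<close>

lemma op_bound_vec:
  assumes "op_bound M C" "0 \<le> C"
  shows "vnorm m (\<lambda>i. \<Sum>j<n. M i j * x j) \<le> C * vnorm n x"
proof -
  define z where "z = (\<lambda>i. \<Sum>j<n. M i j * x j)"
  have "(\<Sum>i<m. \<Sum>j<n. cnj (z i) * M i j * x j) = (\<Sum>i<m. cnj (z i) * z i)"
    by (simp add: z_def sum_distrib_left mult.assoc)
  also have "\<dots> = of_real ((vnorm m z)\<^sup>2)"
    by (simp add: vnorm_power2 complex_norm_square mult.commute del: of_real_power)
  finally have "(vnorm m z)\<^sup>2 = cmod (\<Sum>i<m. \<Sum>j<n. cnj (z i) * M i j * x j)"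
    by (simp only: norm_of_real) simp
  also have "\<dots> \<le> C * (vnorm m z * vnorm n x)"
    using op_boundD[OF assms(1), where m=m and n=n and y="\<lambda>i. cnj (z i)" and x=x] by simp
  finally have *: "vnorm m z * vnorm m z \<le> vnorm m z * (C * vnorm n x)"
    by (simp add: power2_eq_square algebra_simps)
  have "vnorm m z \<le> C * vnorm n x"
  proof (cases "vnorm m z = 0")
    case True then show ?thesis using assms(2) by simp
  next
    case False
    then have "0 < vnorm m z" using vnorm_nonneg[of m z] by linarith
    then show ?thesis using * by (simp add: mult_le_cancel_left_pos)
  qed
  then show ?thesis by (simp add: z_def)
qed

lemma op_bound_of_vec:
  assumes "\<And>m n x. vnorm m (\<lambda>i. \<Sum>j<n. M i j * x j) \<le> C * vnorm n x"
  shows "op_bound M C"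
  unfolding op_bound_def
proof (intro allI)
  fix m n x y
  have "cmod (\<Sum>i<m. \<Sum>j<n. y i * M i j * x j) = cmod (\<Sum>i<m. y i * (\<Sum>j<n. M i j * x j))"
    by (simp add: sum_distrib_left mult.assoc)
  also have "\<dots> \<le> vnorm m y * vnorm m (\<lambda>i. \<Sum>j<n. M i j * x j)"
    by (rule vnorm_Cauchy_Schwarz)
  also have "\<dots> \<le> vnorm m y * (C * vnorm n x)"
    by (intro mult_left_mono assms vnorm_nonneg)
  finally show "cmod (\<Sum>i<m. \<Sum>j<n. y i * M i j * x j) \<le> C * (vnorm m y * vnorm n x)"
    by (simp add: algebra_simps)
qed

lemma op_bound_adj:
  assumes "op_bound M C" shows "op_bound (op_adj M) C"
  unfolding op_bound_def
proof (intro allI)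
  fix m n x y
  have "(\<Sum>i<m. \<Sum>j<n. y i * op_adj M i j * x j)
      = cnj (\<Sum>j<n. \<Sum>i<m. cnj (x j) * M j i * cnj (y i))"
    by (subst sum.swap) (simp add: op_adj_def mult_ac)
  then have "cmod (\<Sum>i<m. \<Sum>j<n. y i * op_adj M i j * x j)
      = cmod (\<Sum>j<n. \<Sum>i<m. cnj (x j) * M j i * cnj (y i))"
    by (simp only: complex_mod_cnj)
  also have "\<dots> \<le> C * (vnorm n x * vnorm m y)"
    using op_boundD[OF assms, where m=n and n=m and y="\<lambda>j. cnj (x j)" and x="\<lambda>i. cnj (y i)"] by simp
  finally show "cmod (\<Sum>i<m. \<Sum>j<n. y i * op_adj M i j * x j) \<le> C * (vnorm m y * vnorm n x)"
    by (simp add: mult_ac)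
qed

lemma op_adj_adj [simp]: "op_adj (op_adj M) = M"
  by (simp add: op_adj_def)

lemma op_bound_transpose_vec:
  assumes "op_bound M C" "0 \<le> C"
  shows "vnorm n (\<lambda>j. \<Sum>i<m. y i * M i j) \<le> C * vnorm m y"
proof -
  have "vnorm n (\<lambda>j. \<Sum>i<m. y i * M i j)
      = vnorm n (\<lambda>j. cnj (\<Sum>i<m. op_adj M j i * cnj (y i)))"
    by (simp add: op_adj_def mult.commute)
  also have "\<dots> \<le> C * vnorm m y"
    using op_bound_vec[OF op_bound_adj[OF assms(1)] assms(2), where m=n and n=m and x="\<lambda>i. cnj (y i)"]
    by (simp del: cnj_sum)
  finally show ?thesis .
qed

lemma op_bound_nonneg_ex: "op_bound M C \<Longrightarrow> op_bound M \<bar>C\<bar>"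
  by (rule op_bound_mono) auto

lemma op_norm_bdd: "bdd_below {C. 0 \<le> C \<and> op_bound M C}"
  by (rule bdd_belowI[of _ 0]) auto

lemma op_norm_nonempty: "bounded_op M \<Longrightarrow> {C. 0 \<le> C \<and> op_bound M C} \<noteq> {}"
  unfolding bounded_op_def using op_bound_nonneg_ex abs_ge_zero by blast

lemma op_norm_nonneg: "bounded_op M \<Longrightarrow> 0 \<le> op_norm M"
  unfolding op_norm_def by (intro cInf_greatest op_norm_nonempty) auto

lemma op_norm_le: "0 \<le> C \<Longrightarrow> op_bound M C \<Longrightarrow> op_norm M \<le> C"
  unfolding op_norm_def by (intro cInf_lower op_norm_bdd) auto

text \<open>The infimum is attained, because each instance of the bound is a closed condition on the
  constant. Where the product of the two vector norms is 0, any admissible constant already forces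
  the form to vanish.\<close>

lemma op_bound_op_norm:
  assumes "bounded_op M" shows "op_bound M (op_norm M)"
  unfolding op_bound_def
proof (intro allI)
  fix m n x y
  define k where "k = vnorm m y * vnorm n x"
  define l where "l = cmod (\<Sum>i<m. \<Sum>j<n. y i * M i j * x j)"
  have k0: "0 \<le> k" by (simp add: k_def)
  have b: "l \<le> C * k" if "op_bound M C" for C
    using op_boundD[OF that] by (simp add: k_def l_def)
  show "l \<le> op_norm M * k"
  proof (cases "k = 0")
    case True
    then show ?thesis using op_norm_nonempty[OF assms] b by fastforce
  next
    case False
    then have "0 < k" using k0 by simp
    then have "l / k \<le> op_norm M"
      unfolding op_norm_def using b by (intro cInf_greatest op_norm_nonempty assms) (auto simp: field_simps)
    with \<open>0 < k\<close> show ?thesis by (simp add: field_simps)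
  qed
qed

lemma bounded_opI: "op_bound M C \<Longrightarrow> bounded_op M"
  by (auto simp: bounded_op_def)

lemma op_bound_entry:
  assumes "op_bound M C" shows "cmod (M i j) \<le> C"
proof -
  let ?y = "\<lambda>a. if a = i then 1 else 0" and ?x = "\<lambda>b. if b = j then 1 else (0::complex)"
  have "(\<Sum>a<Suc i. \<Sum>b<Suc j. ?y a * M a b * ?x b) = (\<Sum>a<Suc i. if a = i then M a j else 0)"
  proof (rule sum.cong[OF refl])
    fix a
    have "(\<Sum>b<Suc j. ?y a * M a b * ?x b) = (\<Sum>b<Suc j. if b = j then ?y a * M a b else 0)"
      by (rule sum.cong) auto
    also have "\<dots> = ?y a * M a j" by (subst sum.delta) auto
    finally show "(\<Sum>b<Suc j. ?y a * M a b * ?x b) = (if a = i then M a j else 0)" by auto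
  qed
  also have "\<dots> = M i j" by (subst sum.delta) auto
  finally show ?thesis
    using op_boundD[OF assms, where m="Suc i" and n="Suc j" and y="?y" and x="?x"] by (simp add: vnorm_delta)
qed

lemma op_bound_add:
  assumes "op_bound M C" "op_bound N D"
  shows "op_bound (\<lambda>i j. M i j + N i j) (C + D)"
  unfolding op_bound_def
proof (intro allI)
  fix m n x y
  have "cmod (\<Sum>i<m. \<Sum>j<n. y i * (M i j + N i j) * x j)
      = cmod ((\<Sum>i<m. \<Sum>j<n. y i * M i j * x j) + (\<Sum>i<m. \<Sum>j<n. y i * N i j * x j))"
    by (simp add: sum.distrib algebra_simps)
  also have "\<dots> \<le> C * (vnorm m y * vnorm n x) + D * (vnorm m y * vnorm n x)"
    by (intro norm_triangle_le add_mono op_boundD assms)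
  finally show "cmod (\<Sum>i<m. \<Sum>j<n. y i * (M i j + N i j) * x j)
      \<le> (C + D) * (vnorm m y * vnorm n x)" by (simp add: algebra_simps)
qed

lemma op_bound_smult:
  assumes "op_bound M C"
  shows "op_bound (\<lambda>i j. c * M i j) (cmod c * C)"
  unfolding op_bound_def
proof (intro allI)
  fix m n x y
  have "(\<Sum>i<m. \<Sum>j<n. y i * (c * M i j) * x j) = c * (\<Sum>i<m. \<Sum>j<n. y i * M i j * x j)"
    by (simp add: sum_distrib_left mult_ac)
  then show "cmod (\<Sum>i<m. \<Sum>j<n. y i * (c * M i j) * x j)
      \<le> cmod c * C * (vnorm m y * vnorm n x)"
    using mult_left_mono[OF op_boundD[OF assms, where m=m and n=n and y=y and x=x], of "cmod c"]
    by (simp add: norm_mult mult.assoc)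
qed

lemma op_bound_0: "op_bound (\<lambda>i j. 0) 0"
  by (simp add: op_bound_def)

lemma bounded_op_0 [simp]: "bounded_op (\<lambda>i j. 0)"
  using op_bound_0 by (rule bounded_opI)

lemma bounded_op_add: "bounded_op M \<Longrightarrow> bounded_op N \<Longrightarrow> bounded_op (\<lambda>i j. M i j + N i j)"
  unfolding bounded_op_def using op_bound_add by blast

lemma bounded_op_smult: "bounded_op M \<Longrightarrow> bounded_op (\<lambda>i j. c * M i j)"
  unfolding bounded_op_def using op_bound_smult by blast

lemma bounded_op_adj: "bounded_op M \<Longrightarrow> bounded_op (op_adj M)"
  unfolding bounded_op_def using op_bound_adj by blast

lemma op_norm_adj: "op_norm (op_adj M) = op_norm M"
proof -
  have "op_bound (op_adj M) C \<longleftrightarrow> op_bound M C" for C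
    using op_bound_adj[of M C] op_bound_adj[of "op_adj M" C] by auto
  then show ?thesis by (simp add: op_norm_def)
qed

lemma op_norm_add:
  "bounded_op M \<Longrightarrow> bounded_op N \<Longrightarrow> op_norm (\<lambda>i j. M i j + N i j) \<le> op_norm M + op_norm N"
  by (intro op_norm_le op_bound_add op_bound_op_norm add_nonneg_nonneg op_norm_nonneg)

lemma op_norm_smult_le:
  "bounded_op M \<Longrightarrow> op_norm (\<lambda>i j. c * M i j) \<le> cmod c * op_norm M"
  by (intro op_norm_le op_bound_smult op_bound_op_norm mult_nonneg_nonneg op_norm_nonneg) auto

lemma op_norm_zero [simp]: "op_norm (\<lambda>i j. 0) = 0"
  using op_norm_le[OF _ op_bound_0] op_norm_nonneg[OF bounded_op_0] by (simp add: order_antisym)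

lemma op_norm_smult:
  assumes "bounded_op M"
  shows "op_norm (\<lambda>i j. c * M i j) = cmod c * op_norm M"
proof (cases "c = 0")
  case False
  have "op_norm M = op_norm (\<lambda>i j. inverse c * (c * M i j))"
    using False by (simp add: mult.assoc[symmetric])
  also have "\<dots> \<le> cmod (inverse c) * op_norm (\<lambda>i j. c * M i j)"
    by (rule op_norm_smult_le[OF bounded_op_smult[OF assms]])
  finally have "cmod c * op_norm M \<le> cmod c * (cmod (inverse c) * op_norm (\<lambda>i j. c * M i j))"
    by (rule mult_left_mono) simp
  then have "cmod c * op_norm M \<le> op_norm (\<lambda>i j. c * M i j)"
    using False by (simp add: norm_inverse mult.assoc[symmetric])
  then show ?thesis using op_norm_smult_le[OF assms, of c] by simp
qed simp

lemma op_norm_eq_0: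
  assumes "bounded_op M" "op_norm M = 0" shows "M i j = 0"
  using op_bound_entry[OF op_bound_op_norm[OF assms(1)], of i j] assms(2) by simp

lemma entry_le_op_norm: "bounded_op M \<Longrightarrow> cmod (M i j) \<le> op_norm M"
  by (rule op_bound_entry[OF op_bound_op_norm])

section \<open>Products of infinite matrices\<close>

lemma vnorm_col:
  assumes "op_bound M C" "0 \<le> C" shows "vnorm n (\<lambda>i. M i j) \<le> C"
proof -
  have "(\<Sum>k<Suc j. M i k * (if k = j then 1 else 0)) = M i j" for i
  proof -
    have "(\<Sum>k<Suc j. M i k * (if k = j then 1 else 0)) = (\<Sum>k<Suc j. if k = j then M i k else 0)"
      by (rule sum.cong) auto
    then show ?thesis by simp
  qed
  then show ?thesis
    using op_bound_vec[OF assms, where m=n and n="Suc j" and x="\<lambda>k. if k = j then 1 else 0"]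
    by (simp add: vnorm_delta)
qed

lemma vnorm_row:
  assumes "op_bound M C" "0 \<le> C" shows "vnorm n (\<lambda>j. M i j) \<le> C"
  using vnorm_col[OF op_bound_adj[OF assms(1)] assms(2), of n i]
  by (simp add: op_adj_def)

lemma summable_sq_of_vnorm:
  assumes "\<And>n. vnorm n x \<le> C"
  shows "summable (\<lambda>i. (cmod (x i))\<^sup>2)"
proof (rule summableI_nonneg_bounded[where x = "C\<^sup>2"])
  show "(\<Sum>i<n. (cmod (x i))\<^sup>2) \<le> C\<^sup>2" for n
    using assms[of n] by (simp flip: vnorm_power2 add: power_mono)
qed simp

lemma summable_mult_sq:
  assumes "summable (\<lambda>i. (cmod (x i))\<^sup>2)" "summable (\<lambda>i. (cmod (y i))\<^sup>2)"
  shows "summable (\<lambda>i. x i * y i)"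
proof (rule summable_comparison_test[OF _ summable_add[OF assms]])
  have "cmod (x i * y i) \<le> (cmod (x i))\<^sup>2 + (cmod (y i))\<^sup>2" for i
  proof -
    have "0 \<le> (cmod (x i) - cmod (y i))\<^sup>2" by simp
    moreover have "0 \<le> (cmod (x i))\<^sup>2 + (cmod (y i))\<^sup>2" by simp
    ultimately show ?thesis unfolding norm_mult power2_diff by linarith
  qed
  then show "\<exists>N. \<forall>n\<ge>N. cmod (x n * y n) \<le> (cmod (x n))\<^sup>2 + (cmod (y n))\<^sup>2" by blast
qed

lemma bounded_op_vecE:
  assumes "bounded_op M"
  obtains C where "0 \<le> C" "op_bound M C"
  using assms op_bound_nonneg_ex abs_ge_zero unfolding bounded_op_def by blast

lemma summable_col: "bounded_op M \<Longrightarrow> summable (\<lambda>i. (cmod (M i j))\<^sup>2)"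
  by (metis bounded_op_vecE summable_sq_of_vnorm vnorm_col)

lemma summable_row: "bounded_op M \<Longrightarrow> summable (\<lambda>j. (cmod (M i j))\<^sup>2)"
  by (metis bounded_op_vecE summable_sq_of_vnorm vnorm_row)

lemma summable_op_mult:
  "bounded_op M \<Longrightarrow> bounded_op N \<Longrightarrow> summable (\<lambda>k. M i k * N k j)"
  by (intro summable_mult_sq summable_row summable_col)

text \<open>Pairing a product with two finitely supported vectors pairs a row combination of
  \<open>M\<close> with a column combination of \<open>N\<close>; only finite sums are moved through
  the defining series.\<close>

lemma op_mult_form_sums:
  assumes "bounded_op M" "bounded_op N"
  shows "(\<lambda>k. (\<Sum>i<m. y i * M i k) * (\<Sum>j<n. N k j * x j))
    sums (\<Sum>i<m. \<Sum>j<n. y i * op_mult M N i j * x j)"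
proof -
  have "(\<lambda>k. y i * (M i k * N k j) * x j) sums (y i * op_mult M N i j * x j)" for i j
    unfolding op_mult_def
    by (intro sums_mult2 sums_mult summable_sums summable_op_mult assms)
  then have "(\<lambda>k. \<Sum>i<m. \<Sum>j<n. y i * (M i k * N k j) * x j)
      sums (\<Sum>i<m. \<Sum>j<n. y i * op_mult M N i j * x j)"
    by (intro sums_sum) blast
  moreover have "(\<Sum>i<m. \<Sum>j<n. y i * (M i k * N k j) * x j)
      = (\<Sum>i<m. y i * M i k) * (\<Sum>j<n. N k j * x j)" for k
    by (simp add: sum_product mult.assoc)
  ultimately show ?thesis by simp
qed

text \<open>Partial sums over the middle index obey Cauchy-Schwarz with constants that do not depend
  on where the series is cut, so the bound survives the limit.\<close>

lemma op_bound_mult: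
  assumes "op_bound M C" "0 \<le> C" "op_bound N D" "0 \<le> D"
  shows "op_bound (op_mult M N) (C * D)"
  unfolding op_bound_def
proof (intro allI)
  fix m n x y
  let ?r = "\<lambda>k. \<Sum>i<m. y i * M i k" and ?t = "\<lambda>k. \<Sum>j<n. N k j * x j"
  have "(\<lambda>K. \<Sum>k<K. ?r k * ?t k) \<longlonglongrightarrow> (\<Sum>i<m. \<Sum>j<n. y i * op_mult M N i j * x j)"
    using op_mult_form_sums[OF bounded_opI[OF assms(1)] bounded_opI[OF assms(3)], where m=m and n=n and x=x and y=y]
    by (simp add: sums_def)
  then have lim: "(\<lambda>K. cmod (\<Sum>k<K. ?r k * ?t k))
      \<longlonglongrightarrow> cmod (\<Sum>i<m. \<Sum>j<n. y i * op_mult M N i j * x j)"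
    by (rule tendsto_norm)
  have "cmod (\<Sum>k<K. ?r k * ?t k) \<le> C * D * (vnorm m y * vnorm n x)" for K
  proof -
    have "cmod (\<Sum>k<K. ?r k * ?t k) \<le> vnorm K ?r * vnorm K ?t" by (rule vnorm_Cauchy_Schwarz)
    also have "\<dots> \<le> (C * vnorm m y) * (D * vnorm n x)"
      by (intro mult_mono op_bound_vec op_bound_transpose_vec assms mult_nonneg_nonneg) auto
    finally show ?thesis by (simp add: mult_ac)
  qed
  then show "cmod (\<Sum>i<m. \<Sum>j<n. y i * op_mult M N i j * x j) \<le> C * D * (vnorm m y * vnorm n x)"
    by (intro LIMSEQ_le_const2[OF lim]) blast
qed

lemma bounded_op_mult: "bounded_op M \<Longrightarrow> bounded_op N \<Longrightarrow> bounded_op (op_mult M N)"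
  by (metis bounded_op_vecE bounded_opI op_bound_mult)

lemma op_norm_mult:
  "bounded_op M \<Longrightarrow> bounded_op N \<Longrightarrow> op_norm (op_mult M N) \<le> op_norm M * op_norm N"
  by (intro op_norm_le op_bound_mult op_bound_op_norm mult_nonneg_nonneg op_norm_nonneg)

lemma op_mult_add_left:
  "bounded_op M \<Longrightarrow> bounded_op M' \<Longrightarrow> bounded_op N \<Longrightarrow>
   op_mult (\<lambda>i j. M i j + M' i j) N = (\<lambda>i j. op_mult M N i j + op_mult M' N i j)"
  by (simp add: op_mult_def distrib_right suminf_add summable_op_mult)

lemma op_mult_add_right:
  "bounded_op M \<Longrightarrow> bounded_op N \<Longrightarrow> bounded_op N' \<Longrightarrow>
   op_mult M (\<lambda>i j. N i j + N' i j) = (\<lambda>i j. op_mult M N i j + op_mult M N' i j)"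
  by (simp add: op_mult_def distrib_left suminf_add summable_op_mult)

lemma op_mult_smult_left:
  "bounded_op M \<Longrightarrow> bounded_op N \<Longrightarrow> op_mult (\<lambda>i j. c * M i j) N = (\<lambda>i j. c * op_mult M N i j)"
  by (simp add: op_mult_def mult.assoc suminf_mult summable_op_mult)

lemma op_mult_smult_right:
  "bounded_op M \<Longrightarrow> bounded_op N \<Longrightarrow> op_mult M (\<lambda>i j. c * N i j) = (\<lambda>i j. c * op_mult M N i j)"
  by (simp add: op_mult_def mult.left_commute suminf_mult summable_op_mult)

lemma op_adj_mult:
  "bounded_op M \<Longrightarrow> bounded_op N \<Longrightarrow> op_adj (op_mult M N) = op_mult (op_adj N) (op_adj M)"
proof (intro ext)
  fix i j assume "bounded_op M" "bounded_op N"
  then have "(\<lambda>k. cnj (M j k * N k i)) sums cnj (\<Sum>k. M j k * N k i)"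
    by (intro iffD2[OF sums_cnj] summable_sums summable_op_mult)
  then show "op_adj (op_mult M N) i j = op_mult (op_adj N) (op_adj M) i j"
    by (simp add: op_adj_def op_mult_def sums_iff mult.commute)
qed

lemma vnorm_truncate:
  assumes "m \<le> n"
  shows "(vnorm n (\<lambda>i. if i < m then 0 else x i))\<^sup>2 = (\<Sum>i<n. (cmod (x i))\<^sup>2) - (\<Sum>i<m. (cmod (x i))\<^sup>2)"
proof -
  have "(\<Sum>i<n. (cmod (x i))\<^sup>2) = (\<Sum>i<m. (cmod (x i))\<^sup>2) + (\<Sum>i=m..<n. (cmod (x i))\<^sup>2)"
    using assms by (metis lessThan_atLeast0 sum.atLeastLessThan_concat zero_le)
  moreover have "(vnorm n (\<lambda>i. if i < m then 0 else x i))\<^sup>2 = (\<Sum>i=m..<n. (cmod (x i))\<^sup>2)"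
    unfolding vnorm_power2 by (rule sum.mono_neutral_cong_right) auto
  ultimately show ?thesis by simp
qed

text \<open>The double series need not converge absolutely; the sums are exchanged by
  estimating the error of truncating the second one.\<close>

lemma op_mult_assoc:
  assumes M: "bounded_op M" and N: "bounded_op N" and P: "bounded_op P"
  shows "op_mult (op_mult M N) P = op_mult M (op_mult N P)"
proof (intro ext)
  fix i j
  obtain CM where CM: "0 \<le> CM" "op_bound M CM" using M by (rule bounded_op_vecE)
  obtain CN where CN: "0 \<le> CN" "op_bound N CN" using N by (rule bounded_op_vecE)
  define u where "u = (\<lambda>l. P l j)"
  define v where "v = (\<lambda>k. M i k)"
  define s where "s = (\<Sum>l. (cmod (u l))\<^sup>2)"
  have su: "summable (\<lambda>l. (cmod (u l))\<^sup>2)" unfolding u_def by (rule summable_col[OF P])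
  \<comment> \<open>The left side with its outer series cut after \<open>L\<close> terms; here the
    exchange is legitimate, since one of the two sums is finite.\<close>
  define F where "F = (\<lambda>L. \<Sum>l<L. (\<Sum>k. v k * N k l) * u l)"
  have F1: "F \<longlonglongrightarrow> op_mult (op_mult M N) P i j"
    using summable_op_mult[OF bounded_op_mult[OF M N] P, of i j]
    unfolding F_def summable_sums_iff sums_def by (simp add: op_mult_def u_def v_def)
  have F2: "(\<lambda>k. v k * (\<Sum>l<L. N k l * u l)) sums F L" for L
  proof -
    have "(\<lambda>k. \<Sum>l<L. (v k * N k l) * u l) sums F L"
      unfolding F_def v_def
      by (intro sums_sum sums_mult2 summable_sums summable_op_mult M N)
    then show ?thesis by (simp add: sum_distrib_left mult.assoc)
  qed
  have R: "(\<lambda>k. v k * (\<Sum>l. N k l * u l)) sums op_mult M (op_mult N P) i j"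
    using summable_sums[OF summable_op_mult[OF M bounded_op_mult[OF N P], of i j]]
    by (simp add: op_mult_def u_def v_def)
  \<comment> \<open>The two operator bounds times the l2 norm of the tail of the column
    \<open>u\<close> from \<open>L\<close> on.\<close>
  define t where "t = (\<lambda>L. CM * (CN * sqrt (s - (\<Sum>i<L. (cmod (u i))\<^sup>2))))"
  have bound: "cmod (op_mult M (op_mult N P) i j - F L) \<le> t L" for L
  proof -
    have D: "(\<lambda>k. v k * ((\<Sum>l. N k l * u l) - (\<Sum>l<L. N k l * u l)))
        sums (op_mult M (op_mult N P) i j - F L)"
      using sums_diff[OF R F2[of L]] by (simp add: algebra_simps)
    have "cmod (\<Sum>k<K. v k * ((\<Sum>l. N k l * u l) - (\<Sum>l<L. N k l * u l))) \<le> t L" for K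
    proof -
      have "(\<lambda>L'. \<Sum>k<K. v k * ((\<Sum>l<L'. N k l * u l) - (\<Sum>l<L. N k l * u l)))
          \<longlonglongrightarrow> (\<Sum>k<K. v k * ((\<Sum>l. N k l * u l) - (\<Sum>l<L. N k l * u l)))"
        unfolding u_def
        by (intro tendsto_intros summable_LIMSEQ summable_op_mult N P)
      then have lim: "(\<lambda>L'. cmod (\<Sum>k<K. v k * ((\<Sum>l<L'. N k l * u l) - (\<Sum>l<L. N k l * u l))))
          \<longlonglongrightarrow> cmod (\<Sum>k<K. v k * ((\<Sum>l. N k l * u l) - (\<Sum>l<L. N k l * u l)))"
        by (rule tendsto_norm)
      have "cmod (\<Sum>k<K. v k * ((\<Sum>l<L'. N k l * u l) - (\<Sum>l<L. N k l * u l))) \<le> t L"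
        if "L \<le> L'" for L'
      proof -
        define u' where "u' = (\<lambda>l. if l < L then 0 else u l)"
        have "(\<Sum>l<L'. N k l * u l) - (\<Sum>l<L. N k l * u l) = (\<Sum>l<L'. N k l * u' l)" for k
        proof -
          have "(\<Sum>l<L'. N k l * u l) = (\<Sum>l<L. N k l * u l) + (\<Sum>l=L..<L'. N k l * u l)"
            using that by (metis lessThan_atLeast0 sum.atLeastLessThan_concat zero_le)
          moreover have "(\<Sum>l<L'. N k l * u' l) = (\<Sum>l=L..<L'. N k l * u l)"
            unfolding u'_def by (rule sum.mono_neutral_cong_right) auto
          ultimately show ?thesis by simp
        qed
        then have "cmod (\<Sum>k<K. v k * ((\<Sum>l<L'. N k l * u l) - (\<Sum>l<L. N k l * u l)))
            \<le> vnorm K v * vnorm K (\<lambda>k. \<Sum>l<L'. N k l * u' l)"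
          by (simp add: vnorm_Cauchy_Schwarz)
        also have "\<dots> \<le> CM * (CN * vnorm L' u')"
          unfolding v_def by (intro mult_mono op_bound_vec vnorm_row CM CN) auto
        also have "\<dots> \<le> t L"
        proof -
          have "(vnorm L' u')\<^sup>2 \<le> s - (\<Sum>i<L. (cmod (u i))\<^sup>2)"
            unfolding u'_def vnorm_truncate[OF that] s_def using sum_le_suminf[OF su, of "{..<L'}"] by simp
          then have "vnorm L' u' \<le> sqrt (s - (\<Sum>i<L. (cmod (u i))\<^sup>2))"
            by (simp add: real_le_rsqrt)
          then show ?thesis unfolding t_def using CM CN by (intro mult_left_mono) auto
        qed
        finally show ?thesis .
      qed
      then show ?thesis by (intro LIMSEQ_le_const2[OF lim]) blast
    qed
    then show ?thesis
      using tendsto_norm[OF D[unfolded sums_def]] by (intro LIMSEQ_le_const2) blast+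
  qed
  have "(\<lambda>L. \<Sum>i<L. (cmod (u i))\<^sup>2) \<longlonglongrightarrow> s"
    unfolding s_def by (rule summable_LIMSEQ[OF su])
  then have "t \<longlonglongrightarrow> CM * (CN * sqrt (s - s))"
    unfolding t_def by (intro tendsto_intros)
  then have t0: "t \<longlonglongrightarrow> 0" by simp
  have "(\<lambda>L. op_mult M (op_mult N P) i j - F L) \<longlonglongrightarrow> 0"
    by (rule tendsto_0_le[OF t0, where K=1]) (simp add: bound order_trans[OF _ abs_ge_self])
  from tendsto_diff[OF tendsto_const[of "op_mult M (op_mult N P) i j"] this]
  have "F \<longlonglongrightarrow> op_mult M (op_mult N P) i j" by simp
  then show "op_mult (op_mult M N) P i j = op_mult M (op_mult N P) i j"
    using F1 LIMSEQ_unique by blast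
qed

lemma op_adj_mult_form_sums:
  assumes "bounded_op M"
  shows "(\<lambda>k. of_real ((cmod (\<Sum>j<n. M k j * x j))\<^sup>2))
    sums (\<Sum>i<n. \<Sum>j<n. cnj (x i) * op_mult (op_adj M) M i j * x j)"
proof -
  have "(\<Sum>i<n. cnj (x i) * op_adj M i k) * (\<Sum>j<n. M k j * x j)
      = of_real ((cmod (\<Sum>j<n. M k j * x j))\<^sup>2)" for k
  proof -
    have "(\<Sum>i<n. cnj (x i) * op_adj M i k) = cnj (\<Sum>j<n. M k j * x j)"
      by (simp add: op_adj_def mult.commute)
    then show ?thesis by (simp only: complex_norm_square mult.commute)
  qed
  then show ?thesis
    using op_mult_form_sums[OF bounded_op_adj[OF assms] assms, where m=n and y="\<lambda>i. cnj (x i)" and n=n and x=x] by simp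
qed

text \<open>The form of the product at \<open>x\<close> is the squared norm of \<open>M x\<close>.
  This is the nontrivial half of the C*-identity.\<close>

lemma op_bound_sqrt:
  assumes "bounded_op M" "op_bound (op_mult (op_adj M) M) C" "0 \<le> C"
  shows "op_bound M (sqrt C)"
proof (rule op_bound_of_vec)
  fix m n x
  have "(\<Sum>k<m. (cmod (\<Sum>j<n. M k j * x j))\<^sup>2) \<le> C * (vnorm n x)\<^sup>2"
  proof -
    let ?f = "\<lambda>k. (cmod (\<Sum>j<n. M k j * x j))\<^sup>2"
    have sm: "(\<lambda>k. of_real (?f k)) sums (\<Sum>i<n. \<Sum>j<n. cnj (x i) * op_mult (op_adj M) M i j * x j)"
      by (rule op_adj_mult_form_sums[OF assms(1)])
    then have s2: "?f sums Re (\<Sum>i<n. \<Sum>j<n. cnj (x i) * op_mult (op_adj M) M i j * x j)"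
      using sums_Re by force
    then have "(\<Sum>k<m. ?f k) \<le> Re (\<Sum>i<n. \<Sum>j<n. cnj (x i) * op_mult (op_adj M) M i j * x j)"
      using sum_le_suminf[of ?f "{..<m}"] by (simp add: sums_iff)
    also have "\<dots> \<le> cmod (\<Sum>i<n. \<Sum>j<n. cnj (x i) * op_mult (op_adj M) M i j * x j)"
      by (rule complex_Re_le_cmod)
    also have "\<dots> \<le> C * (vnorm n x)\<^sup>2"
      using op_boundD[OF assms(2), where m=n and n=n and y="\<lambda>i. cnj (x i)" and x=x] by (simp add: power2_eq_square)
    finally show ?thesis .
  qed
  then have "(vnorm m (\<lambda>i. \<Sum>j<n. M i j * x j))\<^sup>2 \<le> (sqrt C * vnorm n x)\<^sup>2"
    using assms(3) by (simp add: vnorm_power2 power_mult_distrib)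
  then show "vnorm m (\<lambda>i. \<Sum>j<n. M i j * x j) \<le> sqrt C * vnorm n x"
    using assms(3) by (simp add: power2_le_iff_abs_le abs_le_square_iff)
qed

lemma op_norm_cstar:
  assumes "bounded_op M"
  shows "op_norm (op_mult (op_adj M) M) = (op_norm M)\<^sup>2"
proof (rule antisym)
  show "op_norm (op_mult (op_adj M) M) \<le> (op_norm M)\<^sup>2"
    using op_norm_mult[OF bounded_op_adj[OF assms] assms]
    by (simp add: op_norm_adj power2_eq_square)
next
  let ?c = "op_norm (op_mult (op_adj M) M)"
  have b: "bounded_op (op_mult (op_adj M) M)"
    by (intro bounded_op_mult bounded_op_adj assms)
  have "op_norm M \<le> sqrt ?c"
    by (intro op_norm_le op_bound_sqrt assms op_bound_op_norm b) (auto intro: op_norm_nonneg b)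
  then have "(op_norm M)\<^sup>2 \<le> (sqrt ?c)\<^sup>2"
    by (intro power_mono op_norm_nonneg assms)
  then show "(op_norm M)\<^sup>2 \<le> ?c" using op_norm_nonneg[OF b] by simp
qed

text \<open>The limit is taken entry by entry, and the Cauchy bounds pass to it because each
  instance of \<open>op_bound\<close> involves finitely many entries. Entrywise convergence is part
  of the conclusion so that the support condition of \<open>Bop\<close> can be carried over to the
  limit.\<close>

lemma op_complete:
  assumes b: "\<And>n. bounded_op (U n)"
    and C: "\<And>e. e > 0 \<Longrightarrow> \<exists>N. \<forall>m\<ge>N. \<forall>n\<ge>N. op_norm (\<lambda>i j. U m i j - U n i j) < e"
  obtains L where "bounded_op L" "(\<lambda>n. op_norm (\<lambda>i j. U n i j - L i j)) \<longlonglongrightarrow> 0"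
    "\<And>i j. (\<lambda>n. U n i j) \<longlonglongrightarrow> L i j"
proof -
  have bd: "bounded_op (\<lambda>i j. U m i j - U n i j)" for m n
    using bounded_op_add[OF b[of m] bounded_op_smult[OF b[of n], of "-1"]] by simp
  have "Cauchy (\<lambda>n. U n i j)" for i j
  proof (rule metric_CauchyI)
    fix e :: real assume "e > 0"
    from C[OF this] show "\<exists>M. \<forall>m\<ge>M. \<forall>n\<ge>M. dist (U m i j) (U n i j) < e"
      unfolding dist_norm using entry_le_op_norm[OF bd] by (meson le_less_trans)
  qed
  then have "\<forall>i j. \<exists>l. (\<lambda>n. U n i j) \<longlonglongrightarrow> l"
    using Cauchy_convergent_iff convergent_def by blast
  then obtain L where L: "\<And>i j. (\<lambda>n. U n i j) \<longlonglongrightarrow> L i j" by metis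
  have close: "op_bound (\<lambda>i j. U m i j - L i j) e" if "\<forall>n\<ge>m. op_norm (\<lambda>i j. U m i j - U n i j) < e" for m e
    unfolding op_bound_def
  proof (intro allI)
    fix m' n' x y
    let ?f = "\<lambda>n. cmod (\<Sum>i<m'. \<Sum>j<n'. y i * (U m i j - U n i j) * x j)"
    have lim: "?f \<longlonglongrightarrow> cmod (\<Sum>i<m'. \<Sum>j<n'. y i * (U m i j - L i j) * x j)"
      by (intro tendsto_intros L)
    have "?f n \<le> e * (vnorm m' y * vnorm n' x)" if "n \<ge> m" for n
    proof -
      have "op_norm (\<lambda>i j. U m i j - U n i j) \<le> e"
        using \<open>\<forall>n\<ge>m. op_norm (\<lambda>i j. U m i j - U n i j) < e\<close> that by auto
      from op_bound_mono[OF op_bound_op_norm[OF bd] this] show ?thesis by (rule op_boundD)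
    qed
    then show "cmod (\<Sum>i<m'. \<Sum>j<n'. y i * (U m i j - L i j) * x j) \<le> e * (vnorm m' y * vnorm n' x)"
      by (intro LIMSEQ_le_const2[OF lim]) blast
  qed
  obtain N where N: "\<forall>m\<ge>N. \<forall>n\<ge>N. op_norm (\<lambda>i j. U m i j - U n i j) < 1" using C[of 1] by auto
  have "bounded_op (\<lambda>i j. U N i j - L i j)" using close[of N 1] N by (intro bounded_opI) auto
  from bounded_op_add[OF b[of N] bounded_op_smult[OF this, of "-1"]]
  have bL: "bounded_op L" by simp
  have "(\<lambda>n. op_norm (\<lambda>i j. U n i j - L i j)) \<longlonglongrightarrow> 0"
  proof (rule LIMSEQ_I)
    fix r :: real assume "r > 0"
    then obtain N where N: "\<forall>m\<ge>N. \<forall>n\<ge>N. op_norm (\<lambda>i j. U m i j - U n i j) < r/2"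
      using C[of "r/2"] by auto
    have "norm (op_norm (\<lambda>i j. U n i j - L i j) - 0) < r" if "n \<ge> N" for n
    proof -
      have *: "op_bound (\<lambda>i j. U n i j - L i j) (r/2)" using close[of n "r/2"] N that by auto
      from op_norm_le[OF _ this] op_norm_nonneg[OF bounded_opI[OF *]] show ?thesis
        using \<open>r > 0\<close> by simp
    qed
    then show "\<exists>no. \<forall>n\<ge>no. norm (op_norm (\<lambda>i j. U n i j - L i j) - 0) < r" by blast
  qed
  then show ?thesis using that bL L by blast
qed

section \<open>The C*-algebra of bounded operators on l2 of an index set\<close>

definition ent :: "(nat \<Rightarrow> complex) \<Rightarrow> nat \<Rightarrow> nat \<Rightarrow> complex" where
  "ent u = (\<lambda>i j. u (prod_encode (i, j)))"

definition mk :: "(nat \<Rightarrow> nat \<Rightarrow> complex) \<Rightarrow> nat \<Rightarrow> complex" where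
  "mk M = (\<lambda>n. case prod_decode n of (i, j) \<Rightarrow> M i j)"

definition supported_on :: "nat set \<Rightarrow> (nat \<Rightarrow> nat \<Rightarrow> complex) \<Rightarrow> bool" where
  "supported_on I M \<longleftrightarrow> (\<forall>i j. M i j \<noteq> 0 \<longrightarrow> i \<in> I \<and> j \<in> I)"

text \<open>The bounded operators on l2 of \<open>I\<close>, realised as a corner of the infinite
  matrices and stored as sequences through \<open>prod_encode\<close>, since the universal property
  accepts only this type of elements. A finite \<open>I\<close> yields a matrix algebra.\<close>

definition Bop :: "nat set \<Rightarrow> (nat \<Rightarrow> complex) cstar" where
  "Bop I = \<lparr> carrier = {u. bounded_op (ent u) \<and> supported_on I (ent u)},
     monoid.mult = (\<lambda>u v. mk (op_mult (ent u) (ent v))), one = mk (\<lambda>i j. 0),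
     zero = mk (\<lambda>i j. 0), add = (\<lambda>u v. mk (\<lambda>i j. ent u i j + ent v i j)),
     module.smult = (\<lambda>c u. mk (\<lambda>i j. c * ent u i j)),
     adj = (\<lambda>u. mk (op_adj (ent u))), cnorm = (\<lambda>u. op_norm (ent u)) \<rparr>"

lemma ent_mk [simp]: "ent (mk M) = M"
  by (simp add: ent_def mk_def)

lemma mk_ent [simp]: "mk (ent u) = u"
  unfolding ent_def mk_def by (rule ext) (metis case_prod_beta prod.collapse prod_decode_inverse)

lemma mk_inject [simp]: "mk M = mk N \<longleftrightarrow> M = N"
  by (metis ent_mk)

lemma Bop_simps:
  "u \<in> carrier (Bop I) \<longleftrightarrow> bounded_op (ent u) \<and> supported_on I (ent u)"
  "u \<otimes>\<^bsub>Bop I\<^esub> v = mk (op_mult (ent u) (ent v))"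
  "\<zero>\<^bsub>Bop I\<^esub> = mk (\<lambda>i j. 0)"
  "u \<oplus>\<^bsub>Bop I\<^esub> v = mk (\<lambda>i j. ent u i j + ent v i j)"
  "c \<odot>\<^bsub>Bop I\<^esub> u = mk (\<lambda>i j. c * ent u i j)"
  "adj (Bop I) u = mk (op_adj (ent u))"
  "cnorm (Bop I) u = op_norm (ent u)"
  by (simp_all add: Bop_def)

lemma supported_on_simps [simp]:
  "supported_on I (\<lambda>i j. 0)"
  "supported_on I M \<Longrightarrow> supported_on I N \<Longrightarrow> supported_on I (\<lambda>i j. M i j + N i j)"
  "supported_on I M \<Longrightarrow> supported_on I (\<lambda>i j. c * M i j)"
  "supported_on I M \<Longrightarrow> supported_on I (op_adj M)"
  by (auto simp: supported_on_def op_adj_def) (metis add_0)+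

lemma supported_on_mult [simp]:
  assumes "supported_on I M" "supported_on I N" shows "supported_on I (op_mult M N)"
  unfolding supported_on_def
proof (intro allI impI)
  fix i j assume "op_mult M N i j \<noteq> 0"
  have "\<exists>k. M i k * N k j \<noteq> 0"
  proof (rule ccontr)
    assume "\<nexists>k. M i k * N k j \<noteq> 0"
    then have "op_mult M N i j = 0" by (simp add: op_mult_def del: mult_eq_0_iff)
    with \<open>op_mult M N i j \<noteq> 0\<close> show False by contradiction
  qed
  then obtain k where "M i k * N k j \<noteq> 0" by blast
  then show "i \<in> I \<and> j \<in> I" using assms unfolding supported_on_def by auto
qed

lemma abelian_group_Bop: "abelian_group (Bop I)"
proof (rule abelian_groupI)
  fix x assume x: "x \<in> carrier (Bop I)"
  let ?y = "mk (\<lambda>i j. (-1) * ent x i j)"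
  have "?y \<in> carrier (Bop I)" using x by (simp only: Bop_simps ent_mk bounded_op_smult supported_on_simps)
  moreover have "?y \<oplus>\<^bsub>Bop I\<^esub> x = \<zero>\<^bsub>Bop I\<^esub>" by (simp add: Bop_simps)
  ultimately show "\<exists>y\<in>carrier (Bop I). y \<oplus>\<^bsub>Bop I\<^esub> x = \<zero>\<^bsub>Bop I\<^esub>" by blast
qed (auto simp: Bop_simps bounded_op_add add_ac)

lemma ent_minus_Bop:
  assumes "x \<in> carrier (Bop I)" "y \<in> carrier (Bop I)"
  shows "ent (x \<ominus>\<^bsub>Bop I\<^esub> y) = (\<lambda>i j. ent x i j - ent y i j)"
proof -
  interpret abelian_group "Bop I" by (rule abelian_group_Bop)
  let ?y = "mk (\<lambda>i j. (-1) * ent y i j)"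
  have 1: "?y \<in> carrier (Bop I)"
    using assms(2) by (simp only: Bop_simps ent_mk bounded_op_smult supported_on_simps)
  have 2: "?y \<oplus>\<^bsub>Bop I\<^esub> y = \<zero>\<^bsub>Bop I\<^esub>" by (simp add: Bop_simps)
  have "\<ominus>\<^bsub>Bop I\<^esub> y = ?y" using minus_equality[OF 2 assms(2) 1] .
  then show ?thesis by (simp add: a_minus_def Bop_simps)
qed

lemma cstar_algebra_Bop: "cstar_algebra (Bop I)"
proof -
  note simps = Bop_simps bounded_op_add bounded_op_smult bounded_op_mult bounded_op_adj
  have "Module.module (ring_of_type_algebra :: complex ring) (Bop I)"
    by (rule moduleI[OF cring_from_type_algebra abelian_group_Bop])
      (simp_all add: simps ring_of_type_algebra_def algebra_simps)
  moreover have "cstar_algebra_axioms (Bop I)"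
  proof
    fix u assume u: "range u \<subseteq> carrier (Bop I)" "cstar_Cauchy (Bop I) u"
    then have uc: "u n \<in> carrier (Bop I)" for n by auto
    have "\<exists>N. \<forall>m\<ge>N. \<forall>n\<ge>N. op_norm (\<lambda>i j. ent (u m) i j - ent (u n) i j) < e" if "e > 0" for e
      using u(2) that unfolding cstar_Cauchy_def by (simp add: Bop_simps(7) ent_minus_Bop[OF uc uc])
    then obtain L where L: "bounded_op L" "(\<lambda>n. op_norm (\<lambda>i j. ent (u n) i j - L i j)) \<longlonglongrightarrow> 0"
      "\<And>i j. (\<lambda>n. ent (u n) i j) \<longlonglongrightarrow> L i j"
      using uc[unfolded Bop_simps] op_complete[where U = "\<lambda>n. ent (u n)" and thesis = thesis]
      by blast
    have "L i j = 0" if "\<not> (i \<in> I \<and> j \<in> I)" for i j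
    proof -
      have "ent (u n) i j = 0" for n using uc[of n] that by (auto simp: Bop_simps supported_on_def)
      with L(3)[of i j] show ?thesis by (simp add: LIMSEQ_const_iff)
    qed
    then have c: "mk L \<in> carrier (Bop I)" using L(1) by (auto simp: Bop_simps supported_on_def)
    have "cstar_limit (Bop I) u (mk L)"
      unfolding cstar_limit_def using L(2) by (simp add: Bop_simps(7) ent_minus_Bop[OF uc c])
    with c show "\<exists>a\<in>carrier (Bop I). cstar_limit (Bop I) u a" by blast
  next
    fix x y z assume "x \<in> carrier (Bop I)" "y \<in> carrier (Bop I)" "z \<in> carrier (Bop I)"
    then show "x \<otimes>\<^bsub>Bop I\<^esub> y \<otimes>\<^bsub>Bop I\<^esub> z = x \<otimes>\<^bsub>Bop I\<^esub> (y \<otimes>\<^bsub>Bop I\<^esub> z)"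
      "(x \<oplus>\<^bsub>Bop I\<^esub> y) \<otimes>\<^bsub>Bop I\<^esub> z = x \<otimes>\<^bsub>Bop I\<^esub> z \<oplus>\<^bsub>Bop I\<^esub> y \<otimes>\<^bsub>Bop I\<^esub> z"
      "z \<otimes>\<^bsub>Bop I\<^esub> (x \<oplus>\<^bsub>Bop I\<^esub> y) = z \<otimes>\<^bsub>Bop I\<^esub> x \<oplus>\<^bsub>Bop I\<^esub> z \<otimes>\<^bsub>Bop I\<^esub> y"
      by (simp_all add: simps op_mult_assoc op_mult_add_left op_mult_add_right)
  next
    fix x assume x: "x \<in> carrier (Bop I)"
    then show "cnorm (Bop I) x = 0 \<longleftrightarrow> x = \<zero>\<^bsub>Bop I\<^esub>"
      using op_norm_eq_0[of "ent x"] by (auto simp: Bop_simps) (metis ext mk_ent)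
  qed (simp_all add: simps op_mult_smult_left op_mult_smult_right op_norm_nonneg op_norm_add
      op_norm_smult op_norm_mult op_norm_cstar op_adj_mult, simp_all add: op_adj_def)
  ultimately show ?thesis by (simp add: cstar_algebra_def)
qed

section \<open>Partial permutations and branching systems\<close>

definition diag_op :: "nat set \<Rightarrow> nat \<Rightarrow> nat \<Rightarrow> complex" where
  "diag_op S = (\<lambda>i j. if i = j \<and> i \<in> S then 1 else 0)"

text \<open>A weighted partial permutation matrix; for injective \<open>f\<close> and weights of
  modulus 1 it is a partial isometry from l2 of \<open>D\<close> onto l2 of the image of
  \<open>D\<close>.\<close>

definition wperm :: "nat set \<Rightarrow> (nat \<Rightarrow> nat) \<Rightarrow> (nat \<Rightarrow> complex) \<Rightarrow> nat \<Rightarrow> nat \<Rightarrow> complex" where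
  "wperm D f w = (\<lambda>i j. if j \<in> D \<and> i = f j then w j else 0)"

lemma op_mult_single:
  assumes "\<And>k. k \<noteq> a \<Longrightarrow> M i k * N k j = 0"
  shows "op_mult M N i j = M i a * N a j"
  unfolding op_mult_def by (subst suminf_finite[of "{a}"]) (auto simp: assms)

text \<open>Injectivity leaves at most one nonzero entry in each row and each column, so the form is
  a single sum, to which Cauchy-Schwarz applies after reindexing along \<open>f\<close>.\<close>

lemma op_bound_wperm:
  assumes inj: "inj_on f D" and w: "\<And>j. j \<in> D \<Longrightarrow> cmod (w j) = 1"
  shows "op_bound (wperm D f w) 1"
  unfolding op_bound_def
proof (intro allI)
  fix m n x y
  \<comment> \<open>The columns whose nonzero entry falls inside the m by n window.\<close>
  define S where "S = {j\<in>{..<n}. j \<in> D \<and> f j < m}"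
  have S: "finite S" "S \<subseteq> D" "S \<subseteq> {..<n}" "f ` S \<subseteq> {..<m}" by (auto simp: S_def)
  have "(\<Sum>i<m. \<Sum>j<n. y i * wperm D f w i j * x j) = (\<Sum>j<n. \<Sum>i<m. y i * wperm D f w i j * x j)"
    by (rule sum.swap)
  also have "\<dots> = (\<Sum>j<n. if j \<in> D \<and> f j < m then y (f j) * w j * x j else 0)"
  proof (rule sum.cong[OF refl])
    fix j
    have "(\<Sum>i<m. y i * wperm D f w i j * x j)
        = (\<Sum>i<m. if i = f j then (if j \<in> D then y (f j) * w j * x j else 0) else 0)"
      by (rule sum.cong) (auto simp: wperm_def)
    then show "(\<Sum>i<m. y i * wperm D f w i j * x j)
        = (if j \<in> D \<and> f j < m then y (f j) * w j * x j else 0)" by simp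
  qed
  also have "\<dots> = (\<Sum>j\<in>S. y (f j) * w j * x j)"
    unfolding S_def by (rule sum.inter_filter[symmetric]) simp
  finally have "cmod (\<Sum>i<m. \<Sum>j<n. y i * wperm D f w i j * x j) = cmod (\<Sum>j\<in>S. y (f j) * w j * x j)"
    by simp
  also have "\<dots> \<le> (\<Sum>j\<in>S. cmod (y (f j) * w j * x j))" by (rule norm_sum)
  also have "\<dots> = (\<Sum>j\<in>S. \<bar>cmod (y (f j))\<bar> * \<bar>cmod (x j)\<bar>)"
    using S w by (intro sum.cong) (auto simp: norm_mult)
  also have "\<dots> \<le> L2_set (\<lambda>j. cmod (y (f j))) S * L2_set (\<lambda>j. cmod (x j)) S"
    by (rule L2_set_mult_ineq)
  also have "\<dots> \<le> vnorm m y * vnorm n x"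
  proof (intro mult_mono L2_set_nonneg vnorm_nonneg)
    have "L2_set (\<lambda>j. cmod (y (f j))) S = L2_set (\<lambda>j. cmod (y j)) (f ` S)"
      unfolding L2_set_def using inj_on_subset[OF inj S(2)] by (simp add: sum.reindex)
    also have "\<dots> \<le> vnorm m y"
      unfolding vnorm_def L2_set_def using S by (intro real_sqrt_le_mono sum_mono2) auto
    finally show "L2_set (\<lambda>j. cmod (y (f j))) S \<le> vnorm m y" .
    show "L2_set (\<lambda>j. cmod (x j)) S \<le> vnorm n x"
      unfolding vnorm_def L2_set_def using S by (intro real_sqrt_le_mono sum_mono2) auto
  qed
  finally show "cmod (\<Sum>i<m. \<Sum>j<n. y i * wperm D f w i j * x j) \<le> 1 * (vnorm m y * vnorm n x)"
    by simp
qed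

lemma diag_op_wperm: "diag_op S = wperm S (\<lambda>i. i) (\<lambda>_. 1)"
  by (auto simp: diag_op_def wperm_def fun_eq_iff)

lemma bounded_op_diag [simp]: "bounded_op (diag_op S)"
  unfolding diag_op_wperm by (rule bounded_opI, rule op_bound_wperm) auto

lemma op_mult_diag_left: "op_mult (diag_op S) M i j = (if i \<in> S then M i j else 0)"
  by (subst op_mult_single[where a = i]) (auto simp: diag_op_def)

lemma op_mult_diag_diag: "op_mult (diag_op S) (diag_op T) = diag_op (S \<inter> T)"
  by (intro ext) (auto simp: op_mult_diag_left, auto simp: diag_op_def)

lemma op_adj_diag: "op_adj (diag_op S) = diag_op S"
  by (auto simp: op_adj_def diag_op_def fun_eq_iff)

lemma diag_op_empty: "diag_op {} = (\<lambda>i j. 0)"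
  by (simp add: diag_op_def)

lemma op_mult_wperm_adj:
  assumes "inj_on f D" "\<And>j. j \<in> D \<Longrightarrow> cmod (w j) = 1"
  shows "op_mult (op_adj (wperm D f w)) (wperm D f w) = diag_op D"
    and "op_mult (wperm D f w) (op_adj (wperm D f w)) = diag_op (f ` D)"
proof -
  have w1: "cnj (w j) * w j = 1" "w j * cnj (w j) = 1" if "j \<in> D" for j
    using complex_norm_square[of "w j"] assms(2)[OF that] by (simp_all add: mult.commute)
  show "op_mult (op_adj (wperm D f w)) (wperm D f w) = diag_op D"
  proof (intro ext)
    fix i j
    show "op_mult (op_adj (wperm D f w)) (wperm D f w) i j = diag_op D i j"
      using assms(1) w1
      by (subst op_mult_single[where a = "f j"])
        (auto simp: op_adj_def wperm_def diag_op_def inj_on_eq_iff)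
  qed
  show "op_mult (wperm D f w) (op_adj (wperm D f w)) = diag_op (f ` D)"
  proof (intro ext)
    fix i j
    show "op_mult (wperm D f w) (op_adj (wperm D f w)) i j = diag_op (f ` D) i j"
    proof (cases "i \<in> f ` D")
      case True
      then obtain a where a: "a \<in> D" "i = f a" by blast
      show ?thesis using assms(1) w1 a
        by (subst op_mult_single[where a = a])
          (auto simp: op_adj_def wperm_def diag_op_def inj_on_eq_iff)
    next
      case False
      \<comment> \<open>Row \<open>i\<close> vanishes here, so the index 0 stands for an arbitrary
        one.\<close>
      then show ?thesis
        by (subst op_mult_single[where a = 0]) (auto simp: op_adj_def wperm_def diag_op_def)
    qed
  qed
qed

lemma diag_in_Bop: "S \<subseteq> I \<Longrightarrow> mk (diag_op S) \<in> carrier (Bop I)"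
  by (simp add: Bop_simps supported_on_def) (auto simp: diag_op_def)

lemma finsum_diag:
  assumes "finite F" "\<And>e. e \<in> F \<Longrightarrow> S e \<subseteq> I" "\<And>e f. e \<in> F \<Longrightarrow> f \<in> F \<Longrightarrow> e \<noteq> f \<Longrightarrow> S e \<inter> S f = {}"
  shows "(\<Oplus>\<^bsub>Bop I\<^esub>e\<in>F. mk (diag_op (S e))) = mk (diag_op (\<Union>e\<in>F. S e))"
proof -
  interpret abelian_group "Bop I" by (rule abelian_group_Bop)
  show ?thesis using assms
  proof (induction F rule: finite_induct)
    case empty
    show ?case by (simp add: Bop_simps diag_op_empty)
  next
    case (insert a F)
    have "S a \<inter> (\<Union>e\<in>F. S e) = {}" using insert.prems(2)[of a] insert.hyps by blast
    then have "(\<lambda>i j. diag_op (S a) i j + diag_op (\<Union>e\<in>F. S e) i j) = diag_op (S a \<union> (\<Union>e\<in>F. S e))"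
      by (auto simp: diag_op_def fun_eq_iff)
    moreover have "(\<Oplus>\<^bsub>Bop I\<^esub>e\<in>insert a F. mk (diag_op (S e)))
        = mk (diag_op (S a)) \<oplus>\<^bsub>Bop I\<^esub> (\<Oplus>\<^bsub>Bop I\<^esub>e\<in>F. mk (diag_op (S e)))"
      using insert by (intro finsum_insert) (auto intro!: diag_in_Bop)
    moreover have "(\<Oplus>\<^bsub>Bop I\<^esub>e\<in>F. mk (diag_op (S e))) = mk (diag_op (\<Union>e\<in>F. S e))"
      using insert by auto
    ultimately show ?case by (simp add: Bop_simps)
  qed
qed

text \<open>The edge \<open>e\<close> is to act on basis vectors by \<open>\<delta>\<^sub>x \<mapsto> wt e x \<cdot> \<delta>\<^sub>y\<close> with \<open>y = act e x\<close>, where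
  \<open>src x\<close> is the vertex at which \<open>x\<close> sits.\<close>

locale branching_system =
  fixes G :: "('v, 'e) pre_digraph" and B :: "'x set" and src :: "'x \<Rightarrow> 'v"
    and act :: "'e \<Rightarrow> 'x \<Rightarrow> 'x" and wt :: "'e \<Rightarrow> 'x \<Rightarrow> complex"
  assumes act_closed: "\<lbrakk>e \<in> arcs G; x \<in> B; src x = head G e\<rbrakk> \<Longrightarrow> act e x \<in> B"
    and src_act: "\<lbrakk>e \<in> arcs G; x \<in> B; src x = head G e\<rbrakk> \<Longrightarrow> src (act e x) = tail G e"
    and norm_wt: "\<lbrakk>e \<in> arcs G; x \<in> B; src x = head G e\<rbrakk> \<Longrightarrow> cmod (wt e x) = 1"
    and act_inj: "\<lbrakk>e \<in> arcs G; f \<in> arcs G; x \<in> B; y \<in> B; src x = head G e; src y = head G f;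
        act e x = act f y\<rbrakk> \<Longrightarrow> e = f \<and> x = y"
    and act_cover: "\<lbrakk>x \<in> B; out_arcs G (src x) \<noteq> {}; finite (out_arcs G (src x))\<rbrakk> \<Longrightarrow>
        \<exists>e\<in>arcs G. \<exists>y\<in>B. src y = head G e \<and> act e y = x"
begin

definition proj_at :: "'v \<Rightarrow> nat set" where
  "proj_at v = to_nat_on B ` {x\<in>B. src x = v}"

definition rep_p :: "'v \<Rightarrow> nat \<Rightarrow> complex" where
  "rep_p v = mk (diag_op (proj_at v))"

definition nat_act :: "'e \<Rightarrow> nat \<Rightarrow> nat" where
  "nat_act e i = to_nat_on B (act e (from_nat_into B i))"

definition rep_s :: "'e \<Rightarrow> nat \<Rightarrow> complex" where
  "rep_s e = mk (wperm (proj_at (head G e)) (nat_act e) (\<lambda>i. wt e (from_nat_into B i)))"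

text \<open>Every relation becomes a statement about index sets: \<open>act_inj\<close> makes the
  edges partial isometries with disjoint ranges \<open>?R e\<close>, and \<open>act_cover\<close>
  makes these ranges fill \<open>proj_at v\<close> at each regular vertex.\<close>

lemma rep_ck_family:
  assumes B: "countable B"
  shows "ck_family G (Bop (to_nat_on B ` B)) rep_p rep_s"
proof -
  let ?I = "to_nat_on B ` B"
  let ?R = "\<lambda>e. nat_act e ` proj_at (head G e)"
  have fn: "from_nat_into B (to_nat_on B x) = x" if "x \<in> B" for x
    using from_nat_into_to_nat_on[OF B that] .
  have eqn: "to_nat_on B x = to_nat_on B y \<longleftrightarrow> x = y" if "x \<in> B" "y \<in> B" for x y
    using fn[OF that(1)] fn[OF that(2)] by metis
  have R_eq: "?R e = to_nat_on B ` act e ` {x\<in>B. src x = head G e}" for e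
    unfolding proj_at_def nat_act_def by (force simp: fn image_iff)
  have inj: "inj_on (nat_act e) (proj_at (head G e))" if "e \<in> arcs G" for e
    using that by (auto simp: inj_on_def proj_at_def nat_act_def fn eqn act_closed dest: act_inj)
  have wt1: "cmod (wt e (from_nat_into B i)) = 1" if "e \<in> arcs G" "i \<in> proj_at (head G e)" for e i
    using that by (auto simp: proj_at_def fn norm_wt)
  have PI: "proj_at v \<subseteq> ?I" for v by (auto simp: proj_at_def)
  have RP: "?R e \<subseteq> proj_at (tail G e)" if "e \<in> arcs G" for e
    using that unfolding R_eq by (auto simp: proj_at_def act_closed src_act)
  have RI: "?R e \<subseteq> ?I" if "e \<in> arcs G" for e
    using RP[OF that] PI[of "tail G e"] by (rule order_trans)
  have disjR: "?R e \<inter> ?R f = {}" if "e \<in> arcs G" "f \<in> arcs G" "e \<noteq> f" for e f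
    using that unfolding R_eq by (auto simp: eqn act_closed) (metis act_inj act_closed eqn)
  have disjP: "proj_at v \<inter> proj_at w = {}" if "v \<noteq> w" for v w
    using that by (auto simp: proj_at_def eqn)
  have ss: "adj (Bop ?I) (rep_s e) \<otimes>\<^bsub>Bop ?I\<^esub> rep_s e = rep_p (head G e)"
    "rep_s e \<otimes>\<^bsub>Bop ?I\<^esub> adj (Bop ?I) (rep_s e) = mk (diag_op (?R e))" if "e \<in> arcs G" for e
    using op_mult_wperm_adj[OF inj[OF that] wt1[OF that]]
    by (simp_all add: rep_s_def rep_p_def Bop_simps)
  have sc: "rep_s e \<in> carrier (Bop ?I)" if "e \<in> arcs G" for e
    using bounded_opI[OF op_bound_wperm[OF inj[OF that] wt1[OF that]]] PI RP[OF that]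
    by (fastforce simp: Bop_simps rep_s_def supported_on_def wperm_def split: if_splits)
  show ?thesis
    unfolding ck_family_def
  proof (intro conjI ballI impI)
    fix v show "projection (Bop ?I) (rep_p v)"
      using diag_in_Bop[OF PI] unfolding projection_def rep_p_def
      by (simp add: Bop_simps op_mult_diag_diag op_adj_diag)
    fix w assume "v \<noteq> w"
    then show "rep_p v \<otimes>\<^bsub>Bop ?I\<^esub> rep_p w = \<zero>\<^bsub>Bop ?I\<^esub>"
      using disjP[of v w] by (simp add: rep_p_def Bop_simps op_mult_diag_diag diag_op_empty)
  next
    fix e assume e: "e \<in> arcs G"
    have "op_mult (diag_op (?R e)) (ent (rep_s e)) = ent (rep_s e)"
      by (intro ext) (auto simp: op_mult_diag_left rep_s_def wperm_def)
    then show "partial_isometry (Bop ?I) (rep_s e)"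
      unfolding partial_isometry_def ss[OF e] using sc[OF e] by (simp add: Bop_simps(2))
    show "adj (Bop ?I) (rep_s e) \<otimes>\<^bsub>Bop ?I\<^esub> rep_s e = rep_p (head G e)" by (rule ss[OF e])
    show "proj_le (Bop ?I) (range_proj (Bop ?I) (rep_s e)) (rep_p (tail G e))"
      unfolding proj_le_def range_proj_def ss[OF e] using RP[OF e]
      by (simp add: rep_p_def Bop_simps op_mult_diag_diag Int_absorb1 Int_absorb2)
    fix f assume "f \<in> arcs G" "e \<noteq> f"
    then show "range_proj (Bop ?I) (rep_s e) \<otimes>\<^bsub>Bop ?I\<^esub> range_proj (Bop ?I) (rep_s f) = \<zero>\<^bsub>Bop ?I\<^esub>"
      unfolding range_proj_def using disjR[of e f] e
      by (simp add: ss, simp add: Bop_simps op_mult_diag_diag diag_op_empty)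
  next
    fix v assume v: "out_arcs G v \<noteq> {} \<and> finite (out_arcs G v)"
    have "(\<Oplus>\<^bsub>Bop ?I\<^esub>e\<in>out_arcs G v. rep_s e \<otimes>\<^bsub>Bop ?I\<^esub> adj (Bop ?I) (rep_s e))
        = (\<Oplus>\<^bsub>Bop ?I\<^esub>e\<in>out_arcs G v. mk (diag_op (?R e)))"
    proof -
      interpret abelian_group "Bop ?I" by (rule abelian_group_Bop)
      show ?thesis
        using RI by (intro finsum_cong' Pi_I diag_in_Bop) (auto simp: ss)
    qed
    also have "\<dots> = mk (diag_op (\<Union>e\<in>out_arcs G v. ?R e))"
      using v RI disjR by (intro finsum_diag) auto
    also have "(\<Union>e\<in>out_arcs G v. ?R e) = proj_at v"
    proof
      show "proj_at v \<subseteq> (\<Union>e\<in>out_arcs G v. ?R e)"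
      proof
        fix i assume "i \<in> proj_at v"
        then obtain x where x: "x \<in> B" "src x = v" "i = to_nat_on B x" by (auto simp: proj_at_def)
        with act_cover[of x] v obtain e y where "e \<in> arcs G" "y \<in> B" "src y = head G e" "act e y = x"
          by auto
        moreover from this have "tail G e = v" using src_act[of e y] x by simp
        ultimately show "i \<in> (\<Union>e\<in>out_arcs G v. ?R e)" unfolding R_eq using x by (intro UN_I[of e]) auto
      qed
      show "(\<Union>e\<in>out_arcs G v. ?R e) \<subseteq> proj_at v"
      proof (rule UN_least)
        fix e assume "e \<in> out_arcs G v"
        then show "?R e \<subseteq> proj_at v" using RP[of e] by simp
      qed
    qed
    finally show "rep_p v = (\<Oplus>\<^bsub>Bop ?I\<^esub>e\<in>out_arcs G v. rep_s e \<otimes>\<^bsub>Bop ?I\<^esub> adj (Bop ?I) (rep_s e))"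
      by (simp add: rep_p_def)
  qed
qed

lemma rep_p_nonzero:
  assumes "countable B" "x \<in> B" shows "rep_p (src x) \<noteq> \<zero>\<^bsub>Bop I\<^esub>"
proof
  assume "rep_p (src x) = \<zero>\<^bsub>Bop I\<^esub>"
  then have "diag_op (proj_at (src x)) = (\<lambda>i j. 0)" by (simp add: rep_p_def Bop_simps)
  from fun_cong[OF fun_cong[OF this, of "to_nat_on B x"], of "to_nat_on B x"]
  show False using assms(2) by (auto simp: diag_op_def proj_at_def split: if_splits)
qed

end

section \<open>Elementary C*-algebra theory\<close>

context cstar_algebra
begin

section \<open>Calculation rules in C*-algebras without unit\<close>

declare mult_closed [simp, intro] adj_closed [simp, intro]

lemma scalar_in_carrier [simp]: "c \<in> carrier (ring_of_type_algebra :: complex ring)"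
  by (simp add: ring_of_type_algebra_def)

lemma smult_add_left: "x \<in> carrier A \<Longrightarrow> (c + d) \<odot> x = c \<odot> x \<oplus> d \<odot> x"
  using smult_l_distr[of c d x] by (simp add: ring_of_type_algebra_def)

lemma smult_add_right:
  "x \<in> carrier A \<Longrightarrow> y \<in> carrier A \<Longrightarrow> c \<odot> (x \<oplus> y) = c \<odot> x \<oplus> c \<odot> y"
  by (rule smult_r_distr) auto

lemma smult_smult: "x \<in> carrier A \<Longrightarrow> c \<odot> (d \<odot> x) = (c * d) \<odot> x"
  using smult_assoc1[of c d x] by (simp add: ring_of_type_algebra_def)

lemma smult_1 [simp]: "x \<in> carrier A \<Longrightarrow> 1 \<odot> x = x"
  using smult_one[of x] by (simp add: ring_of_type_algebra_def)

lemma smult_0 [simp]: "x \<in> carrier A \<Longrightarrow> 0 \<odot> x = \<zero>"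
  using smult_l_null[of x] by (simp add: ring_of_type_algebra_def)

lemma smult_zero [simp]: "c \<odot> \<zero> = \<zero>"
  by (rule smult_r_null) auto

lemma uminus_conv: "x \<in> carrier A \<Longrightarrow> \<ominus> x = (-1) \<odot> x"
proof -
  assume x: "x \<in> carrier A"
  have "(-1) \<odot> x \<oplus> x = ((-1) + 1) \<odot> x" using x by (subst smult_add_left) auto
  also have "\<dots> = \<zero>" using x by simp
  finally show ?thesis using x by (intro M.minus_equality) auto
qed

lemma minus_conv: "x \<in> carrier A \<Longrightarrow> y \<in> carrier A \<Longrightarrow> x \<ominus> y = x \<oplus> (-1) \<odot> y"
  by (simp add: a_minus_def uminus_conv)

lemma minus_closed' [simp, intro]: "x \<in> carrier A \<Longrightarrow> y \<in> carrier A \<Longrightarrow> x \<ominus> y \<in> carrier A"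
  by (simp add: minus_conv)

lemma mult_zero_left [simp]: "x \<in> carrier A \<Longrightarrow> \<zero> \<otimes> x = \<zero>"
  using mult_smult_left[of \<zero> x 0] by simp

lemma mult_zero_right [simp]: "x \<in> carrier A \<Longrightarrow> x \<otimes> \<zero> = \<zero>"
  using mult_smult_right[of x \<zero> 0] by simp

lemma adj_zero [simp]: "adj A \<zero> = \<zero>"
  using adj_smult[of \<zero> 0] by simp

lemma minus_self [simp]: "x \<in> carrier A \<Longrightarrow> x \<ominus> x = \<zero>"
  by (simp add: M.r_neg a_minus_def)

lemma minus_zero [simp]: "x \<in> carrier A \<Longrightarrow> x \<ominus> \<zero> = x"
  by (simp add: minus_conv)

lemma minus_add_minus:
  assumes "x \<in> carrier A" "y \<in> carrier A" "z \<in> carrier A"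
  shows "(x \<ominus> y) \<oplus> (y \<ominus> z) = x \<ominus> z"
  using assms by (simp add: a_minus_def M.a_assoc M.r_neg1 M.r_neg2)

lemma add_minus_add:
  assumes "x \<in> carrier A" "y \<in> carrier A" "z \<in> carrier A" "w \<in> carrier A"
  shows "(x \<oplus> y) \<ominus> (z \<oplus> w) = (x \<ominus> z) \<oplus> (y \<ominus> w)"
  using assms by (simp add: minus_conv smult_add_right M.a_ac)

lemma minus_add_cancel: "x \<in> carrier A \<Longrightarrow> y \<in> carrier A \<Longrightarrow> (x \<ominus> y) \<oplus> y = x"
  by (simp add: a_minus_def M.a_assoc M.l_neg)

lemma minus_eq_zero_iff: "x \<in> carrier A \<Longrightarrow> y \<in> carrier A \<Longrightarrow> x \<ominus> y = \<zero> \<longleftrightarrow> x = y"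
  by (metis M.l_zero minus_add_cancel minus_self)

lemma mult_minus_left:
  "\<lbrakk>x \<in> carrier A; y \<in> carrier A; z \<in> carrier A\<rbrakk> \<Longrightarrow> (x \<ominus> y) \<otimes> z = (x \<otimes> z) \<ominus> (y \<otimes> z)"
  by (simp add: minus_conv mult_add_left mult_smult_left)

lemma mult_minus_right:
  "\<lbrakk>x \<in> carrier A; y \<in> carrier A; z \<in> carrier A\<rbrakk> \<Longrightarrow> z \<otimes> (x \<ominus> y) = (z \<otimes> x) \<ominus> (z \<otimes> y)"
  by (simp add: minus_conv mult_add_right mult_smult_right)

lemma smult_minus:
  "\<lbrakk>x \<in> carrier A; y \<in> carrier A\<rbrakk> \<Longrightarrow> c \<odot> (x \<ominus> y) = (c \<odot> x) \<ominus> (c \<odot> y)"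
  by (simp add: minus_conv smult_add_right smult_smult)

lemma adj_minus:
  "\<lbrakk>x \<in> carrier A; y \<in> carrier A\<rbrakk> \<Longrightarrow> adj A (x \<ominus> y) = adj A x \<ominus> adj A y"
  by (simp add: minus_conv adj_add adj_smult)

lemma norm_zero [simp]: "cnorm A \<zero> = 0"
  by (simp add: norm_eq_0_iff)

lemma norm_minus_commute:
  "x \<in> carrier A \<Longrightarrow> y \<in> carrier A \<Longrightarrow> cnorm A (x \<ominus> y) = cnorm A (y \<ominus> x)"
proof -
  assume xy: "x \<in> carrier A" "y \<in> carrier A"
  then have "(-1) \<odot> (y \<ominus> x) = x \<ominus> y"
    by (simp add: minus_conv smult_add_right smult_smult M.a_comm)
  with xy norm_smult[of "y \<ominus> x" "-1"] show ?thesis by simp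
qed

lemma norm_minus_triangle:
  assumes "x \<in> carrier A" "y \<in> carrier A" "z \<in> carrier A"
  shows "cnorm A (x \<ominus> z) \<le> cnorm A (x \<ominus> y) + cnorm A (y \<ominus> z)"
  using norm_triangle[of "x \<ominus> y" "y \<ominus> z"] assms by (simp add: minus_add_minus)

lemma norm_le_minus:
  "x \<in> carrier A \<Longrightarrow> y \<in> carrier A \<Longrightarrow> cnorm A x \<le> cnorm A (x \<ominus> y) + cnorm A y"
  using norm_triangle[of "x \<ominus> y" y] by (simp add: minus_add_cancel)

text \<open>By the C*-identity the square of \<open>cnorm A y\<close> is at most the product of the
  norms of \<open>adj A y\<close> and \<open>y\<close>; one factor cancels, and applying this to
  \<open>adj A y\<close> gives the other inequality.\<close>

lemma norm_adj: assumes x: "x \<in> carrier A" shows "cnorm A (adj A x) = cnorm A x"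
proof -
  have le: "cnorm A y \<le> cnorm A (adj A y)" if y: "y \<in> carrier A" for y
  proof (cases "cnorm A y = 0")
    case False
    then have "0 < cnorm A y" using norm_nonneg[OF y] by simp
    moreover have "cnorm A y * cnorm A y \<le> cnorm A (adj A y) * cnorm A y"
      using norm_cstar[OF y] norm_mult[of "adj A y" y] y by (simp add: power2_eq_square)
    ultimately show ?thesis by (simp add: mult_le_cancel_right)
  qed (use y norm_nonneg in auto)
  show ?thesis using le[OF x] le[of "adj A x"] x by (simp add: adj_adj)
qed

lemma norm_finsum:
  assumes "finite F" "\<And>i. i \<in> F \<Longrightarrow> f i \<in> carrier A"
  shows "cnorm A (\<Oplus>i\<in>F. f i) \<le> (\<Sum>i\<in>F. cnorm A (f i))"
  using assms
proof (induction F rule: finite_induct)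
  case (insert a F)
  then have "(\<Oplus>i\<in>insert a F. f i) = f a \<oplus> (\<Oplus>i\<in>F. f i)"
    by (intro M.finsum_insert) auto
  moreover have "(\<Oplus>i\<in>F. f i) \<in> carrier A" using insert by (intro M.finsum_closed) auto
  ultimately show ?case using norm_triangle[of "f a" "\<Oplus>i\<in>F. f i"] insert by auto
qed simp

lemma norm_projection:
  assumes "projection A q" "q \<noteq> \<zero>" shows "cnorm A q = 1"
proof -
  have q: "q \<in> carrier A" "q \<otimes> q = q" "adj A q = q" using assms by (auto simp: projection_def)
  have "cnorm A q * cnorm A q = cnorm A q"
    using norm_cstar[OF q(1)] q by (simp add: power2_eq_square)
  then show ?thesis using assms(2) q norm_eq_0_iff by simp
qed

lemma eq_if_norm_le_null:
  assumes "x \<in> carrier A" "y \<in> carrier A" "f \<longlonglongrightarrow> 0" "\<And>n. cnorm A (x \<ominus> y) \<le> f n"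
  shows "x = y"
proof -
  have "cnorm A (x \<ominus> y) \<le> 0" using assms(3,4) by (intro LIMSEQ_le_const) auto
  then show ?thesis using norm_nonneg[of "x \<ominus> y"] assms
    by (metis minus_closed' minus_eq_zero_iff norm_eq_0_iff order_antisym)
qed

lemma square_minus_square:
  assumes "a \<in> carrier A" "b \<in> carrier A"
  shows "cnorm A (a \<otimes> a \<ominus> b \<otimes> b) \<le> (cnorm A a + cnorm A b) * cnorm A (a \<ominus> b)"
proof -
  have "a \<otimes> a \<ominus> b \<otimes> b = a \<otimes> (a \<ominus> b) \<oplus> (a \<ominus> b) \<otimes> b"
    using assms by (simp add: mult_minus_left mult_minus_right minus_add_minus)
  then have "cnorm A (a \<otimes> a \<ominus> b \<otimes> b) \<le> cnorm A (a \<otimes> (a \<ominus> b)) + cnorm A ((a \<ominus> b) \<otimes> b)"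
    using assms by (simp add: norm_triangle)
  also have "\<dots> \<le> cnorm A a * cnorm A (a \<ominus> b) + cnorm A (a \<ominus> b) * cnorm A b"
    using assms by (intro add_mono norm_mult) auto
  finally show ?thesis by (simp add: algebra_simps)
qed

text \<open>The element \<open>k\<close> is \<open>1 - sqrt (1 - h\<^sup>2)\<close> in the unitization, obtained as the fixed point of
  a contraction.\<close>

lemma selfadjoint_defect_root:
  assumes h: "h \<in> carrier A" "adj A h = h" "cnorm A h < 1"
  obtains k where "k \<in> carrier A" "adj A k = k" "k \<oplus> k = h \<otimes> h \<oplus> k \<otimes> k"
proof -
  define r where "r = cnorm A h"
  have r: "0 \<le> r" "r < 1" using h norm_nonneg by (auto simp: r_def)
  \<comment> \<open>The target equation says that k is a fixed point of v -> (h h + v v) / 2. Since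
    r < 1, this map sends the closed ball of radius r into itself, and it shrinks differences there
    by the factor r.\<close>
  define u where "u = rec_nat \<zero> (\<lambda>_ v. (1/2) \<odot> (h \<otimes> h \<oplus> v \<otimes> v))"
  have u0: "u 0 = \<zero>" and uS: "u (Suc n) = (1/2) \<odot> (h \<otimes> h \<oplus> u n \<otimes> u n)" for n
    by (simp_all add: u_def)
  have uc [simp]: "u n \<in> carrier A" for n
    by (induction n) (auto simp: u0 uS h)
  have ua: "adj A (u n) = u n" for n
    by (induction n) (simp_all add: u0 uS h adj_smult adj_add adj_mult)
  have rr: "r * r \<le> r" using r by (simp add: mult_left_le_one_le)
  have un: "cnorm A (u n) \<le> r" for n
  proof (induction n)
    case 0
    show ?case using r by (simp add: u0)
  next
    case (Suc n)
    have "cnorm A (h \<otimes> h \<oplus> u n \<otimes> u n) \<le> cnorm A (h \<otimes> h) + cnorm A (u n \<otimes> u n)"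
      using h by (intro norm_triangle) auto
    also have "\<dots> \<le> cnorm A h * cnorm A h + cnorm A (u n) * cnorm A (u n)"
      using h by (intro add_mono norm_mult) auto
    also have "\<dots> \<le> r * r + r * r"
      using Suc r h norm_nonneg[OF uc] by (intro add_mono mult_mono) (auto simp: r_def)
    finally show ?case using rr h by (simp add: uS norm_smult)
  qed
  have step: "cnorm A (u (Suc n) \<ominus> u n) \<le> r ^ n" for n
  proof (induction n)
    case 0
    show ?case using un[of 1] r by (simp add: u0)
  next
    case (Suc n)
    have "u (Suc (Suc n)) \<ominus> u (Suc n)
        = (1/2) \<odot> (u (Suc n) \<otimes> u (Suc n) \<ominus> u n \<otimes> u n)"
    proof -
      have "u (Suc (Suc n)) \<ominus> u (Suc n)
          = (1/2) \<odot> ((h \<otimes> h \<oplus> u (Suc n) \<otimes> u (Suc n)) \<ominus> (h \<otimes> h \<oplus> u n \<otimes> u n))"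
        using h by (simp add: uS[of "Suc n"] uS[of n] smult_minus)
      also have "\<dots> = (1/2) \<odot> (u (Suc n) \<otimes> u (Suc n) \<ominus> u n \<otimes> u n)"
        using h by (simp add: add_minus_add)
      finally show ?thesis .
    qed
    then have "cnorm A (u (Suc (Suc n)) \<ominus> u (Suc n))
        = (1/2) * cnorm A (u (Suc n) \<otimes> u (Suc n) \<ominus> u n \<otimes> u n)"
      by (simp add: norm_smult)
    also have "\<dots> \<le> (1/2) * ((cnorm A (u (Suc n)) + cnorm A (u n)) * cnorm A (u (Suc n) \<ominus> u n))"
      by (intro mult_left_mono square_minus_square) auto
    also have "\<dots> \<le> (1/2) * ((r + r) * r ^ n)"
      using un Suc r by (intro mult_left_mono mult_mono add_mono norm_nonneg) auto
    finally show ?case by simp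
  qed
  have tele: "cnorm A (u (m + n) \<ominus> u m) \<le> r ^ m * (1 / (1 - r))" for m n
  proof -
    have "cnorm A (u (m + n) \<ominus> u m) \<le> (\<Sum>i<n. r ^ (m + i))"
    proof (induction n)
      case (Suc n)
      have "cnorm A (u (m + Suc n) \<ominus> u m)
          \<le> cnorm A (u (Suc (m + n)) \<ominus> u (m + n)) + cnorm A (u (m + n) \<ominus> u m)"
        using norm_minus_triangle[of "u (Suc (m + n))" "u (m + n)" "u m"] by simp
      with Suc step[of "m + n"] show ?case by simp
    qed simp
    also have "\<dots> = r ^ m * (\<Sum>i<n. r ^ i)" by (simp add: power_add sum_distrib_left)
    also have "\<dots> \<le> r ^ m * (1 / (1 - r))"
      using r by (intro mult_left_mono) (auto simp: sum_gp_strict divide_right_mono)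
    finally show ?thesis .
  qed
  have "(\<lambda>m. r ^ m * (1 / (1 - r))) \<longlonglongrightarrow> 0 * (1 / (1 - r))"
    using r by (intro tendsto_mult LIMSEQ_realpow_zero tendsto_const) auto
  then have lim0: "(\<lambda>m. r ^ m * (1 / (1 - r))) \<longlonglongrightarrow> 0" by simp
  have "cstar_Cauchy A u"
    unfolding cstar_Cauchy_def
  proof (intro allI impI)
    fix e :: real assume "e > 0"
    then have "\<exists>N. \<forall>m\<ge>N. norm (r ^ m * (1 / (1 - r)) - 0) < e / 2"
      using LIMSEQ_D[OF lim0, of "e / 2"] by simp
    then obtain N where N: "norm (r ^ N * (1 / (1 - r)) - 0) < e / 2" by blast
    have *: "cnorm A (u m \<ominus> u N) < e / 2" if "m \<ge> N" for m
    proof -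
      have "r ^ N * (1 / (1 - r)) < e / 2" using N by (simp only: real_norm_def diff_0_right abs_less_iff)
      moreover have "cnorm A (u m \<ominus> u N) \<le> r ^ N * (1 / (1 - r))"
        using tele[of N "m - N"] that by (simp only: le_add_diff_inverse)
      ultimately show ?thesis by linarith
    qed
    have "cnorm A (u m \<ominus> u n) < e" if "m \<ge> N" "n \<ge> N" for m n
      using norm_minus_triangle[of "u m" "u N" "u n"] *[OF that(1)] *[OF that(2)]
        norm_minus_commute[of "u N" "u n"] by simp
    then show "\<exists>N. \<forall>m\<ge>N. \<forall>n\<ge>N. cnorm A (u m \<ominus> u n) < e" by blast
  qed
  moreover have "range u \<subseteq> carrier A" by (rule image_subsetI) simp
  ultimately obtain k where k: "k \<in> carrier A" "cstar_limit A u k"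
    using complete[of u] by blast
  define d where "d = (\<lambda>n. cnorm A (u n \<ominus> k))"
  have d0: "d \<longlonglongrightarrow> 0" using k(2) by (simp add: d_def cstar_limit_def)
  have "adj A k = k"
  proof (rule eq_if_norm_le_null)
    show "(\<lambda>n. d n + d n) \<longlonglongrightarrow> 0" using tendsto_add[OF d0 d0] by simp
    fix n
    have "cnorm A (adj A k \<ominus> u n) = d n"
      using norm_adj[of "k \<ominus> u n"] k by (simp add: adj_minus ua d_def norm_minus_commute)
    then show "cnorm A (adj A k \<ominus> k) \<le> d n + d n"
      using norm_minus_triangle[of "adj A k" "u n" k] k by (simp add: d_def)
  qed (use k in auto)
  moreover have "k \<oplus> k = h \<otimes> h \<oplus> k \<otimes> k"
  proof (rule eq_if_norm_le_null)
    let ?g = "\<lambda>n. (d (Suc n) + d (Suc n)) + (r + cnorm A k) * d n"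
    have "?g \<longlonglongrightarrow> (0 + 0) + (r + cnorm A k) * 0"
      by (intro tendsto_add tendsto_mult tendsto_const d0 LIMSEQ_Suc[OF d0])
    then show "?g \<longlonglongrightarrow> 0" by simp
    fix n
    have e: "u (Suc n) \<oplus> u (Suc n) = h \<otimes> h \<oplus> u n \<otimes> u n"
      using h unfolding uS by (simp add: smult_add_left[symmetric])
    have "cnorm A (k \<oplus> k \<ominus> (u (Suc n) \<oplus> u (Suc n))) \<le> d (Suc n) + d (Suc n)"
      using k norm_triangle[of "k \<ominus> u (Suc n)" "k \<ominus> u (Suc n)"]
      by (simp add: add_minus_add d_def norm_minus_commute)
    moreover have "cnorm A ((h \<otimes> h \<oplus> u n \<otimes> u n) \<ominus> (h \<otimes> h \<oplus> k \<otimes> k)) \<le> (r + cnorm A k) * d n"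
    proof -
      have "cnorm A ((h \<otimes> h \<oplus> u n \<otimes> u n) \<ominus> (h \<otimes> h \<oplus> k \<otimes> k)) = cnorm A (u n \<otimes> u n \<ominus> k \<otimes> k)"
        using h k by (simp add: add_minus_add)
      also have "\<dots> \<le> (cnorm A (u n) + cnorm A k) * d n"
        unfolding d_def using k by (intro square_minus_square) auto
      also have "\<dots> \<le> (r + cnorm A k) * d n"
        using un k by (intro mult_right_mono) (auto simp: d_def norm_nonneg)
      finally show ?thesis .
    qed
    ultimately show "cnorm A (k \<oplus> k \<ominus> (h \<otimes> h \<oplus> k \<otimes> k)) \<le> ?g n"
      using norm_minus_triangle[of "k \<oplus> k" "u (Suc n) \<oplus> u (Suc n)" "h \<otimes> h \<oplus> k \<otimes> k"] k h
      by (simp add: e)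
  qed (use h k in auto)
  ultimately show ?thesis using that k by blast
qed

end

text \<open>The hypothesis reads 1 - H H = (1 - K)(1 - K), and the right side is positive. In
  coordinates: expanding the squared norm of x - K x bounds 2 Re (x, K x) by the sum of the squared
  norms of x and K x, and the hypothesis turns this into a bound of H x by x.\<close>

lemma op_bound_1_if_defect_root:
  assumes H: "bounded_op H" "op_adj H = H" and K: "bounded_op K" "op_adj K = K"
    and eq: "\<And>i j. K i j + K i j = op_mult H H i j + op_mult K K i j"
  shows "op_bound H 1"
proof (rule op_bound_of_vec)
  fix m n x
  define hx where "hx = (\<lambda>k. \<Sum>j<n. H k j * x j)"
  define kx where "kx = (\<lambda>k. \<Sum>j<n. K k j * x j)"
  define form where "form = (\<lambda>M. \<Sum>i<n. \<Sum>j<n. cnj (x i) * M i j * x j)"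
  have sH: "(\<lambda>k. (cmod (hx k))\<^sup>2) sums Re (form (op_mult H H))"
    using sums_Re[OF op_adj_mult_form_sums[OF H(1), where n=n and x=x]] H(2) by (simp add: hx_def form_def)
  have sK: "(\<lambda>k. (cmod (kx k))\<^sup>2) sums Re (form (op_mult K K))"
    using sums_Re[OF op_adj_mult_form_sums[OF K(1), where n=n and x=x]] K(2) by (simp add: kx_def form_def)
  have "form (op_mult H H) + form (op_mult K K) = form (\<lambda>i j. op_mult H H i j + op_mult K K i j)"
    by (simp add: form_def sum.distrib distrib_left distrib_right)
  also have "\<dots> = form (\<lambda>i j. K i j + K i j)" by (simp only: eq)
  also have "\<dots> = form K + form K" by (simp only: form_def sum.distrib distrib_left distrib_right)
  also have "\<dots> = 2 * form K" by simp
  finally have f: "Re (form (op_mult H H)) + Re (form (op_mult K K)) = 2 * Re (form K)"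
    by (metis mult_2 plus_complex.sel(1))
  have formK: "form K = (\<Sum>i<n. cnj (x i) * kx i)"
    by (simp add: form_def kx_def sum_distrib_left mult.assoc)
  \<comment> \<open>\<open>x\<close> lives on the first \<open>n\<close> coordinates, so only those
    of \<open>K x\<close> are compared with it; the discarded ones can only add to the squared norm
    of \<open>K x\<close>.\<close>
  have "0 \<le> (\<Sum>i<n. (cmod (x i - kx i))\<^sup>2)" by (intro sum_nonneg) auto
  also have "\<dots> = (\<Sum>i<n. (cmod (x i))\<^sup>2 + (cmod (kx i))\<^sup>2 - 2 * Re (cnj (x i) * kx i))"
    by (intro sum.cong refl) (simp only: cmod_power2, simp add: power2_eq_square algebra_simps)
  also have "\<dots> = (vnorm n x)\<^sup>2 + (\<Sum>i<n. (cmod (kx i))\<^sup>2) - 2 * Re (form K)"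
    by (simp add: formK vnorm_power2 sum.distrib sum_subtractf sum_distrib_left)
  finally have "2 * Re (form K) \<le> (vnorm n x)\<^sup>2 + (\<Sum>i<n. (cmod (kx i))\<^sup>2)" by simp
  also have "(\<Sum>i<n. (cmod (kx i))\<^sup>2) \<le> Re (form (op_mult K K))"
    using sum_le_suminf[OF sums_summable[OF sK], of "{..<n}"] sums_unique[OF sK] by simp
  finally have "Re (form (op_mult H H)) \<le> (vnorm n x)\<^sup>2" using f by simp
  moreover have "(\<Sum>i<m. (cmod (hx i))\<^sup>2) \<le> Re (form (op_mult H H))"
    using sum_le_suminf[OF sums_summable[OF sH], of "{..<m}"] sums_unique[OF sH] by simp
  ultimately have "(vnorm m hx)\<^sup>2 \<le> (vnorm n x)\<^sup>2" by (simp add: vnorm_power2)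
  then have "vnorm m hx \<le> vnorm n x" by (rule power2_le_imp_le) simp
  then show "vnorm m (\<lambda>i. \<Sum>j<n. H i j * x j) \<le> 1 * vnorm n x" by (simp add: hx_def)
qed

text \<open>Contractivity without spectral theory: for selfadjoint \<open>h\<close> of norm below 1,
  the identity supplied by \<open>selfadjoint_defect_root\<close> survives \<open>\<phi>\<close> and
  bounds the image by 1. Scaling extends this to all selfadjoint elements, the C*-identity to all
  elements.\<close>

lemma star_hom_Bop_contractive:
  assumes A: "cstar_algebra A" and \<phi>: "star_hom A (Bop I) \<phi>" and x: "x \<in> carrier A"
  shows "op_norm (ent (\<phi> x)) \<le> cnorm A x"
proof -
  interpret cstar_algebra A by (rule A)
  have b: "bounded_op (ent (\<phi> y))" if "y \<in> carrier A" for y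
    using \<phi> that by (auto simp: star_hom_def Bop_simps)
  have one: "op_norm (ent (\<phi> h)) \<le> 1"
    if h: "h \<in> carrier A" "adj A h = h" "cnorm A h < 1" for h
  proof -
    obtain k where k: "k \<in> carrier A" "adj A k = k"
      "k \<oplus>\<^bsub>A\<^esub> k = h \<otimes>\<^bsub>A\<^esub> h \<oplus>\<^bsub>A\<^esub> k \<otimes>\<^bsub>A\<^esub> k"
      using selfadjoint_defect_root[OF h] .
    have "ent (\<phi> (k \<oplus>\<^bsub>A\<^esub> k)) = ent (\<phi> (h \<otimes>\<^bsub>A\<^esub> h \<oplus>\<^bsub>A\<^esub> k \<otimes>\<^bsub>A\<^esub> k))" using k by simp
    then have "(\<lambda>i j. ent (\<phi> k) i j + ent (\<phi> k) i j)
        = (\<lambda>i j. op_mult (ent (\<phi> h)) (ent (\<phi> h)) i j + op_mult (ent (\<phi> k)) (ent (\<phi> k)) i j)"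
      using \<phi> h k(1) by (simp add: star_hom_def Bop_simps)
    moreover have "op_adj (ent (\<phi> y)) = ent (\<phi> y)" if "y \<in> carrier A" "adj A y = y" for y
      using \<phi> that unfolding star_hom_def by (metis Bop_simps(6) ent_mk)
    ultimately have "op_bound (ent (\<phi> h)) 1"
      using h k by (intro op_bound_1_if_defect_root[where K = "ent (\<phi> k)"] b) (auto dest: fun_cong)
    then show ?thesis by (intro op_norm_le) auto
  qed
  have sa: "op_norm (ent (\<phi> h)) \<le> cnorm A h" if h: "h \<in> carrier A" "adj A h = h" for h
  proof (rule field_le_epsilon)
    fix e :: real assume e: "e > 0"
    \<comment> \<open>Slightly more than the norm, so that division by \<open>r\<close> is possible
      and leaves a norm strictly below 1.\<close>
    define r where "r = cnorm A h + e"
    have r: "r > 0" "cnorm A h < r" using norm_nonneg[OF h(1)] e by (auto simp: r_def)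
    define g where "g = complex_of_real (1 / r) \<odot>\<^bsub>A\<^esub> h"
    have g: "g \<in> carrier A" "adj A g = g" using h by (simp_all add: g_def adj_smult)
    have "cnorm A g = (1 / r) * cnorm A h" using h r by (simp add: g_def norm_smult norm_divide)
    then have "cnorm A g < 1" using r by simp
    have "ent (\<phi> g) = (\<lambda>i j. complex_of_real (1 / r) * ent (\<phi> h) i j)"
      using \<phi> h by (simp add: star_hom_def g_def Bop_simps del: of_real_divide)
    then have "op_norm (ent (\<phi> g)) = (1 / r) * op_norm (ent (\<phi> h))"
      using op_norm_smult[OF b[OF h(1)], of "complex_of_real (1 / r)"] r by (simp add: norm_divide)
    with one[OF g \<open>cnorm A g < 1\<close>] r have "op_norm (ent (\<phi> h)) \<le> r" by (simp add: field_simps)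
    then show "op_norm (ent (\<phi> h)) \<le> cnorm A h + e" by (simp add: r_def)
  qed
  have "(op_norm (ent (\<phi> x)))\<^sup>2 = op_norm (ent (\<phi> (adj A x \<otimes>\<^bsub>A\<^esub> x)))"
    using \<phi> x b[OF x] by (simp add: star_hom_def Bop_simps op_norm_cstar)
  also have "\<dots> \<le> cnorm A (adj A x \<otimes>\<^bsub>A\<^esub> x)"
    using x by (intro sa) (auto simp: adj_mult adj_adj)
  also have "\<dots> = (cnorm A x)\<^sup>2" using x by (rule norm_cstar)
  finally show ?thesis using norm_nonneg[OF x] by (rule power2_le_imp_le)
qed

section \<open>Walks in graphs whose cycles have no exits\<close>

context wf_digraph
begin

section \<open>Closed walks and cycles\<close>

definition on_cycle :: "'a \<Rightarrow> bool" where
  "on_cycle u \<longleftrightarrow> (\<exists>c. c \<noteq> [] \<and> awalk u c u)"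

text \<open>The basis of the finite-dimensional representation attached to a sink, an infinite emitter or
  a vertex on a cycle.\<close>

definition first_walks :: "'a \<Rightarrow> 'b list set" where
  "first_walks w = {\<mu>. \<exists>v. awalk v \<mu> w \<and> w \<notin> tail G ` set \<mu>}"

definition walk_source :: "'a \<Rightarrow> 'b list \<Rightarrow> 'a" where
  "walk_source w \<mu> = (if \<mu> = [] then w else tail G (hd \<mu>))"

lemma awalk_append_ex: "awalk u (p @ q) w \<longleftrightarrow> (\<exists>v. awalk u p v \<and> awalk v q w)"
proof
  assume "awalk u (p @ q) w"
  then show "\<exists>v. awalk u p v \<and> awalk v q w" unfolding awalk_append_iff by blast
qed (auto intro: awalk_appendI simp del: awalk_append_iff)

lemma awalk_source: "awalk u \<mu> w \<Longrightarrow> u = walk_source w \<mu>"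
  by (cases \<mu>) (auto simp: walk_source_def awalk_Cons_iff awalk_Nil_iff)

lemma shortest_closed_walk:
  assumes "on_cycle u"
  obtains c where "c \<noteq> []" "awalk u c u" "\<And>d. d \<noteq> [] \<Longrightarrow> awalk u d u \<Longrightarrow> length c \<le> length d"
proof -
  obtain c0 where "c0 \<noteq> [] \<and> awalk u c0 u" using assms by (auto simp: on_cycle_def)
  then show ?thesis
    using ex_has_least_nat[of "\<lambda>c. c \<noteq> [] \<and> awalk u c u" c0 length] that by blast
qed

text \<open>A shortest closed walk at \<open>u\<close> does not come back to \<open>u\<close> early,
  since its part from that visit on would be a shorter closed walk.\<close>

lemma first_return_walk:
  assumes "on_cycle u"
  obtains e \<nu> where "awalk u (e # \<nu>) u" "u \<notin> tail G ` set \<nu>"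
proof -
  obtain c where c: "c \<noteq> []" "awalk u c u" "\<And>d. d \<noteq> [] \<Longrightarrow> awalk u d u \<Longrightarrow> length c \<le> length d"
    using shortest_closed_walk[OF assms] by blast
  obtain e \<nu> where e: "c = e # \<nu>" using c(1) by (cases c) auto
  have "u \<notin> tail G ` set \<nu>"
  proof
    assume "u \<in> tail G ` set \<nu>"
    then obtain b where b: "b \<in> set \<nu>" "tail G b = u" by auto
    then obtain x y where xy: "\<nu> = x @ b # y" by (meson split_list)
    have "awalk u (e # x @ b # y) u" using c(2) e xy by simp
    then have "awalk u (b # y) u"
      using b(2) awalk_append_ex[of u "e # x" "b # y" u] by (auto simp: awalk_Cons_iff)
    from c(3)[OF _ this] show False using e xy by simp
  qed
  with that c(2) e show ?thesis by blast
qed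

lemma split_repeated_tail:
  assumes "\<not> distinct (map (tail G) d)"
  obtains xs a ys b zs where "d = xs @ a # ys @ b # zs" "tail G a = tail G b"
proof -
  obtain xs ys zs y where d: "map (tail G) d = xs @ [y] @ ys @ [y] @ zs"
    using not_distinct_decomp[OF assms] by blast
  then obtain xs' r where r: "d = xs' @ r" "map (tail G) r = y # ys @ y # zs"
    by (auto simp: map_eq_append_conv)
  then obtain a r' where r': "r = a # r'" "tail G a = y" "map (tail G) r' = ys @ y # zs" by auto
  then obtain ys' r'' where r'': "r' = ys' @ r''" "map (tail G) r'' = y # zs"
    by (auto simp: map_eq_append_conv)
  then obtain b zs' where "r'' = b # zs'" "tail G b = y" by auto
  with r r' r'' that show ?thesis by simp
qed

text \<open>Cutting out the loop between two edges with equal source would leave a shorter closed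
  walk, still nonempty because the second of the two edges survives.\<close>

lemma shortest_closed_walk_distinct:
  assumes d: "d \<noteq> []" "awalk u d u" "\<And>d'. d' \<noteq> [] \<Longrightarrow> awalk u d' u \<Longrightarrow> length d \<le> length d'"
  shows "distinct (map (tail G) d)"
proof (rule ccontr)
  assume "\<not> distinct (map (tail G) d)"
  then obtain xs a ys b zs where s: "d = xs @ a # ys @ b # zs" "tail G a = tail G b"
    by (rule split_repeated_tail)
  obtain v where v: "awalk u xs v" "awalk v (a # ys @ b # zs) u"
    using d(2) unfolding s(1) awalk_append_ex by blast
  have "awalk v ((a # ys) @ (b # zs)) u" using v(2) by simp
  then have "awalk (tail G b) (b # zs) u" unfolding awalk_append_ex by (auto simp: awalk_Cons_iff)
  moreover have "v = tail G b" using v(2) s(2) by (simp add: awalk_Cons_iff)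
  ultimately have "awalk u (xs @ b # zs) u" using v(1) by (metis awalk_appendI)
  from d(3)[OF _ this] show False using s(1) by simp
qed

lemma on_cycle_graph_cycle:
  assumes "on_cycle u" shows "\<exists>\<mu>. graph_cycle G \<mu> \<and> u \<in> cycle_verts G \<mu>"
proof -
  obtain c where c: "c \<noteq> []" "awalk u c u" "\<And>d. d \<noteq> [] \<Longrightarrow> awalk u d u \<Longrightarrow> length c \<le> length d"
    using shortest_closed_walk[OF assms] by blast
  have "graph_cycle G c" using c shortest_closed_walk_distinct[OF c] by (auto simp: graph_cycle_def)
  moreover have "u \<in> cycle_verts G c"
    using c(1,2) by (cases c) (auto simp: cycle_verts_def awalk_Cons_iff)
  ultimately show ?thesis by blast
qed

lemma graph_cycle_on_cycle:
  assumes "graph_cycle G \<mu>" "u \<in> cycle_verts G \<mu>" shows "on_cycle u"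
proof -
  obtain v where v: "awalk v \<mu> v" using assms(1) by (auto simp: graph_cycle_def)
  obtain e where e: "e \<in> set \<mu>" "u = tail G e" using assms(2) by (auto simp: cycle_verts_def)
  obtain x y where xy: "\<mu> = x @ e # y" using e(1) by (meson split_list)
  then have "awalk v x u" "awalk u (e # y) v"
    using v e(2) by (auto simp: awalk_append_ex awalk_Cons_iff simp del: awalk_append_iff)
  then have "awalk u ((e # y) @ x) u" by (metis awalk_appendI)
  then show ?thesis unfolding on_cycle_def by blast
qed

end

section \<open>Walks forced by the absence of exits\<close>

locale exitless_digraph = wf_digraph +
  assumes no_exit: "graph_cycle G \<mu> \<Longrightarrow> \<not> has_exit G \<mu>"
begin

text \<open>A shortest closed walk at \<open>u\<close> is a cycle. Without exits it contains every
  edge leaving \<open>u\<close>, and since its sources are distinct there is only one such edge;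
  hence every closed walk at \<open>u\<close> begins with it.\<close>

lemma out_arc_closed_walk:
  assumes c: "awalk u c u" "c \<noteq> []" and e: "e \<in> arcs G" "tail G e = u"
  shows "e = hd c"
proof -
  have "on_cycle u" using c by (auto simp: on_cycle_def)
  then obtain d where d: "d \<noteq> []" "awalk u d u" "\<And>d'. d' \<noteq> [] \<Longrightarrow> awalk u d' u \<Longrightarrow> length d \<le> length d'"
    using shortest_closed_walk by blast
  have dist: "distinct (map (tail G) d)" using shortest_closed_walk_distinct[OF d] .
  have cyc: "graph_cycle G d" using d dist by (auto simp: graph_cycle_def)
  have hd: "hd d' \<in> arcs G" "tail G (hd d') = u" if "d' \<noteq> []" "awalk u d' u" for d'
    using that by (cases d'; simp add: awalk_Cons_iff)+
  have "f = hd d" if f: "f \<in> arcs G" "tail G f = u" for f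
  proof -
    have "tail G f \<in> cycle_verts G d"
      using f hd[OF d(1,2)] d(1) unfolding cycle_verts_def by (metis hd_in_set image_eqI)
    then have "f \<in> set d" using no_exit[OF cyc] f(1) by (auto simp: has_exit_def)
    then show ?thesis
      using dist f hd[OF d(1,2)] d(1) by (metis distinct_map hd_in_set inj_onD)
  qed
  then show ?thesis using e hd[OF c(2,1)] by metis
qed

text \<open>Each step of the walk is forced to follow the closed walk, so the walk never leaves its
  vertices.\<close>

lemma walk_from_closed_walk:
  "awalk u \<rho> w \<Longrightarrow> awalk u c u \<Longrightarrow> c \<noteq> [] \<Longrightarrow> w \<in> tail G ` set c"
proof (induction \<rho> arbitrary: u c)
  case Nil
  then show ?case by (cases c) (auto simp: awalk_Cons_iff awalk_Nil_iff)
next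
  case (Cons e \<rho>)
  have e: "e \<in> arcs G" "tail G e = u" "awalk (head G e) \<rho> w"
    using Cons.prems(1) by (auto simp: awalk_Cons_iff)
  have "e = hd c" using out_arc_closed_walk[OF Cons.prems(2,3) e(1,2)] .
  then obtain c' where c': "c = e # c'" using Cons.prems(3) by (cases c) auto
  \<comment> \<open>The closed walk is rotated by one edge so that it starts where the rest of the
    walk does.\<close>
  have "awalk (head G e) c' u" using Cons.prems(2) c' by (auto simp: awalk_Cons_iff)
  moreover have "awalk u [e] (head G e)" using e arc_implies_awalk by blast
  ultimately have "awalk (head G e) (c' @ [e]) (head G e)" by (rule awalk_appendI)
  from Cons.IH[OF e(3) this] c' show ?case by auto
qed

lemma on_cycle_walk:
  assumes "on_cycle u" "awalk u \<rho> w"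
  shows "on_cycle w" and "\<exists>\<gamma>. awalk w \<gamma> u"
proof -
  obtain c where c: "awalk u c u" "c \<noteq> []" using assms(1) by (auto simp: on_cycle_def)
  obtain e where e: "e \<in> set c" "w = tail G e" using walk_from_closed_walk[OF assms(2) c] by auto
  obtain x y where xy: "c = x @ e # y" using e(1) by (meson split_list)
  then have *: "awalk u x w" "awalk w (e # y) u"
    using c(1) e(2) by (auto simp: awalk_append_ex awalk_Cons_iff simp del: awalk_append_iff)
  then have "awalk w ((e # y) @ x) w" by (metis awalk_appendI)
  then show "on_cycle w" unfolding on_cycle_def by blast
  show "\<exists>\<gamma>. awalk w \<gamma> u" using * by blast
qed

lemma out_arc_unique:
  assumes "on_cycle u" "e \<in> arcs G" "f \<in> arcs G" "tail G e = u" "tail G f = u"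
  shows "e = f"
  using assms out_arc_closed_walk unfolding on_cycle_def by metis

lemma on_cycle_out_arcs:
  assumes "on_cycle u" "e \<in> arcs G" "tail G e = u" shows "out_arcs G u = {e}"
  using assms out_arc_unique by auto

lemma first_walk_unique:
  "on_cycle v \<Longrightarrow> awalk v \<mu> w \<Longrightarrow> awalk v \<nu> w \<Longrightarrow> w \<notin> tail G ` set \<mu> \<Longrightarrow> w \<notin> tail G ` set \<nu> \<Longrightarrow> \<mu> = \<nu>"
proof (induction \<mu> arbitrary: v \<nu>)
  case Nil
  then show ?case by (cases \<nu>) (auto simp: awalk_simps)
next
  case (Cons e \<mu>)
  from Cons.prems obtain f \<nu>' where f: "\<nu> = f # \<nu>'" by (cases \<nu>) (auto simp: awalk_simps)
  have "e = f"
    using Cons.prems f by (intro out_arc_unique[of v]) (auto simp: awalk_simps)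
  moreover have "on_cycle (head G e)"
    using Cons.prems on_cycle_walk(1)[of v "[e]" "head G e"] by (auto simp: awalk_simps intro: arc_implies_awalk)
  ultimately show ?case
    using Cons.IH[of "head G e" \<nu>'] Cons.prems f by (auto simp: awalk_simps)
qed

text \<open>The closed walk is cut at its first return to \<open>u\<close>. As walks from cycle
  vertices are forced, the piece cut off is the given first-return loop, and the remainder is
  shorter.\<close>

lemma closed_walk_power:
  assumes c: "awalk u (e # \<nu>) u" "u \<notin> tail G ` set \<nu>"
  shows "awalk u \<alpha> u \<Longrightarrow> \<exists>k\<le>length \<alpha>. \<alpha> = concat (replicate k (e # \<nu>))"
proof (induction \<alpha> rule: length_induct)
  case (1 \<alpha>)
  show ?case
  proof (cases \<alpha>)
    case Nil
    then show ?thesis by (intro exI[of _ 0]) auto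
  next
    case (Cons f \<alpha>')
    have f: "f \<in> arcs G" "tail G f = u" "awalk (head G f) \<alpha>' u"
      using "1.prems" Cons by (auto simp: awalk_simps)
    have fe: "f = e" using out_arc_closed_walk[OF c(1) _ f(1,2)] by simp
    define a where "a = takeWhile (\<lambda>g. tail G g \<noteq> u) \<alpha>'"
    define b where "b = dropWhile (\<lambda>g. tail G g \<noteq> u) \<alpha>'"
    have ab: "\<alpha>' = a @ b" by (simp add: a_def b_def)
    obtain v where v: "awalk (head G f) a v" "awalk v b u"
      using f(3) unfolding ab awalk_append_ex by blast
    have "v = u"
    proof (cases b)
      case Nil
      then show ?thesis using v(2) by (simp add: awalk_simps)
    next
      case (Cons g b')
      then have "tail G g = u" using hd_dropWhile[of "\<lambda>g. tail G g \<noteq> u" \<alpha>'] unfolding b_def[symmetric] by simp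
      then show ?thesis using v(2) Cons by (simp add: awalk_simps)
    qed
    have ua: "u \<notin> tail G ` set a" unfolding a_def using set_takeWhileD by fastforce
    have "on_cycle (head G e)"
      using on_cycle_walk(1)[of u "[e]" "head G e"] c(1) f fe arc_implies_awalk[of e]
      unfolding on_cycle_def by blast
    then have "\<nu> = a"
      using first_walk_unique[of "head G e" \<nu> u a] v \<open>v = u\<close> ua c fe by (auto simp: awalk_simps)
    moreover obtain k where k: "k \<le> length b" "b = concat (replicate k (e # \<nu>))"
      using "1.IH"[rule_format, of b] v \<open>v = u\<close> ab Cons by auto
    ultimately have "\<alpha> = concat (replicate (Suc k) (e # \<nu>))" using Cons fe ab by simp
    moreover have "Suc k \<le> length \<alpha>" using k Cons ab by simp
    ultimately show ?thesis by blast
  qed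
qed

text \<open>A repeated vertex would lie on a closed walk inside \<open>\<mu>\<close>, whose vertices
  the rest of \<open>\<mu>\<close> cannot leave; so \<open>w\<close> would already be the source of
  an edge of \<open>\<mu>\<close>.\<close>

lemma first_walk_distinct:
  assumes "awalk v \<mu> w" "w \<notin> tail G ` set \<mu>"
  shows "distinct (map (tail G) \<mu>)"
proof (rule ccontr)
  assume "\<not> distinct (map (tail G) \<mu>)"
  then obtain xs a ys b zs where s: "\<mu> = xs @ a # ys @ b # zs" "tail G a = tail G b"
    by (rule split_repeated_tail)
  obtain u where u: "awalk v xs u" "awalk u (a # ys @ b # zs) w"
    using assms(1) unfolding s(1) awalk_append_ex by blast
  then have "awalk u ((a # ys) @ (b # zs)) w" by simp
  then obtain u' where u': "awalk u (a # ys) u'" "awalk u' (b # zs) w"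
    unfolding awalk_append_ex by blast
  then have "u' = u" using s(2) by (simp add: awalk_simps)
  with u' walk_from_closed_walk[OF u(2), of "a # ys"] have "w \<in> tail G ` set (a # ys)" by simp
  then show False using assms(2) s(1) by auto
qed

lemma first_walks_suffix:
  assumes "\<nu> @ \<mu> \<in> first_walks w" shows "\<mu> \<in> first_walks w"
  using assms unfolding first_walks_def by (auto simp: awalk_append_ex simp del: awalk_append_iff)

text \<open>The nodes of the tree are the walks in \<open>first_walks w\<close>, extended at the
  front; finite in-degree makes it finitely branching. The edges added along an infinite branch are
  distinct because the sources in a first walk are, so they form a backward chain.\<close>

lemma finite_first_walks:
  assumes recv: "\<And>v. v \<in> verts G \<Longrightarrow> finite (in_arcs G v)"
    and chain: "\<not> (\<exists>I e. infinite_backward_chain G I e)"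
    and w: "w \<in> verts G"
  shows "finite (first_walks w)"
proof (rule ccontr)
  assume inf: "infinite (first_walks w)"
  \<comment> \<open>The nodes with infinitely many descendants.\<close>
  define P where "P = (\<lambda>\<mu>. \<mu> \<in> first_walks w \<and> infinite {\<nu>. \<nu> @ \<mu> \<in> first_walks w})"
  have P0: "P []"
    using inf w by (simp add: P_def first_walks_def awalk_simps del: awalk_append_iff)
  have step: "\<exists>e. P (e # \<mu>)" if P\<mu>: "P \<mu>" for \<mu>
  proof (rule ccontr)
    assume no: "\<nexists>e. P (e # \<mu>)"
    obtain v where v: "awalk v \<mu> w" using P\<mu> by (auto simp: P_def first_walks_def)
    have fin: "finite {\<nu>. \<nu> @ (e # \<mu>) \<in> first_walks w}" for e
    proof (cases "e # \<mu> \<in> first_walks w")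
      case True
      then show ?thesis using no by (auto simp: P_def)
    next
      case False
      then have "{\<nu>. \<nu> @ (e # \<mu>) \<in> first_walks w} = {}" using first_walks_suffix by blast
      then show ?thesis by simp
    qed
    have "{\<nu>. \<nu> @ \<mu> \<in> first_walks w}
        \<subseteq> insert [] (\<Union>e\<in>in_arcs G v. (\<lambda>\<nu>. \<nu> @ [e]) ` {\<nu>. \<nu> @ (e # \<mu>) \<in> first_walks w})"
    proof
      fix \<nu> assume \<nu>: "\<nu> \<in> {\<nu>. \<nu> @ \<mu> \<in> first_walks w}"
      show "\<nu> \<in> insert [] (\<Union>e\<in>in_arcs G v. (\<lambda>\<nu>. \<nu> @ [e]) ` {\<nu>. \<nu> @ (e # \<mu>) \<in> first_walks w})"
      proof (cases \<nu> rule: rev_cases)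
        case (snoc \<nu>' e)
        then have 1: "\<nu>' @ (e # \<mu>) \<in> first_walks w" using \<nu> by simp
        then have "e # \<mu> \<in> first_walks w" by (rule first_walks_suffix)
        then obtain v' where v': "awalk v' (e # \<mu>) w" by (auto simp: first_walks_def)
        then have "head G e = v" using awalk_source v by (metis awalk_Cons_iff)
        moreover have "e \<in> arcs G" using v' by (simp add: awalk_simps)
        ultimately show ?thesis using 1 snoc by auto
      qed simp
    qed
    moreover have "finite (in_arcs G v)" using recv v by (meson awalk_hd_in_verts)
    ultimately have "finite {\<nu>. \<nu> @ \<mu> \<in> first_walks w}"
      using fin by (meson finite_UN_I finite_imageI finite_insert finite_subset)
    then show False using P\<mu> by (simp add: P_def)
  qed
  have "\<exists>f. \<forall>n. P (f n) \<and> (\<exists>e. f (Suc n) = e # f n)"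
    using step P0 by (intro dependent_nat_choice[where P = "\<lambda>_. P" and Q = "\<lambda>_ x y. \<exists>e. y = e # x"]) blast+
  then obtain f where f: "\<And>n. P (f n)" "\<And>n. \<exists>e. f (Suc n) = e # f n" by metis
  then obtain g where g: "\<And>n. f (Suc n) = g n # f n" by metis
  have walk: "\<exists>v. awalk v (f n) w" "distinct (map (tail G) (f n))" for n
    using f(1)[of n] first_walk_distinct unfolding P_def first_walks_def by blast+
  have sub: "g m \<in> set (f n)" if "m < n" for m n
    using that by (induction n) (auto simp: g less_Suc_eq)
  have gne: "g m \<noteq> g n" if "m < n" for m n
    using sub[OF that] walk(2)[of "Suc n"] unfolding g by auto
  have garc: "g n \<in> arcs G" for n using walk(1)[of "Suc n"] unfolding g by (auto simp: awalk_simps)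
  have gstep: "head G (g (Suc n)) = tail G (g n)" for n
    using walk(1)[of "Suc (Suc n)"] unfolding g by (auto simp: awalk_simps)
  have ginj: "m = n" if "g m = g n" for m n
    using gne that by (metis nat_neq_iff)
  \<comment> \<open>\<open>g\<close> lists the edges against their direction, hence the change of
    sign.\<close>
  have "infinite_backward_chain G {..0} (\<lambda>i. g (nat (- i)))"
    unfolding infinite_backward_chain_def
  proof (intro conjI allI impI)
    show "inj_on (\<lambda>i. g (nat (- i))) {..0}"
    proof (rule inj_onI)
      fix x y :: int assume "x \<in> {..0}" "y \<in> {..0}" "g (nat (- x)) = g (nat (- y))"
      then show "x = y" using ginj[of "nat (- x)" "nat (- y)"] by simp
    qed
    fix i :: int assume i: "i \<in> {..0} \<and> i + 1 \<in> {..0}"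
    then have "nat (- i) = Suc (nat (- (i + 1)))" by (simp add: nat_eq_iff)
    then show "head G (g (nat (- i))) = tail G (g (nat (- (i + 1))))" by (simp only: gstep)
  qed (use garc in auto)
  then show False using chain by blast
qed

text \<open>Edges act by prepending, except that an edge leaving \<open>w\<close> closes a loop and
  resets the walk to the empty one with weight \<open>z\<close>. At a sink or an infinite emitter no
  relation asks for the empty walk to be covered; on a cycle the first-return loop covers
  it.\<close>

lemma branching_first_walks:
  assumes w: "w \<in> verts G" "out_arcs G w = {} \<or> infinite (out_arcs G w) \<or> on_cycle w" and z: "cmod z = 1"
  shows "branching_system G (first_walks w) (walk_source w)
    (\<lambda>e \<mu>. if tail G e = w then [] else e # \<mu>) (\<lambda>e \<mu>. if tail G e = w then z else 1)"
proof
  have walk: "awalk (head G e) \<mu> w" if "\<mu> \<in> first_walks w" "walk_source w \<mu> = head G e" for e \<mu>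
    using that awalk_source unfolding first_walks_def by fastforce
  have nil: "[] \<in> first_walks w" using w by (simp add: first_walks_def awalk_simps)
  have cons: "e # \<mu> \<in> first_walks w"
    if "e \<in> arcs G" "\<mu> \<in> first_walks w" "walk_source w \<mu> = head G e" "tail G e \<noteq> w" for e \<mu>
    using that walk[OF that(2,3)] unfolding first_walks_def by (auto simp: awalk_simps)
  show "(if tail G e = w then [] else e # \<mu>) \<in> first_walks w"
    if "e \<in> arcs G" "\<mu> \<in> first_walks w" "walk_source w \<mu> = head G e" for e \<mu>
    using nil cons[OF that] by simp
  show "walk_source w (if tail G e = w then [] else e # \<mu>) = tail G e"
    if "e \<in> arcs G" "\<mu> \<in> first_walks w" "walk_source w \<mu> = head G e" for e \<mu>
    by (simp add: walk_source_def)
  show "cmod (if tail G e = w then z else 1) = 1" for e by (simp add: z)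
  show "e = f \<and> \<mu> = \<nu>"
    if ef: "e \<in> arcs G" "f \<in> arcs G" and \<mu>: "\<mu> \<in> first_walks w" "\<nu> \<in> first_walks w"
      "walk_source w \<mu> = head G e" "walk_source w \<nu> = head G f"
      and eq: "(if tail G e = w then [] else e # \<mu>) = (if tail G f = w then [] else f # \<nu>)" for e f \<mu> \<nu>
  proof (cases "tail G e = w")
    case True
    then have t: "tail G e = w" "tail G f = w" using eq by (auto split: if_splits)
    \<comment> \<open>An edge from \<open>w\<close> that acts on some basis walk closes a walk at
      \<open>w\<close>, so \<open>w\<close> lies on a cycle and emits only this edge.\<close>
    have "awalk w (e # \<mu>) w" using walk[OF \<mu>(1,3)] ef t by (simp add: awalk_simps)
    then have cyc: "on_cycle w" unfolding on_cycle_def by blast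
    have e: "e = f" using out_arc_unique[OF cyc ef t] .
    have "on_cycle (head G e)"
      using on_cycle_walk(1)[OF cyc, of "[e]" "head G e"] t ef arc_implies_awalk[of e] by simp
    then have "\<mu> = \<nu>"
      using walk[OF \<mu>(1,3)] walk[OF \<mu>(2,4)] \<mu>(1,2) e
      by (intro first_walk_unique) (auto simp: first_walks_def)
    with e show ?thesis by simp
  next
    case False
    with eq show ?thesis by (auto split: if_splits)
  qed
  show "\<exists>e\<in>arcs G. \<exists>\<nu>\<in>first_walks w. walk_source w \<nu> = head G e \<and> (if tail G e = w then [] else e # \<nu>) = \<mu>"
    if \<mu>: "\<mu> \<in> first_walks w" and reg: "out_arcs G (walk_source w \<mu>) \<noteq> {}" "finite (out_arcs G (walk_source w \<mu>))" for \<mu>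
  proof (cases \<mu>)
    case Nil
    then have "on_cycle w" using reg w by (auto simp: walk_source_def)
    then obtain e \<nu> where e: "awalk w (e # \<nu>) w" "w \<notin> tail G ` set \<nu>" by (rule first_return_walk)
    then have 1: "e \<in> arcs G" "tail G e = w" "awalk (head G e) \<nu> w" by (auto simp: awalk_simps)
    then have "\<nu> \<in> first_walks w" using e(2) by (auto simp: first_walks_def)
    moreover have "walk_source w \<nu> = head G e" using awalk_source[OF 1(3)] by simp
    ultimately show ?thesis using 1 Nil by auto
  next
    case (Cons e \<nu>)
    obtain v where v: "awalk v (e # \<nu>) w" "w \<notin> tail G ` set (e # \<nu>)"
      using \<mu> Cons by (auto simp: first_walks_def)
    then have 1: "e \<in> arcs G" "tail G e \<noteq> w" "awalk (head G e) \<nu> w" by (auto simp: awalk_simps)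
    moreover have "\<nu> \<in> first_walks w" using 1 v(2) by (auto simp: first_walks_def)
    moreover have "walk_source w \<nu> = head G e" using awalk_source[OF 1(3)] by simp
    ultimately show ?thesis using Cons by auto
  qed
qed

end

section \<open>Monomials in a Cuntz--Krieger family\<close>

context cstar_algebra
begin

section \<open>Finite sums in C*-algebras\<close>

lemma finsum_mult_right:
  assumes "finite F" "\<And>i. i \<in> F \<Longrightarrow> f i \<in> carrier A" "x \<in> carrier A"
  shows "(\<Oplus>i\<in>F. f i) \<otimes> x = (\<Oplus>i\<in>F. f i \<otimes> x)"
  using assms
proof (induction F rule: finite_induct)
  case (insert a F)
  have c: "(\<Oplus>i\<in>F. f i) \<in> carrier A" using insert by (intro M.finsum_closed) auto
  have "(\<Oplus>i\<in>insert a F. f i) = f a \<oplus> (\<Oplus>i\<in>F. f i)"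
    using insert by (intro M.finsum_insert) auto
  moreover have "(\<Oplus>i\<in>insert a F. f i \<otimes> x) = f a \<otimes> x \<oplus> (\<Oplus>i\<in>F. f i \<otimes> x)"
    using insert by (intro M.finsum_insert) auto
  ultimately show ?case using insert c by (simp add: mult_add_left)
qed simp

lemma adj_finsum:
  assumes "finite F" "\<And>i. i \<in> F \<Longrightarrow> f i \<in> carrier A"
  shows "adj A (\<Oplus>i\<in>F. f i) = (\<Oplus>i\<in>F. adj A (f i))"
  using assms
proof (induction F rule: finite_induct)
  case (insert a F)
  have c: "(\<Oplus>i\<in>F. f i) \<in> carrier A" using insert by (intro M.finsum_closed) auto
  have "(\<Oplus>i\<in>insert a F. f i) = f a \<oplus> (\<Oplus>i\<in>F. f i)"
    using insert by (intro M.finsum_insert) auto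
  moreover have "(\<Oplus>i\<in>insert a F. adj A (f i)) = adj A (f a) \<oplus> (\<Oplus>i\<in>F. adj A (f i))"
    using insert by (intro M.finsum_insert) auto
  ultimately show ?case using insert c by (simp add: adj_add)
qed simp

text \<open>The adjoint exchanges left and right multiplication, which reduces this to
  \<open>finsum_mult_right\<close>.\<close>

lemma finsum_mult_left:
  assumes "finite F" "\<And>i. i \<in> F \<Longrightarrow> f i \<in> carrier A" "x \<in> carrier A"
  shows "x \<otimes> (\<Oplus>i\<in>F. f i) = (\<Oplus>i\<in>F. x \<otimes> f i)"
proof -
  have 1: "(\<Oplus>i\<in>F. f i) \<in> carrier A" "(\<Oplus>i\<in>F. x \<otimes> f i) \<in> carrier A"
    using assms by (auto intro!: M.finsum_closed)
  have "adj A (x \<otimes> (\<Oplus>i\<in>F. f i)) = adj A (\<Oplus>i\<in>F. x \<otimes> f i)"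
  proof -
    have "adj A (x \<otimes> (\<Oplus>i\<in>F. f i)) = (\<Oplus>i\<in>F. adj A (f i)) \<otimes> adj A x"
      using assms 1 by (simp add: adj_mult adj_finsum)
    also have "\<dots> = (\<Oplus>i\<in>F. adj A (f i) \<otimes> adj A x)"
      using assms by (intro finsum_mult_right) auto
    also have "\<dots> = (\<Oplus>i\<in>F. adj A (x \<otimes> f i))"
      using assms by (intro M.finsum_cong') (auto simp: adj_mult)
    finally show ?thesis using assms by (simp add: adj_finsum)
  qed
  then have "adj A (adj A (x \<otimes> (\<Oplus>i\<in>F. f i))) = adj A (adj A (\<Oplus>i\<in>F. x \<otimes> f i))" by simp
  then show ?thesis using assms 1 by (simp add: adj_adj)
qed

lemma finsum_single:
  assumes "finite F" "a \<in> F" "x \<in> carrier A" "\<And>i. i \<in> F \<Longrightarrow> f i = (if i = a then x else \<zero>)"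
  shows "(\<Oplus>i\<in>F. f i) = x"
proof -
  have "(\<Oplus>i\<in>F. f i) = (\<Oplus>i\<in>F. if a = i then x else \<zero>)"
    using assms by (intro M.finsum_cong') auto
  also have "\<dots> = x" using assms by (intro M.finsum_singleton[where f = "\<lambda>_. x"]) auto
  finally show ?thesis .
qed

lemma finsum_all_zero:
  assumes "\<And>i. i \<in> F \<Longrightarrow> f i = \<zero>" shows "(\<Oplus>i\<in>F. f i) = \<zero>"
proof -
  have "(\<Oplus>i\<in>F. f i) = (\<Oplus>i\<in>F. \<zero>)" using assms by (intro M.finsum_cong') auto
  then show ?thesis by simp
qed

end

section \<open>Cuntz-Krieger relations and path elements\<close>

locale ck_algebra = wf_digraph G + cstar_algebra A
  for G :: "('v, 'e) pre_digraph" and A :: "('a, 'b) cstar_scheme" (structure) +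
  fixes p :: "'v \<Rightarrow> 'a" and s :: "'e \<Rightarrow> 'a"
  assumes ck: "ck_family G A p s"
begin

lemma p_closed [simp]: "v \<in> verts G \<Longrightarrow> p v \<in> carrier A"
  and p_idem [simp]: "v \<in> verts G \<Longrightarrow> p v \<otimes> p v = p v"
  and adj_p [simp]: "v \<in> verts G \<Longrightarrow> adj A (p v) = p v"
  and p_orth: "v \<in> verts G \<Longrightarrow> w \<in> verts G \<Longrightarrow> v \<noteq> w \<Longrightarrow> p v \<otimes> p w = \<zero>"
  and s_closed [simp]: "e \<in> arcs G \<Longrightarrow> s e \<in> carrier A"
  and adj_s_s: "e \<in> arcs G \<Longrightarrow> adj A (s e) \<otimes> s e = p (head G e)"
  and p_regular: "v \<in> verts G \<Longrightarrow> out_arcs G v \<noteq> {} \<Longrightarrow> finite (out_arcs G v) \<Longrightarrow>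
    p v = (\<Oplus>e\<in>out_arcs G v. s e \<otimes> adj A (s e))"
  using ck unfolding ck_family_def projection_def partial_isometry_def by blast+

lemma verts_ends [simp]: "e \<in> arcs G \<Longrightarrow> tail G e \<in> verts G" "e \<in> arcs G \<Longrightarrow> head G e \<in> verts G"
  by auto

lemma s_adj_s: "e \<in> arcs G \<Longrightarrow> s e \<otimes> adj A (s e) \<otimes> s e = s e"
  using ck unfolding ck_family_def partial_isometry_def by blast

lemma s_p: "e \<in> arcs G \<Longrightarrow> s e \<otimes> p (head G e) = s e"
  using s_adj_s[of e] by (simp add: mult_assoc flip: adj_s_s)

lemma p_s: assumes e: "e \<in> arcs G" shows "p (tail G e) \<otimes> s e = s e"
proof -
  have "p (tail G e) \<otimes> (s e \<otimes> adj A (s e)) = s e \<otimes> adj A (s e)"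
    using ck e unfolding ck_family_def proj_le_def range_proj_def by blast
  then have "p (tail G e) \<otimes> (s e \<otimes> adj A (s e)) \<otimes> s e = s e" using s_adj_s[OF e] by simp
  then show ?thesis using e s_adj_s[OF e] by (simp add: mult_assoc)
qed

lemma p_mult_s:
  assumes "v \<in> verts G" "e \<in> arcs G"
  shows "p v \<otimes> s e = (if v = tail G e then s e else \<zero>)"
proof (cases "v = tail G e")
  case False
  have "p v \<otimes> s e = p v \<otimes> (p (tail G e) \<otimes> s e)" using assms p_s by simp
  also have "\<dots> = (p v \<otimes> p (tail G e)) \<otimes> s e"
    using assms by (intro mult_assoc[symmetric]) auto
  finally show ?thesis using False assms p_orth by simp
qed (use assms p_s in simp)

lemma s_mult_p:
  assumes "v \<in> verts G" "e \<in> arcs G"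
  shows "s e \<otimes> p v = (if v = head G e then s e else \<zero>)"
proof (cases "v = head G e")
  case False
  have "s e \<otimes> p v = (s e \<otimes> p (head G e)) \<otimes> p v" using assms s_p by simp
  also have "\<dots> = s e \<otimes> (p (head G e) \<otimes> p v)"
    using assms by (intro mult_assoc) auto
  finally show ?thesis using False assms p_orth by simp
qed (use assms s_p in simp)

lemma adj_s_mult_p:
  assumes "v \<in> verts G" "e \<in> arcs G"
  shows "adj A (s e) \<otimes> p v = (if v = tail G e then adj A (s e) else \<zero>)"
  using arg_cong[OF p_mult_s[OF assms], of "adj A"] assms by (simp add: adj_mult split: if_splits)

lemma p_mult_adj_s:
  assumes "v \<in> verts G" "e \<in> arcs G"
  shows "p v \<otimes> adj A (s e) = (if v = head G e then adj A (s e) else \<zero>)"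
  using arg_cong[OF s_mult_p[OF assms], of "adj A"] assms by (simp add: adj_mult split: if_splits)

text \<open>Each factor absorbs its own range projection, and the two range projections are
  orthogonal.\<close>

lemma adj_s_s_orth:
  assumes e: "e \<in> arcs G" and f: "f \<in> arcs G" and ne: "e \<noteq> f"
  shows "adj A (s e) \<otimes> s f = \<zero>"
proof -
  have ea: "adj A (s e) = adj A (s e) \<otimes> (s e \<otimes> adj A (s e))"
    using arg_cong[OF s_adj_s[OF e], of "adj A"] e by (simp add: adj_mult adj_adj mult_assoc)
  have "adj A (s e) \<otimes> s f = (adj A (s e) \<otimes> (s e \<otimes> adj A (s e))) \<otimes> (s f \<otimes> adj A (s f) \<otimes> s f)"
    using ea s_adj_s[OF f] by simp
  also have "\<dots> = adj A (s e) \<otimes> ((s e \<otimes> adj A (s e)) \<otimes> (s f \<otimes> adj A (s f))) \<otimes> s f"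
    using e f by (simp add: mult_assoc)
  also have "(s e \<otimes> adj A (s e)) \<otimes> (s f \<otimes> adj A (s f)) = \<zero>"
    using ck e f ne unfolding ck_family_def range_proj_def by blast
  finally show ?thesis using e f by simp
qed

lemma adj_s_mult_s:
  "e \<in> arcs G \<Longrightarrow> f \<in> arcs G \<Longrightarrow> adj A (s e) \<otimes> s f = (if e = f then p (head G e) else \<zero>)"
  by (simp add: adj_s_s adj_s_s_orth)

text \<open>The range \<open>v\<close> is an argument because the empty list does not determine it:
  as a path of length 0 it must stand for \<open>p v\<close>.\<close>

fun path_el :: "'e list \<Rightarrow> 'v \<Rightarrow> 'a" where
  "path_el [] v = p v"
| "path_el (e # \<alpha>) v = s e \<otimes> path_el \<alpha> v"

lemma path_el_closed [simp]: "awalk u \<alpha> v \<Longrightarrow> path_el \<alpha> v \<in> carrier A"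
  by (induction \<alpha> arbitrary: u) (auto simp: awalk_simps)

lemma p_path: "awalk u \<alpha> v \<Longrightarrow> w \<in> verts G \<Longrightarrow> p w \<otimes> path_el \<alpha> v = (if w = u then path_el \<alpha> v else \<zero>)"
proof (cases \<alpha>)
  case (Cons e \<beta>)
  assume a: "awalk u \<alpha> v" "w \<in> verts G"
  then have e: "e \<in> arcs G" "u = tail G e" "awalk (head G e) \<beta> v" using Cons by (auto simp: awalk_simps)
  have "p w \<otimes> path_el \<alpha> v = (p w \<otimes> s e) \<otimes> path_el \<beta> v" using Cons a e by (simp add: mult_assoc)
  then show ?thesis using Cons a e by (simp add: p_mult_s)
qed (auto simp: awalk_simps p_orth)

lemma path_p: "awalk u \<alpha> v \<Longrightarrow> w \<in> verts G \<Longrightarrow> path_el \<alpha> v \<otimes> p w = (if w = v then path_el \<alpha> v else \<zero>)"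
  by (induction \<alpha> arbitrary: u) (auto simp: awalk_simps p_orth mult_assoc)

lemma path_append:
  "awalk u \<alpha> v \<Longrightarrow> awalk v \<beta> w \<Longrightarrow> path_el (\<alpha> @ \<beta>) w = path_el \<alpha> v \<otimes> path_el \<beta> w"
proof (induction \<alpha> arbitrary: u)
  case Nil
  then show ?case by (auto simp: awalk_simps p_path)
next
  case (Cons e \<alpha>)
  then show ?case by (auto simp: awalk_simps mult_assoc)
qed

lemma p_adj_path:
  "awalk u \<alpha> v \<Longrightarrow> w \<in> verts G \<Longrightarrow> p w \<otimes> adj A (path_el \<alpha> v) = (if w = v then adj A (path_el \<alpha> v) else \<zero>)"
  using arg_cong[OF path_p[of u \<alpha> v w], of "adj A"] by (simp add: adj_mult split: if_splits)

lemma adj_path_p: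
  "awalk u \<alpha> v \<Longrightarrow> w \<in> verts G \<Longrightarrow> adj A (path_el \<alpha> v) \<otimes> p w = (if w = u then adj A (path_el \<alpha> v) else \<zero>)"
  using arg_cong[OF p_path[of u \<alpha> v w], of "adj A"] by (simp add: adj_mult split: if_splits)

lemma adj_path_path: "awalk u \<alpha> v \<Longrightarrow> adj A (path_el \<alpha> v) \<otimes> path_el \<alpha> v = p v"
proof (induction \<alpha> arbitrary: u)
  case (Cons e \<alpha>)
  then have e: "e \<in> arcs G" "awalk (head G e) \<alpha> v" by (auto simp: awalk_simps)
  then have c: "path_el \<alpha> v \<in> carrier A" by simp
  have "adj A (path_el (e # \<alpha>) v) \<otimes> path_el (e # \<alpha>) v
      = adj A (path_el \<alpha> v) \<otimes> ((adj A (s e) \<otimes> s e) \<otimes> path_el \<alpha> v)"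
    using e c by (simp add: adj_mult mult_assoc)
  also have "\<dots> = adj A (path_el \<alpha> v) \<otimes> path_el \<alpha> v" using e p_path[OF e(2)] by (simp add: adj_s_s)
  finally show ?case using Cons.IH[OF e(2)] by simp
qed (auto simp: awalk_simps)

section \<open>Spans of monomials, graded by edges and degree\<close>

definition monomial :: "'e list \<Rightarrow> 'v \<Rightarrow> 'e list \<Rightarrow> 'a" where
  "monomial \<alpha> v \<beta> = path_el \<alpha> v \<otimes> adj A (path_el \<beta> v)"

lemma monomial_closed [simp]: "awalk u \<alpha> v \<Longrightarrow> awalk u' \<beta> v \<Longrightarrow> monomial \<alpha> v \<beta> \<in> carrier A"
  by (simp add: monomial_def)

lemma adj_mono: "awalk u \<alpha> v \<Longrightarrow> awalk u' \<beta> v \<Longrightarrow> adj A (monomial \<alpha> v \<beta>) = monomial \<beta> v \<alpha>"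
  by (simp add: monomial_def adj_mult adj_adj)

text \<open>Both parameters serve the norm estimate: \<open>E\<close> confines an element and all
  its powers to one set of edges, and \<open>D\<close> bounds the degree of the Laurent polynomials
  that the element produces at cycles.\<close>

inductive_set mono_span :: "'e set \<Rightarrow> nat \<Rightarrow> 'a set" for E :: "'e set" and D :: nat where
  zero: "\<zero> \<in> mono_span E D"
| step: "\<lbrakk>y \<in> mono_span E D; awalk u \<alpha> v; awalk u' \<beta> v; set \<alpha> \<subseteq> E; set \<beta> \<subseteq> E;
    length \<alpha> + length \<beta> \<le> D\<rbrakk> \<Longrightarrow> c \<odot> monomial \<alpha> v \<beta> \<oplus> y \<in> mono_span E D"

lemma span_closed [simp]: "x \<in> mono_span E D \<Longrightarrow> x \<in> carrier A"
  by (induction rule: mono_span.induct) auto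

lemma span_mono: "x \<in> mono_span E D \<Longrightarrow> E \<subseteq> E' \<Longrightarrow> D \<le> D' \<Longrightarrow> x \<in> mono_span E' D'"
proof (induction rule: mono_span.induct)
  case (step x u \<alpha> v u' \<beta> c)
  show ?case
    by (rule mono_span.step[OF step.IH[OF step.prems] step.hyps(2,3)]) (use step.hyps(4-6) step.prems in auto)
qed (rule mono_span.zero)

lemma span_add: "x \<in> mono_span E D \<Longrightarrow> y \<in> mono_span E D \<Longrightarrow> x \<oplus> y \<in> mono_span E D"
proof (induction rule: mono_span.induct)
  case (step x u \<alpha> v u' \<beta> c)
  then have "c \<odot> monomial \<alpha> v \<beta> \<oplus> (x \<oplus> y) \<in> mono_span E D" by (intro mono_span.step) auto
  then show ?case using step by (simp add: M.a_assoc)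
qed simp

lemma span_mono_el:
  "\<lbrakk>awalk u \<alpha> v; awalk u' \<beta> v; set \<alpha> \<subseteq> E; set \<beta> \<subseteq> E; length \<alpha> + length \<beta> \<le> D\<rbrakk>
    \<Longrightarrow> monomial \<alpha> v \<beta> \<in> mono_span E D"
  using mono_span.step[OF mono_span.zero, of u \<alpha> v u' \<beta> E D 1] by simp

lemma span_smult: "x \<in> mono_span E D \<Longrightarrow> d \<odot> x \<in> mono_span E D"
proof (induction rule: mono_span.induct)
  case (step x u \<alpha> v u' \<beta> c)
  then have "(d * c) \<odot> monomial \<alpha> v \<beta> \<oplus> d \<odot> x \<in> mono_span E D" by (intro mono_span.step) auto
  then show ?case using step by (simp add: smult_add_right smult_smult)
qed (simp add: mono_span.zero)

lemma span_adj: "x \<in> mono_span E D \<Longrightarrow> adj A x \<in> mono_span E D"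
proof (induction rule: mono_span.induct)
  case (step x u \<alpha> v u' \<beta> c)
  then have "cnj c \<odot> monomial \<beta> v \<alpha> \<oplus> adj A x \<in> mono_span E D" by (intro mono_span.step) auto
  then show ?case using step by (simp add: adj_add adj_smult adj_mono)
qed (simp add: mono_span.zero)

lemma span_mult_leftI:
  assumes a: "a \<in> carrier A"
    and m: "\<And>u \<alpha> v u' \<beta>. \<lbrakk>awalk u \<alpha> v; awalk u' \<beta> v; set \<alpha> \<subseteq> E; set \<beta> \<subseteq> E;
      length \<alpha> + length \<beta> \<le> D\<rbrakk> \<Longrightarrow> a \<otimes> monomial \<alpha> v \<beta> \<in> mono_span E D'"
    and x: "x \<in> mono_span E D"
  shows "a \<otimes> x \<in> mono_span E D'"
  using x
proof (induction rule: mono_span.induct)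
  case (step y u \<alpha> v u' \<beta> c)
  have "a \<otimes> (c \<odot> monomial \<alpha> v \<beta> \<oplus> y) = c \<odot> (a \<otimes> monomial \<alpha> v \<beta>) \<oplus> a \<otimes> y"
    using step a by (simp add: mult_add_right mult_smult_right)
  then show ?case using step m by (simp add: span_add span_smult)
qed (simp add: a mono_span.zero)

lemma span_p_left: "x \<in> mono_span E D \<Longrightarrow> w \<in> verts G \<Longrightarrow> p w \<otimes> x \<in> mono_span E D"
proof (rule span_mult_leftI)
  fix u \<alpha> v u' \<beta> assume w: "w \<in> verts G" and
    m: "awalk u \<alpha> v" "awalk u' \<beta> v" "set \<alpha> \<subseteq> E" "set \<beta> \<subseteq> E" "length \<alpha> + length \<beta> \<le> D"
  have "p w \<otimes> monomial \<alpha> v \<beta> = (p w \<otimes> path_el \<alpha> v) \<otimes> adj A (path_el \<beta> v)"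
    using m w by (simp add: monomial_def mult_assoc)
  then show "p w \<otimes> monomial \<alpha> v \<beta> \<in> mono_span E D"
    using m w span_mono_el[OF m] by (simp add: p_path monomial_def mono_span.zero)
qed auto

lemma span_s_left:
  assumes e: "e \<in> arcs G" "e \<in> E" and x: "x \<in> mono_span E D"
  shows "s e \<otimes> x \<in> mono_span E (Suc D)"
proof (rule span_mult_leftI[OF _ _ x])
  fix u \<alpha> v u' \<beta> assume
    m: "awalk u \<alpha> v" "awalk u' \<beta> v" "set \<alpha> \<subseteq> E" "set \<beta> \<subseteq> E" "length \<alpha> + length \<beta> \<le> D"
  show "s e \<otimes> monomial \<alpha> v \<beta> \<in> mono_span E (Suc D)"
  proof (cases "u = head G e")
    case True
    have "monomial (e # \<alpha>) v \<beta> \<in> mono_span E (Suc D)"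
      using m e True by (intro span_mono_el[of "tail G e" _ _ u']) (auto simp: awalk_simps)
    then show ?thesis using e m by (simp add: monomial_def mult_assoc)
  next
    case False
    have "s e \<otimes> monomial \<alpha> v \<beta> = (s e \<otimes> p (head G e)) \<otimes> monomial \<alpha> v \<beta>" using s_p e by simp
    also have "\<dots> = s e \<otimes> ((p (head G e) \<otimes> path_el \<alpha> v) \<otimes> adj A (path_el \<beta> v))"
      using m e unfolding monomial_def by (simp add: mult_assoc)
    also have "\<dots> = \<zero>" using m e False p_path[OF m(1), of "head G e"] by simp
    finally show ?thesis by (simp add: mono_span.zero)
  qed
qed (use e in simp)

text \<open>A starred edge cancels against the first edge of \<open>\<alpha>\<close>, or kills the
  monomial, or, if \<open>\<alpha>\<close> is empty, may join the end of \<open>\<beta>\<close>;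
  only in the last case does the degree grow.\<close>

lemma span_adj_s_left:
  assumes e: "e \<in> arcs G" "e \<in> E" and x: "x \<in> mono_span E D"
  shows "adj A (s e) \<otimes> x \<in> mono_span E (Suc D)"
proof (rule span_mult_leftI[OF _ _ x])
  fix u \<alpha> v u' \<beta> assume
    m: "awalk u \<alpha> v" "awalk u' \<beta> v" "set \<alpha> \<subseteq> E" "set \<beta> \<subseteq> E" "length \<alpha> + length \<beta> \<le> D"
  show "adj A (s e) \<otimes> monomial \<alpha> v \<beta> \<in> mono_span E (Suc D)"
  proof (cases \<alpha>)
    case Nil
    have v: "v \<in> verts G" using m(1) by (rule awalk_last_in_verts)
    have "adj A (s e) \<otimes> monomial \<alpha> v \<beta> = (adj A (s e) \<otimes> p v) \<otimes> adj A (path_el \<beta> v)"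
      using m e v Nil by (simp add: monomial_def mult_assoc)
    then have eq: "adj A (s e) \<otimes> monomial \<alpha> v \<beta> = (if v = tail G e then adj A (s e) \<otimes> adj A (path_el \<beta> v) else \<zero>)"
      using e v m by (simp add: adj_s_mult_p)
    show ?thesis
    proof (cases "v = tail G e")
      case True
      then have w: "awalk v [e] (head G e)" using e by (simp add: awalk_simps)
      have "path_el (\<beta> @ [e]) (head G e) = path_el \<beta> v \<otimes> s e"
        using path_append[OF m(2) w] e by (simp add: s_p)
      then have "monomial [] (head G e) (\<beta> @ [e]) = p (head G e) \<otimes> (adj A (s e) \<otimes> adj A (path_el \<beta> v))"
        using e m by (simp add: monomial_def adj_mult)
      also have "\<dots> = (p (head G e) \<otimes> adj A (s e)) \<otimes> adj A (path_el \<beta> v)"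
        using e m by (simp add: mult_assoc)
      also have "\<dots> = adj A (s e) \<otimes> adj A (path_el \<beta> v)" using e by (simp add: p_mult_adj_s)
      finally have "adj A (s e) \<otimes> monomial \<alpha> v \<beta> = monomial [] (head G e) (\<beta> @ [e])" using eq True by simp
      moreover have "monomial [] (head G e) (\<beta> @ [e]) \<in> mono_span E (Suc D)"
        using m e awalk_appendI[OF m(2) w] by (intro span_mono_el[of "head G e" _ _ u']) (auto simp: awalk_simps simp del: awalk_append_iff)
      ultimately show ?thesis by simp
    qed (simp add: eq mono_span.zero)
  next
    case (Cons f \<alpha>')
    then have f: "f \<in> arcs G" "awalk (head G f) \<alpha>' v" using m by (auto simp: awalk_simps)
    have "adj A (s e) \<otimes> monomial \<alpha> v \<beta> = ((adj A (s e) \<otimes> s f) \<otimes> path_el \<alpha>' v) \<otimes> adj A (path_el \<beta> v)"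
      using m e f Cons by (simp add: monomial_def mult_assoc)
    also have "\<dots> = (if e = f then monomial \<alpha>' v \<beta> else \<zero>)"
      using e f m p_path[OF f(2)] by (simp add: adj_s_mult_s monomial_def)
    finally show ?thesis
      using f m Cons by (auto simp: mono_span.zero intro!: span_mono_el[OF f(2) m(2)])
  qed
qed (use e in simp)

lemma span_path_left:
  "awalk u \<alpha> v \<Longrightarrow> set \<alpha> \<subseteq> E \<Longrightarrow> x \<in> mono_span E D \<Longrightarrow> path_el \<alpha> v \<otimes> x \<in> mono_span E (D + length \<alpha>)"
proof (induction \<alpha> arbitrary: u)
  case (Cons e \<alpha>)
  then have e: "e \<in> arcs G" "e \<in> E" "awalk (head G e) \<alpha> v" by (auto simp: awalk_simps)
  have "s e \<otimes> (path_el \<alpha> v \<otimes> x) \<in> mono_span E (Suc (D + length \<alpha>))"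
    using e Cons by (intro span_s_left) auto
  then show ?case using e Cons.prems by (simp add: mult_assoc)
qed (auto simp: awalk_simps span_p_left)

lemma span_adj_path_left:
  "awalk u \<alpha> v \<Longrightarrow> set \<alpha> \<subseteq> E \<Longrightarrow> x \<in> mono_span E D \<Longrightarrow>
    adj A (path_el \<alpha> v) \<otimes> x \<in> mono_span E (D + length \<alpha>)"
proof (induction \<alpha> arbitrary: u x D)
  case (Cons e \<alpha>)
  then have e: "e \<in> arcs G" "e \<in> E" "awalk (head G e) \<alpha> v" by (auto simp: awalk_simps)
  have "adj A (path_el \<alpha> v) \<otimes> (adj A (s e) \<otimes> x) \<in> mono_span E (Suc D + length \<alpha>)"
    using e Cons.prems by (intro Cons.IH[OF e(3)] span_adj_s_left) auto
  then show ?case using e Cons.prems by (simp add: adj_mult mult_assoc)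
qed (auto simp: awalk_simps span_p_left)

text \<open>The generators that form a monomial act from the left one at a time, and each raises the
  degree by at most one.\<close>

lemma span_mult:
  assumes "x \<in> mono_span E D" "y \<in> mono_span E D'"
  shows "x \<otimes> y \<in> mono_span E (D + D')"
  using assms(1)
proof (induction rule: mono_span.induct)
  case (step x u \<alpha> v u' \<beta> c)
  have "path_el \<alpha> v \<otimes> (adj A (path_el \<beta> v) \<otimes> y) \<in> mono_span E (D' + length \<beta> + length \<alpha>)"
    using step assms(2) by (intro span_path_left span_adj_path_left)
  then have "monomial \<alpha> v \<beta> \<otimes> y \<in> mono_span E (D + D')"
    using step assms(2) by (auto simp: monomial_def mult_assoc intro: span_mono)
  moreover have "(c \<odot> monomial \<alpha> v \<beta> \<oplus> x) \<otimes> y = c \<odot> (monomial \<alpha> v \<beta> \<otimes> y) \<oplus> x \<otimes> y"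
    using step assms(2) by (simp add: mult_add_left mult_smult_left)
  ultimately show ?case using step by (simp add: span_add span_smult)
qed (use assms in \<open>simp add: mono_span.zero\<close>)

lemma span_p: "v \<in> verts G \<Longrightarrow> p v \<in> mono_span E D"
  using span_mono_el[of v "[]" v v "[]" E D] by (simp add: monomial_def awalk_simps)

lemma span_path: "awalk u \<alpha> v \<Longrightarrow> set \<alpha> \<subseteq> E \<Longrightarrow> path_el \<alpha> v \<in> mono_span E (length \<alpha>)"
  using span_path_left[OF _ _ span_p, of u \<alpha> v E v 0] by (auto simp: path_p dest: awalk_last_in_verts)

lemma span_s: "e \<in> arcs G \<Longrightarrow> e \<in> E \<Longrightarrow> s e \<in> mono_span E 1"
  using span_s_left[OF _ _ span_p, of e E "head G e" 0] by (simp add: s_p)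

lemma span_finite_arcs: "x \<in> mono_span E D \<Longrightarrow> \<exists>F. finite F \<and> F \<subseteq> E \<and> x \<in> mono_span F D"
proof (induction rule: mono_span.induct)
  case (step x u \<alpha> v u' \<beta> c)
  then obtain F where F: "finite F" "F \<subseteq> E" "x \<in> mono_span F D" by blast
  let ?F = "F \<union> set \<alpha> \<union> set \<beta>"
  have "c \<odot> monomial \<alpha> v \<beta> \<oplus> x \<in> mono_span ?F D"
    by (rule mono_span.step[OF span_mono[OF F(3)] step.hyps(2,3)]) (use step.hyps(6) in auto)
  moreover have "finite ?F" "?F \<subseteq> E" using F step.hyps(4,5) by auto
  ultimately show ?case by (intro exI[of _ ?F] conjI)
next
  case zero
  show ?case by (rule exI[of _ "{}"]) (simp add: mono_span.zero)
qed

lemma p_mult_unit: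
  assumes "finite V" "V \<subseteq> verts G" "w \<in> V"
  shows "p w \<otimes> (\<Oplus>v\<in>V. p v) = p w"
proof -
  have w: "w \<in> verts G" using assms by auto
  have "p w \<otimes> (\<Oplus>v\<in>V. p v) = (\<Oplus>v\<in>V. p w \<otimes> p v)"
    using assms w by (intro finsum_mult_left) auto
  also have "\<dots> = p w" using assms w by (intro finsum_single[of V w]) (auto simp: p_orth)
  finally show ?thesis .
qed

text \<open>A local unit: it suffices that \<open>V\<close> contains the sources of the finitely
  many paths \<open>\<beta>\<close>.\<close>

lemma span_unit: "x \<in> mono_span E D \<Longrightarrow> \<exists>V. finite V \<and> V \<subseteq> verts G \<and> x \<otimes> (\<Oplus>v\<in>V. p v) = x"
proof (induction rule: mono_span.induct)
  case (step x u \<alpha> v u' \<beta> c)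
  then obtain V where V: "finite V" "V \<subseteq> verts G" "x \<otimes> (\<Oplus>v\<in>V. p v) = x" by blast
  let ?W = "insert u' V" and ?one = "\<lambda>V. \<Oplus>v\<in>V. p v"
  have u': "u' \<in> verts G" using step by blast
  have W: "finite ?W" "?W \<subseteq> verts G" using V u' by auto
  have c: "?one V \<in> carrier A" "?one ?W \<in> carrier A" using V W by (auto intro!: M.finsum_closed)
  have "?one V \<otimes> ?one ?W = ?one V"
  proof -
    have "?one V \<otimes> ?one ?W = (\<Oplus>v\<in>V. p v \<otimes> ?one ?W)"
      using V c by (intro finsum_mult_right) auto
    also have "\<dots> = ?one V"
      using V W by (intro M.finsum_cong' p_mult_unit) auto
    finally show ?thesis .
  qed
  then have "x \<otimes> ?one ?W = x"
    using V(3) step c by (metis mult_assoc span_closed)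
  moreover have "monomial \<alpha> v \<beta> \<otimes> ?one ?W = monomial \<alpha> v \<beta>"
  proof -
    have a: "adj A (path_el \<beta> v) \<otimes> p u' = adj A (path_el \<beta> v)" using step u' by (simp add: adj_path_p)
    then have "adj A (path_el \<beta> v) \<otimes> ?one ?W = adj A (path_el \<beta> v) \<otimes> (p u' \<otimes> ?one ?W)"
      using step u' c by (metis adj_closed mult_assoc p_closed path_el_closed)
    also have "\<dots> = adj A (path_el \<beta> v)" using p_mult_unit[OF W, of u'] a by simp
    finally show ?thesis using step c by (simp add: monomial_def mult_assoc)
  qed
  ultimately have "(c \<odot> monomial \<alpha> v \<beta> \<oplus> x) \<otimes> ?one ?W = c \<odot> monomial \<alpha> v \<beta> \<oplus> x"
    using step c by (simp add: mult_add_left mult_smult_left)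
  then show ?case using W by blast
qed (auto intro!: exI[of _ "{}"])

lemma p_on_cycle_step:
  assumes "e \<in> arcs G" "out_arcs G (tail G e) = {e}"
  shows "s e \<otimes> adj A (s e) = p (tail G e)"
  using p_regular[of "tail G e"] assms by simp

end

section \<open>Norm estimates by seminorms that see all vertices and cycles\<close>

text \<open>Discrete Fourier inversion: averaging the values at the roots of unity of order 2D + 1,
  weighted by z to the power -k, isolates the coefficient, and each term of the average is at most
  \<open>M\<close>.\<close>

lemma Laurent_coeff_bound:
  fixes c :: "int \<Rightarrow> complex" and D :: nat
  assumes M: "\<And>z. cmod z = 1 \<Longrightarrow> cmod (\<Sum>k\<in>{-int D..int D}. c k * z powi k) \<le> M"
    and k: "k \<in> {-int D..int D}"
  shows "cmod (c k) \<le> M"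
proof -
  \<comment> \<open>Two exponents in the range differ by at most 2D, so roots of unity of this order
    separate them.\<close>
  define n where "n = 2 * D + 1"
  define w where "w = cis (2 * pi / real n)"
  have n0: "n > 0" by (simp add: n_def)
  have w: "cmod w = 1" "w \<noteq> 0" by (simp_all add: w_def)
  have wk: "w powi j = cis (2 * pi * of_int j / real n)" for j
    by (simp add: w_def cis_power_int mult_ac)
  have orth: "(\<Sum>m<n. (w powi j) ^ m) = (if j = 0 then of_nat n else 0)" if "\<bar>j\<bar> < int n" for j
  proof (cases "j = 0")
    case False
    have "(w powi j) ^ n = cis (2 * pi * of_int j)"
      unfolding wk Complex.DeMoivre using n0 by (simp add: field_simps)
    also have "\<dots> = 1" by (simp add: cis_multiple_2pi)
    finally have 1: "(w powi j) ^ n = 1" .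
    have "w powi j \<noteq> 1"
    proof
      assume "w powi j = 1"
      then have "cos (2 * pi * of_int j / real n) = 1" unfolding wk by (metis cis.simps(1) one_complex.sel(1))
      then obtain l :: int where "2 * pi * of_int j / real n = of_int l * 2 * pi"
        using cos_one_2pi_int by blast
      then have "of_int j = of_int l * real n" using n0 by (simp add: field_simps)
      then have "j = l * int n" by (metis of_int_eq_iff of_int_mult of_int_of_nat_eq)
      then have "\<bar>j\<bar> \<ge> int n" using False by (auto simp: abs_mult mult_le_cancel_right1)
      then show False using that by simp
    qed
    then show ?thesis using 1 False by (simp add: geometric_sum)
  qed simp
  have "(\<Sum>m<n. (w ^ m) powi (- k) * (\<Sum>j\<in>{-int D..int D}. c j * (w ^ m) powi j))
      = (\<Sum>m<n. \<Sum>j\<in>{-int D..int D}. c j * (w powi (j - k)) ^ m)"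
  proof (rule sum.cong[OF refl])
    fix m
    have "(w ^ m) powi (- k) * (w ^ m) powi j = (w powi (j - k)) ^ m" for j
    proof -
      have "(w ^ m) powi (- k) * (w ^ m) powi j = (w ^ m) powi (j - k)"
        using w by (simp add: power_int_add[symmetric])
      then show ?thesis by (metis power_int_power power_int_power' mult.commute power_int_mult power_int_of_nat)
    qed
    then show "(w ^ m) powi (- k) * (\<Sum>j\<in>{-int D..int D}. c j * (w ^ m) powi j)
        = (\<Sum>j\<in>{-int D..int D}. c j * (w powi (j - k)) ^ m)"
      by (simp add: sum_distrib_left mult.left_commute)
  qed
  also have "\<dots> = (\<Sum>j\<in>{-int D..int D}. c j * (\<Sum>m<n. (w powi (j - k)) ^ m))"
    by (subst sum.swap) (simp add: sum_distrib_left)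
  also have "\<dots> = (\<Sum>j\<in>{-int D..int D}. if j = k then c k * of_nat n else 0)"
    using k by (intro sum.cong refl) (subst orth, auto simp: n_def)
  also have "\<dots> = c k * of_nat n" using k by simp
  finally have eq: "c k * of_nat n
      = (\<Sum>m<n. (w ^ m) powi (- k) * (\<Sum>j\<in>{-int D..int D}. c j * (w ^ m) powi j))" by simp
  have "cmod (c k) * real n = cmod (c k * of_nat n)" by (simp add: norm_mult)
  also have "\<dots> \<le> (\<Sum>m<n. cmod ((w ^ m) powi (- k) * (\<Sum>j\<in>{-int D..int D}. c j * (w ^ m) powi j)))"
    unfolding eq by (rule norm_sum)
  also have "\<dots> \<le> (\<Sum>m<n. M)"
  proof (rule sum_mono)
    fix m
    have "cmod (w ^ m) = 1" using w by (simp add: norm_power)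
    then show "cmod ((w ^ m) powi (- k) * (\<Sum>j\<in>{-int D..int D}. c j * (w ^ m) powi j)) \<le> M"
      using M[of "w ^ m"] by (simp add: norm_mult norm_power_int)
  qed
  finally show ?thesis using n0 by simp
qed

text \<open>If \<open>a\<close> exceeded \<open>M\<close>, dividing by the power of \<open>a\<close>
  would leave a linear factor times the power of M / a with exponent 2^n. This tends to 0 and yet is
  always at least 1.\<close>

lemma le_if_power_le_linear:
  fixes a M :: real
  assumes M: "0 \<le> M"
    and le: "\<And>n. a ^ (2 ^ n) \<le> K * (d * 2 ^ n + 1) * M ^ (2 ^ n)"
  shows "a \<le> M"
proof (rule ccontr)
  assume "\<not> a \<le> M"
  then have a: "a > M" "a > 0" using M by auto
  define x where "x = M / a"
  have x: "0 \<le> x" "x < 1" using a M by (auto simp: x_def)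
  have A: "(\<lambda>m. real m * x ^ m) \<longlonglongrightarrow> 0" using x by (intro powser_times_n_limit_0) auto
  have B: "(\<lambda>m. x ^ m) \<longlonglongrightarrow> 0" using x by (intro LIMSEQ_realpow_zero) auto
  have "(\<lambda>m. K * (d * (real m * x ^ m) + x ^ m)) \<longlonglongrightarrow> K * (d * 0 + 0)"
    by (intro tendsto_mult tendsto_add tendsto_const A B)
  then have "(\<lambda>n. K * (d * (real (2 ^ n) * x ^ (2 ^ n)) + x ^ (2 ^ n))) \<longlonglongrightarrow> K * (d * 0 + 0)"
    using LIMSEQ_subseq_LIMSEQ[where f = "\<lambda>n. 2 ^ n :: nat"] by (fastforce simp: o_def strict_mono_def)
  moreover have "1 \<le> K * (d * (real (2 ^ n) * x ^ (2 ^ n)) + x ^ (2 ^ n))" for n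
  proof -
    have "a ^ (2 ^ n) \<le> a ^ (2 ^ n) * (K * (d * (real (2 ^ n) * x ^ (2 ^ n)) + x ^ (2 ^ n)))"
    proof -
      have "M ^ (2 ^ n) = a ^ (2 ^ n) * x ^ (2 ^ n)" using a by (simp add: x_def power_divide)
      then show ?thesis using le[of n] by (simp add: algebra_simps)
    qed
    then show ?thesis using a by (simp add: mult_le_cancel_left1)
  qed
  ultimately have "1 \<le> K * (d * 0 + 0)" by (intro LIMSEQ_le_const) auto
  then show False by simp
qed

text \<open>The properties shared by the norms of images under *-homomorphisms into operators.
  Domination by \<open>cnorm\<close> allows values on an element to be compared with values on its
  approximants.\<close>

definition cstar_seminorm :: "('a, 'b) cstar_scheme \<Rightarrow> ('a \<Rightarrow> real) \<Rightarrow> bool" where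
  "cstar_seminorm A \<rho> \<longleftrightarrow>
     (\<forall>x\<in>carrier A. 0 \<le> \<rho> x \<and> \<rho> x \<le> cnorm A x) \<and>
     (\<forall>x\<in>carrier A. \<forall>y\<in>carrier A. \<rho> (x \<oplus>\<^bsub>A\<^esub> y) \<le> \<rho> x + \<rho> y) \<and>
     (\<forall>c. \<forall>x\<in>carrier A. \<rho> (c \<odot>\<^bsub>A\<^esub> x) = cmod c * \<rho> x) \<and>
     (\<forall>x\<in>carrier A. \<forall>y\<in>carrier A. \<rho> (x \<otimes>\<^bsub>A\<^esub> y) \<le> \<rho> x * \<rho> y) \<and>
     (\<forall>x\<in>carrier A. \<rho> (adj A x \<otimes>\<^bsub>A\<^esub> x) = (\<rho> x)\<^sup>2)"

context cstar_algebra
begin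

lemma
  assumes "cstar_seminorm A \<rho>" "x \<in> carrier A"
  shows seminorm_nonneg: "0 \<le> \<rho> x" and seminorm_le: "\<rho> x \<le> cnorm A x"
    and seminorm_smult: "\<rho> (c \<odot> x) = cmod c * \<rho> x"
    and seminorm_cstar: "\<rho> (adj A x \<otimes> x) = (\<rho> x)\<^sup>2"
  using assms by (auto simp: cstar_seminorm_def)

lemma
  assumes "cstar_seminorm A \<rho>" "x \<in> carrier A" "y \<in> carrier A"
  shows seminorm_add: "\<rho> (x \<oplus> y) \<le> \<rho> x + \<rho> y"
    and seminorm_mult: "\<rho> (x \<otimes> y) \<le> \<rho> x * \<rho> y"
  using assms by (auto simp: cstar_seminorm_def)

lemma seminorm_adj:
  assumes \<rho>: "cstar_seminorm A \<rho>" and x: "x \<in> carrier A" shows "\<rho> (adj A x) = \<rho> x"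
proof -
  have le: "\<rho> y \<le> \<rho> (adj A y)" if y: "y \<in> carrier A" for y
  proof (cases "\<rho> y = 0")
    case False
    then have "0 < \<rho> y" using seminorm_nonneg[OF \<rho> y] by simp
    moreover have "\<rho> y * \<rho> y \<le> \<rho> (adj A y) * \<rho> y"
      using seminorm_cstar[OF \<rho> y] seminorm_mult[OF \<rho>, of "adj A y" y] y by (simp add: power2_eq_square)
    ultimately show ?thesis by (simp add: mult_le_cancel_right)
  qed (use y seminorm_nonneg[OF \<rho>] in auto)
  show ?thesis using le[OF x] le[of "adj A x"] x by (simp add: adj_adj)
qed

lemma seminorm_minus_le:
  assumes \<rho>: "cstar_seminorm A \<rho>" and "x \<in> carrier A" "y \<in> carrier A"
  shows "\<rho> (x \<ominus> y) \<le> \<rho> x + \<rho> y"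
  using seminorm_add[OF \<rho>, of x "(-1) \<odot> y"] assms by (simp add: minus_conv seminorm_smult)

lemma seminorm_zero: "cstar_seminorm A \<rho> \<Longrightarrow> \<rho> \<zero> = 0"
  using seminorm_smult[of \<rho> \<zero> 0] by simp

lemma seminorm_le_if_minus_null:
  assumes \<rho>: "cstar_seminorm A \<rho>" and "x \<in> carrier A" "y \<in> carrier A" "\<rho> (x \<ominus> y) = 0"
  shows "\<rho> y \<le> \<rho> x"
proof -
  have "y = x \<ominus> (x \<ominus> y)"
    using assms by (simp add: minus_conv smult_add_right smult_smult M.a_assoc[symmetric])
      (simp add: M.r_neg uminus_conv[symmetric])
  then have "\<rho> y \<le> \<rho> x + \<rho> (x \<ominus> y)"
    using seminorm_minus_le[OF \<rho>, of x "x \<ominus> y"] assms by simp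
  then show ?thesis using assms by simp
qed

text \<open>By the C*-identity the value equals its own square.\<close>

lemma seminorm_projection:
  assumes \<rho>: "cstar_seminorm A \<rho>" and q: "projection A q" and "\<rho> q \<noteq> 0" shows "\<rho> q = 1"
  using seminorm_cstar[OF \<rho>, of q] assms by (simp add: projection_def power2_eq_square)

text \<open>The C*-identity turns norms of these iterated squares into powers of the norm of \<open>h\<close>.\<close>

primrec sq_iter :: "'a \<Rightarrow> nat \<Rightarrow> 'a" where
  "sq_iter h 0 = h"
| "sq_iter h (Suc n) = sq_iter h n \<otimes> sq_iter h n"

lemma sq_iter_closed [simp]: "h \<in> carrier A \<Longrightarrow> sq_iter h n \<in> carrier A"
  by (induction n) auto

lemma adj_sq_iter: "h \<in> carrier A \<Longrightarrow> adj A h = h \<Longrightarrow> adj A (sq_iter h n) = sq_iter h n"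
  by (induction n) (auto simp: adj_mult)

lemma norm_sq_iter:
  assumes "h \<in> carrier A" "adj A h = h" shows "cnorm A (sq_iter h n) = cnorm A h ^ (2 ^ n)"
proof (induction n)
  case (Suc n)
  have "cnorm A (sq_iter h (Suc n)) = (cnorm A (sq_iter h n))\<^sup>2"
    using norm_cstar[of "sq_iter h n"] assms by (simp add: adj_sq_iter)
  then show ?case using Suc by (simp add: power_mult[symmetric] mult.commute)
qed simp

lemma seminorm_sq_iter:
  assumes \<rho>: "cstar_seminorm A \<rho>" and "h \<in> carrier A" "adj A h = h"
  shows "\<rho> (sq_iter h n) = \<rho> h ^ (2 ^ n)"
proof (induction n)
  case (Suc n)
  have "\<rho> (sq_iter h (Suc n)) = (\<rho> (sq_iter h n))\<^sup>2"
    using seminorm_cstar[OF \<rho>, of "sq_iter h n"] assms by (simp add: adj_sq_iter)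
  then show ?case using Suc by (simp add: power_mult[symmetric] mult.commute)
qed simp

end

section \<open>Defect projections of finite sets of edges\<close>

context ck_algebra
begin

text \<open>What remains of \<open>p v\<close> after removing the ranges of the edges in
  \<open>F\<close>. For finite \<open>F\<close> the sum makes sense at infinite emitters
  too.\<close>

definition gap :: "'e set \<Rightarrow> 'v \<Rightarrow> 'a" where
  "gap F v = p v \<ominus> (\<Oplus>e\<in>F \<inter> out_arcs G v. s e \<otimes> adj A (s e))"

context
  fixes F :: "'e set" assumes F: "finite F" "F \<subseteq> arcs G"
begin

lemma emitted_closed [simp]: "(\<Oplus>e\<in>F \<inter> out_arcs G v. s e \<otimes> adj A (s e)) \<in> carrier A"
  using F by (intro M.finsum_closed) auto

lemma gap_closed [simp]: "v \<in> verts G \<Longrightarrow> gap F v \<in> carrier A"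
  by (simp add: gap_def)

lemma adj_gap [simp]: "v \<in> verts G \<Longrightarrow> adj A (gap F v) = gap F v"
proof -
  assume v: "v \<in> verts G"
  have "adj A (\<Oplus>e\<in>F \<inter> out_arcs G v. s e \<otimes> adj A (s e)) = (\<Oplus>e\<in>F \<inter> out_arcs G v. s e \<otimes> adj A (s e))"
    using F by (subst adj_finsum) (auto intro!: M.finsum_cong' simp: adj_mult adj_adj)
  then show ?thesis using v by (simp add: gap_def adj_minus)
qed

lemma emitted_mult_s:
  assumes e: "e \<in> arcs G"
  shows "(\<Oplus>f\<in>F \<inter> out_arcs G v. s f \<otimes> adj A (s f)) \<otimes> s e = (if e \<in> F \<and> tail G e = v then s e else \<zero>)"
proof -
  have 1: "(\<Oplus>f\<in>F \<inter> out_arcs G v. s f \<otimes> adj A (s f)) \<otimes> s e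
      = (\<Oplus>f\<in>F \<inter> out_arcs G v. (s f \<otimes> adj A (s f)) \<otimes> s e)"
    using F e by (intro finsum_mult_right) auto
  have 2: "(s f \<otimes> adj A (s f)) \<otimes> s e = (if f = e then s e else \<zero>)" if "f \<in> arcs G" for f
    using that e by (simp add: mult_assoc adj_s_mult_s s_p)
  show ?thesis
  proof (cases "e \<in> F \<and> tail G e = v")
    case True
    then show ?thesis unfolding 1 using e F by (subst finsum_single[of _ e]) (auto simp: 2)
  next
    case False
    then show ?thesis unfolding 1 by (subst finsum_all_zero) (use e 2 in auto)
  qed
qed

lemma gap_mult_s:
  assumes v: "v \<in> verts G" and e: "e \<in> arcs G"
  shows "gap F v \<otimes> s e = (if tail G e = v \<and> e \<notin> F then s e else \<zero>)"
  using assms F by (auto simp: gap_def mult_minus_left p_mult_s emitted_mult_s)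

lemma gap_mult_p: assumes "v \<in> verts G" "w \<in> verts G" shows "gap F v \<otimes> p w = (if v = w then gap F v else \<zero>)"
proof -
  have "(\<Oplus>f\<in>F \<inter> out_arcs G v. s f \<otimes> adj A (s f)) \<otimes> p w
      = (\<Oplus>f\<in>F \<inter> out_arcs G v. (s f \<otimes> adj A (s f)) \<otimes> p w)"
    using F assms by (intro finsum_mult_right) auto
  also have "\<dots> = (if v = w then (\<Oplus>f\<in>F \<inter> out_arcs G v. s f \<otimes> adj A (s f)) else \<zero>)"
  proof (cases "v = w")
    case True
    then show ?thesis using F assms by (auto intro!: M.finsum_cong' simp: mult_assoc adj_s_mult_p)
  next
    case False
    then show ?thesis using F assms by (auto intro!: finsum_all_zero simp: mult_assoc adj_s_mult_p)
  qed
  finally show ?thesis using assms by (auto simp: gap_def mult_minus_left p_orth)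
qed

lemma p_mult_gap: assumes "v \<in> verts G" "w \<in> verts G" shows "p w \<otimes> gap F v = (if v = w then gap F v else \<zero>)"
  using arg_cong[OF gap_mult_p[OF assms], of "adj A"] assms by (simp add: adj_mult split: if_splits)

lemma adj_s_mult_gap:
  assumes v: "v \<in> verts G" and e: "e \<in> arcs G"
  shows "adj A (s e) \<otimes> gap F v = (if tail G e = v \<and> e \<notin> F then adj A (s e) else \<zero>)"
  using arg_cong[OF gap_mult_s[OF assms], of "adj A"] assms by (simp add: adj_mult split: if_splits)

text \<open>The adjoint of each edge in \<open>F\<close> annihilates the gap, so multiplying the gap
  by itself amounts to multiplying it by \<open>p v\<close>.\<close>

lemma gap_projection: assumes v: "v \<in> verts G" shows "projection A (gap F v)"
proof -
  have "(\<Oplus>f\<in>F \<inter> out_arcs G v. s f \<otimes> adj A (s f)) \<otimes> gap F v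
      = (\<Oplus>f\<in>F \<inter> out_arcs G v. (s f \<otimes> adj A (s f)) \<otimes> gap F v)"
    using F v by (intro finsum_mult_right) auto
  also have "\<dots> = \<zero>" using F v by (intro finsum_all_zero) (auto simp: mult_assoc adj_s_mult_gap)
  finally have "gap F v \<otimes> gap F v = p v \<otimes> gap F v"
    using v by (subst gap_def) (simp add: mult_minus_left)
  then show ?thesis using v by (simp add: projection_def p_mult_gap)
qed

end

end

text \<open>\<open>S\<close> stands for the seminorms of the finite-dimensional representations.  The third
  assumption says that some representation sends the element of a first-return cycle to \<open>z\<close> times
  its vertex projection.\<close>

locale exitless_ck_algebra = ck_algebra G A p s + exitless_digraph G
  for G :: "('v, 'e) pre_digraph" and A :: "('a, 'b) cstar_scheme" (structure)
    and p :: "'v \<Rightarrow> 'a" and s :: "'e \<Rightarrow> 'a" +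
  fixes S :: "('a \<Rightarrow> real) set"
  assumes S: "\<rho> \<in> S \<Longrightarrow> cstar_seminorm A \<rho>"
    and S_vertex: "v \<in> verts G \<Longrightarrow> \<exists>\<rho>\<in>S. \<rho> (p v) \<noteq> 0"
    and S_cycle: "\<lbrakk>awalk u (e # \<nu>) u; u \<notin> tail G ` set \<nu>; cmod z = 1\<rbrakk> \<Longrightarrow>
      \<exists>\<rho>\<in>S. \<rho> (p u) \<noteq> 0 \<and> \<rho> (path_el (e # \<nu>) u \<ominus> z \<odot> p u) = 0"
begin

text \<open>The bound may grow with the degree \<open>D\<close>, but only linearly; this growth disappears when the
  estimate is applied to high powers of a selfadjoint element.\<close>

definition tame :: "'e set \<Rightarrow> 'a \<Rightarrow> 'a \<Rightarrow> bool" where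
  "tame E q r \<longleftrightarrow> (\<exists>K\<ge>0. \<forall>D. \<forall>y\<in>mono_span E D. \<forall>M\<ge>0. (\<forall>\<rho>\<in>S. \<rho> y \<le> M) \<longrightarrow>
     cnorm A (q \<otimes> y \<otimes> r) \<le> K * (real D + 1) * M)"

section \<open>Tame pairs and their closure properties\<close>

lemma tameI:
  assumes "0 \<le> K" "\<And>D y M. \<lbrakk>y \<in> mono_span E D; 0 \<le> M; \<And>\<rho>. \<rho> \<in> S \<Longrightarrow> \<rho> y \<le> M\<rbrakk> \<Longrightarrow>
    cnorm A (q \<otimes> y \<otimes> r) \<le> K * (real D + 1) * M"
  shows "tame E q r"
  using assms unfolding tame_def by blast

lemma tameE:
  assumes "tame E q r"
  obtains K where "0 \<le> K" "\<And>D y M. \<lbrakk>y \<in> mono_span E D; 0 \<le> M; \<And>\<rho>. \<rho> \<in> S \<Longrightarrow> \<rho> y \<le> M\<rbrakk> \<Longrightarrow>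
    cnorm A (q \<otimes> y \<otimes> r) \<le> K * (real D + 1) * M"
  using assms unfolding tame_def by metis

lemma tame_null: "(\<And>D y. y \<in> mono_span E D \<Longrightarrow> q \<otimes> y \<otimes> r = \<zero>) \<Longrightarrow> tame E q r"
  by (rule tameI[of 0]) auto

text \<open>Absorbing \<open>b\<close> into the element raises its degree by \<open>k\<close>; since
  k + D + 1 is at most (k + 1)(D + 1), the bound stays linear in \<open>D\<close>.\<close>

lemma tame_mult_left:
  assumes t: "tame E q r" and c: "q \<in> carrier A" "r \<in> carrier A" "a \<in> carrier A"
    and b: "b \<in> mono_span E k"
  shows "tame E (a \<otimes> q \<otimes> b) r"
proof -
  obtain K where K: "0 \<le> K" "\<And>D y M. \<lbrakk>y \<in> mono_span E D; 0 \<le> M; \<And>\<rho>. \<rho> \<in> S \<Longrightarrow> \<rho> y \<le> M\<rbrakk> \<Longrightarrow>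
    cnorm A (q \<otimes> y \<otimes> r) \<le> K * (real D + 1) * M" using t by (rule tameE) blast
  have bc: "b \<in> carrier A" using b by simp
  have n: "0 \<le> cnorm A a" "0 \<le> cnorm A b" using c bc by (auto intro: norm_nonneg)
  show ?thesis
  proof (rule tameI[of "cnorm A a * K * (real k + 1) * cnorm A b"])
    show "0 \<le> cnorm A a * K * (real k + 1) * cnorm A b" using K n by simp
    fix D y M assume y: "y \<in> mono_span E D" "0 \<le> M" "\<And>\<rho>. \<rho> \<in> S \<Longrightarrow> \<rho> y \<le> M"
    have "\<rho> (b \<otimes> y) \<le> cnorm A b * M" if "\<rho> \<in> S" for \<rho>
    proof -
      have "\<rho> (b \<otimes> y) \<le> \<rho> b * \<rho> y" using S[OF that] b y by (intro seminorm_mult) auto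
      also have "\<dots> \<le> cnorm A b * M"
        using seminorm_le[OF S[OF that] bc] seminorm_nonneg[OF S[OF that], of y] y that n
        by (intro mult_mono) auto
      finally show ?thesis .
    qed
    then have "cnorm A (q \<otimes> (b \<otimes> y) \<otimes> r) \<le> K * (real (k + D) + 1) * (cnorm A b * M)"
      using span_mult[OF b y(1)] n y(2) by (intro K) auto
    also have "\<dots> \<le> K * ((real k + 1) * (real D + 1)) * (cnorm A b * M)"
      using K n y(2) by (intro mult_right_mono mult_left_mono) (auto simp: algebra_simps)
    finally have 1: "cnorm A (q \<otimes> (b \<otimes> y) \<otimes> r) \<le> K * ((real k + 1) * (real D + 1)) * (cnorm A b * M)" .
    have "(a \<otimes> q \<otimes> b) \<otimes> y \<otimes> r = a \<otimes> (q \<otimes> (b \<otimes> y) \<otimes> r)"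
      using c bc y by (simp add: mult_assoc)
    then have "cnorm A ((a \<otimes> q \<otimes> b) \<otimes> y \<otimes> r) \<le> cnorm A a * cnorm A (q \<otimes> (b \<otimes> y) \<otimes> r)"
      using c bc y by (simp add: norm_mult)
    also have "\<dots> \<le> cnorm A a * (K * ((real k + 1) * (real D + 1)) * (cnorm A b * M))"
      using 1 n by (intro mult_left_mono)
    finally show "cnorm A ((a \<otimes> q \<otimes> b) \<otimes> y \<otimes> r) \<le> cnorm A a * K * (real k + 1) * cnorm A b * (real D + 1) * M"
      by (simp add: mult_ac)
  qed
qed

text \<open>Span and seminorms are invariant under the adjoint, so estimates for left factors
  transfer to right factors.\<close>

lemma tame_adj:
  assumes t: "tame E q r" and c: "q \<in> carrier A" "r \<in> carrier A"
  shows "tame E (adj A r) (adj A q)"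
proof -
  obtain K where K: "0 \<le> K" "\<And>D y M. \<lbrakk>y \<in> mono_span E D; 0 \<le> M; \<And>\<rho>. \<rho> \<in> S \<Longrightarrow> \<rho> y \<le> M\<rbrakk> \<Longrightarrow>
    cnorm A (q \<otimes> y \<otimes> r) \<le> K * (real D + 1) * M" using t by (rule tameE) blast
  show ?thesis
  proof (rule tameI[of K])
    fix D y M assume y: "y \<in> mono_span E D" "0 \<le> M" "\<And>\<rho>. \<rho> \<in> S \<Longrightarrow> \<rho> y \<le> M"
    have "\<rho> (adj A y) \<le> M" if "\<rho> \<in> S" for \<rho> using y that S by (simp add: seminorm_adj)
    then have 1: "cnorm A (q \<otimes> adj A y \<otimes> r) \<le> K * (real D + 1) * M" using y by (intro K span_adj)
    have "adj A (q \<otimes> adj A y \<otimes> r) = adj A r \<otimes> y \<otimes> adj A q"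
      using c y by (simp add: adj_mult adj_adj mult_assoc)
    then show "cnorm A (adj A r \<otimes> y \<otimes> adj A q) \<le> K * (real D + 1) * M"
      using 1 norm_adj[of "q \<otimes> adj A y \<otimes> r"] c y by simp
  qed (rule K)
qed

lemma tame_add:
  assumes t: "tame E q r" "tame E q' r" and c: "q \<in> carrier A" "q' \<in> carrier A" "r \<in> carrier A"
  shows "tame E (q \<oplus> q') r"
proof -
  obtain K where K: "0 \<le> K" "\<And>D y M. \<lbrakk>y \<in> mono_span E D; 0 \<le> M; \<And>\<rho>. \<rho> \<in> S \<Longrightarrow> \<rho> y \<le> M\<rbrakk> \<Longrightarrow>
    cnorm A (q \<otimes> y \<otimes> r) \<le> K * (real D + 1) * M" using t(1) by (rule tameE) blast
  obtain K' where K': "0 \<le> K'" "\<And>D y M. \<lbrakk>y \<in> mono_span E D; 0 \<le> M; \<And>\<rho>. \<rho> \<in> S \<Longrightarrow> \<rho> y \<le> M\<rbrakk> \<Longrightarrow>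
    cnorm A (q' \<otimes> y \<otimes> r) \<le> K' * (real D + 1) * M" using t(2) by (rule tameE) blast
  show ?thesis
  proof (rule tameI[of "K + K'"])
    fix D y M assume y: "y \<in> mono_span E D" "0 \<le> M" "\<And>\<rho>. \<rho> \<in> S \<Longrightarrow> \<rho> y \<le> M"
    have "cnorm A ((q \<oplus> q') \<otimes> y \<otimes> r) \<le> cnorm A (q \<otimes> y \<otimes> r) + cnorm A (q' \<otimes> y \<otimes> r)"
      using c y by (simp add: mult_add_left norm_triangle)
    also have "\<dots> \<le> K * (real D + 1) * M + K' * (real D + 1) * M"
      using y by (intro add_mono K K')
    finally show "cnorm A ((q \<oplus> q') \<otimes> y \<otimes> r) \<le> (K + K') * (real D + 1) * M"
      by (simp add: algebra_simps)
  qed (use K K' in simp)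
qed

lemma tame_finsum:
  assumes "finite F" "\<And>i. i \<in> F \<Longrightarrow> f i \<in> carrier A" "r \<in> carrier A" "\<And>i. i \<in> F \<Longrightarrow> tame E (f i) r"
  shows "tame E (\<Oplus>i\<in>F. f i) r"
  using assms
proof (induction F rule: finite_induct)
  case empty
  then show ?case by (intro tame_null) simp
next
  case (insert a F)
  have "(\<Oplus>i\<in>insert a F. f i) = f a \<oplus> (\<Oplus>i\<in>F. f i)"
    using insert by (intro M.finsum_insert) auto
  moreover have "tame E (f a \<oplus> (\<Oplus>i\<in>F. f i)) r"
    using insert by (intro tame_add) (auto intro!: M.finsum_closed)
  ultimately show ?case by simp
qed

text \<open>The added edges, possibly infinitely many, keep paths along cycles available. Gaps at
  vertices off the cycles do not notice them: all edges of the closure that leave such a vertex lie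
  in \<open>F\<close>.\<close>

definition cycle_closure :: "'e set \<Rightarrow> 'e set" where
  "cycle_closure F = F \<union> {e \<in> arcs G. on_cycle (tail G e)}"

section \<open>Compressions by gaps\<close>

context
  fixes F :: "'e set" assumes F [simp]: "finite F" "F \<subseteq> arcs G"
begin

text \<open>The first edge of the path either starts elsewhere or belongs to \<open>F\<close>,
  because \<open>v\<close> is off the cycles; the gap kills it in both cases.\<close>

lemma gap_path:
  assumes v: "v \<in> verts G" "\<not> on_cycle v" and \<alpha>: "awalk u \<alpha> w" "set \<alpha> \<subseteq> cycle_closure F"
  shows "gap F v \<otimes> path_el \<alpha> w = (if \<alpha> = [] \<and> w = v then gap F v else \<zero>)"
proof (cases \<alpha>)
  case Nil
  then show ?thesis using assms by (auto simp: awalk_simps gap_mult_p)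
next
  case (Cons e \<beta>)
  then have e: "e \<in> arcs G" "awalk (head G e) \<beta> w" "e \<in> cycle_closure F" using \<alpha> by (auto simp: awalk_simps)
  then have "gap F v \<otimes> s e = \<zero>" using v by (auto simp: gap_mult_s cycle_closure_def)
  moreover have "gap F v \<otimes> path_el \<alpha> w = (gap F v \<otimes> s e) \<otimes> path_el \<beta> w"
    using Cons e v by (simp add: mult_assoc)
  ultimately show ?thesis using Cons e by simp
qed

lemma adj_path_gap:
  assumes v: "v \<in> verts G" "\<not> on_cycle v" and \<alpha>: "awalk u \<alpha> w" "set \<alpha> \<subseteq> cycle_closure F"
  shows "adj A (path_el \<alpha> w) \<otimes> gap F v = (if \<alpha> = [] \<and> w = v then gap F v else \<zero>)"
  using arg_cong[OF gap_path[OF assms], of "adj A"] assms by (simp add: adj_mult split: if_splits)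

lemma gap_span_gap_neq:
  assumes "v \<in> verts G" "\<not> on_cycle v" "v' \<in> verts G" "\<not> on_cycle v'" "v \<noteq> v'"
    "y \<in> mono_span (cycle_closure F) D"
  shows "gap F v \<otimes> y \<otimes> gap F v' = \<zero>"
  using assms(6)
proof (induction rule: mono_span.induct)
  case (step y u \<alpha> w u' \<beta> c)
  have "gap F v \<otimes> monomial \<alpha> w \<beta> \<otimes> gap F v' = (gap F v \<otimes> path_el \<alpha> w) \<otimes> (adj A (path_el \<beta> w) \<otimes> gap F v')"
    using step assms by (simp add: monomial_def mult_assoc)
  also have "\<dots> = \<zero>" using step assms by (auto simp: gap_path adj_path_gap)
  finally show ?case using step assms
    by (simp add: mult_add_left mult_add_right mult_smult_left mult_smult_right)
qed (use assms in simp)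

text \<open>Of all monomials only \<open>p v\<close> survives the cut from both sides, and it
  becomes the gap itself.\<close>

lemma gap_span_gap:
  assumes v: "v \<in> verts G" "\<not> on_cycle v" and y: "y \<in> mono_span (cycle_closure F) D"
  shows "\<exists>c. gap F v \<otimes> y \<otimes> gap F v = c \<odot> gap F v"
  using y
proof (induction rule: mono_span.induct)
  case zero
  then show ?case using v by (intro exI[of _ 0]) simp
next
  case (step y u \<alpha> w u' \<beta> c)
  have g: "gap F v \<otimes> gap F v = gap F v" using gap_projection[OF F v(1)] by (simp add: projection_def)
  have "gap F v \<otimes> monomial \<alpha> w \<beta> \<otimes> gap F v = (gap F v \<otimes> path_el \<alpha> w) \<otimes> (adj A (path_el \<beta> w) \<otimes> gap F v)"
    using step v by (simp add: monomial_def mult_assoc)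
  also have "\<dots> = (if \<alpha> = [] \<and> \<beta> = [] \<and> w = v then 1 else 0) \<odot> gap F v"
    using step v by (auto simp: gap_path adj_path_gap g)
  finally have m: "gap F v \<otimes> monomial \<alpha> w \<beta> \<otimes> gap F v = (if \<alpha> = [] \<and> \<beta> = [] \<and> w = v then 1 else 0) \<odot> gap F v" .
  obtain d where d: "gap F v \<otimes> y \<otimes> gap F v = d \<odot> gap F v" using step by blast
  have "gap F v \<otimes> (c \<odot> monomial \<alpha> w \<beta> \<oplus> y) \<otimes> gap F v
      = c \<odot> (gap F v \<otimes> monomial \<alpha> w \<beta> \<otimes> gap F v) \<oplus> gap F v \<otimes> y \<otimes> gap F v"
    using step v by (simp add: mult_add_left mult_add_right mult_smult_left mult_smult_right)
  also have "\<dots> = (c * (if \<alpha> = [] \<and> \<beta> = [] \<and> w = v then 1 else 0) + d) \<odot> gap F v"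
    unfolding m d using v by (simp add: smult_smult smult_add_left)
  finally show ?case by blast
qed

text \<open>A surviving monomial would be a starred path from \<open>x\<close> to \<open>v\<close>,
  but a walk from a cycle vertex never reaches a vertex off the cycles.\<close>

lemma gap_span_p_null:
  assumes v: "v \<in> verts G" "\<not> on_cycle v" and u: "on_cycle x" "x \<in> verts G"
    and y: "y \<in> mono_span (cycle_closure F) D"
  shows "gap F v \<otimes> y \<otimes> p x = \<zero>"
  using y
proof (induction rule: mono_span.induct)
  case (step y u \<alpha> w u' \<beta> c)
  have "gap F v \<otimes> monomial \<alpha> w \<beta> \<otimes> p x = (gap F v \<otimes> path_el \<alpha> w) \<otimes> (adj A (path_el \<beta> w) \<otimes> p x)"
    using step assms by (simp add: monomial_def mult_assoc)
  also have "\<dots> = \<zero>"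
  proof (cases "\<alpha> = [] \<and> w = v \<and> x = u'")
    case True
    then have "on_cycle v" using on_cycle_walk(1)[OF u(1)] step by blast
    then show ?thesis using v by blast
  next
    case False
    then show ?thesis using step assms by (auto simp: gap_path adj_path_p)
  qed
  finally show ?case using step assms
    by (simp add: mult_add_left mult_add_right mult_smult_left mult_smult_right)
qed (use assms in simp)

text \<open>If \<open>F\<close> contains all edges leaving \<open>v\<close>, then \<open>v\<close>
  is a sink, for otherwise the Cuntz-Krieger relation makes the gap zero; so the gap is
  \<open>p v\<close>. If not, an edge \<open>e\<close> outside \<open>F\<close> has its range below
  the gap, and compressing the gap by \<open>s e\<close> recovers
  \<open>p (head G e)\<close>.\<close>

lemma seminorm_gap:
  assumes v: "v \<in> verts G" "gap F v \<noteq> \<zero>"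
  shows "\<exists>\<rho>\<in>S. \<rho> (gap F v) \<noteq> 0"
proof (cases "out_arcs G v \<subseteq> F")
  case True
  then have fin: "finite (out_arcs G v)" and int: "F \<inter> out_arcs G v = out_arcs G v"
    using F finite_subset by blast+
  have "out_arcs G v = {}"
  proof (rule ccontr)
    assume "out_arcs G v \<noteq> {}"
    then have "gap F v = \<zero>" using p_regular[OF v(1) _ fin] v int by (simp add: gap_def)
    then show False using v by simp
  qed
  then have "gap F v = p v" using v by (simp add: gap_def)
  then show ?thesis using S_vertex v by simp
next
  case False
  then obtain e where "e \<in> out_arcs G v" "e \<notin> F" by blast
  then have e: "e \<in> arcs G" "tail G e = v" "e \<notin> F" by auto
  obtain \<rho> where \<rho>: "\<rho> \<in> S" "\<rho> (p (head G e)) \<noteq> 0" using S_vertex[of "head G e"] e by auto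
  have "\<rho> (gap F v) \<noteq> 0"
  proof
    assume z: "\<rho> (gap F v) = 0"
    have eq: "p (head G e) = adj A (s e) \<otimes> (gap F v \<otimes> s e)" using e v by (simp add: gap_mult_s adj_s_s)
    have "\<rho> (p (head G e)) \<le> \<rho> (adj A (s e)) * \<rho> (gap F v \<otimes> s e)"
      unfolding eq using e v by (intro seminorm_mult[OF S[OF \<rho>(1)]]) auto
    moreover have "\<rho> (gap F v \<otimes> s e) \<le> 0"
      using seminorm_mult[OF S[OF \<rho>(1)], of "gap F v" "s e"] e v z by simp
    ultimately have "\<rho> (p (head G e)) \<le> 0"
      using S[OF \<rho>(1)] e by (smt (verit) adj_closed mult_nonneg_nonpos s_closed seminorm_nonneg)
    then show False using \<rho> seminorm_nonneg[OF S[OF \<rho>(1)], of "p (head G e)"] e by simp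
  qed
  then show ?thesis using \<rho> by blast
qed

text \<open>A seminorm that sees the gap takes the value 1 on it, as the norm does, so both read off
  the modulus of the scalar to which an element is compressed.\<close>

lemma tame_gap_gap:
  assumes v: "v \<in> verts G" "\<not> on_cycle v" and v': "v' \<in> verts G" "\<not> on_cycle v'"
  shows "tame (cycle_closure F) (gap F v) (gap F v')"
proof (cases "v = v' \<and> gap F v \<noteq> \<zero>")
  case False
  then show ?thesis
    using gap_span_gap_neq[OF v v'] v v' by (intro tame_null) auto
next
  case True
  then obtain \<rho> where \<rho>: "\<rho> \<in> S" "\<rho> (gap F v) \<noteq> 0" using seminorm_gap v by blast
  have 1: "\<rho> (gap F v) = 1" using seminorm_projection[OF S[OF \<rho>(1)] gap_projection[OF F v(1)]] \<rho> by blast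
  have n1: "cnorm A (gap F v) = 1" using norm_projection[OF gap_projection[OF F v(1)]] True by blast
  show ?thesis
  proof (rule tameI[of 1])
    fix D y M assume y: "y \<in> mono_span (cycle_closure F) D" "0 \<le> M" "\<And>\<rho>. \<rho> \<in> S \<Longrightarrow> \<rho> y \<le> M"
    obtain c where c: "gap F v \<otimes> y \<otimes> gap F v = c \<odot> gap F v" using gap_span_gap[OF v y(1)] by blast
    have "\<rho> (gap F v \<otimes> y \<otimes> gap F v) \<le> \<rho> (gap F v \<otimes> y) * \<rho> (gap F v)"
      using S[OF \<rho>(1)] v y by (intro seminorm_mult) auto
    also have "\<dots> \<le> \<rho> (gap F v) * \<rho> y"
      using seminorm_mult[OF S[OF \<rho>(1)], of "gap F v" y] v y 1 by simp
    finally have "cmod c \<le> M"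
      using y(3)[OF \<rho>(1)] v 1 seminorm_smult[OF S[OF \<rho>(1)], of "gap F v" c] by (simp add: c)
    then have "cmod c \<le> (real D + 1) * M"
      using y(2) by (smt (verit) mult_le_cancel_right1 of_nat_0_le_iff)
    then show "cnorm A (gap F v \<otimes> y \<otimes> gap F v') \<le> 1 * (real D + 1) * M"
      using v n1 True[THEN conjunct1, symmetric] by (simp add: c norm_smult)
  qed simp
qed

end

end

section \<open>Corners at vertices on cycles\<close>

context exitless_ck_algebra
begin

text \<open>Every vertex met on the way lies on a cycle and emits a single edge, so the
  Cuntz-Krieger sum has one term there. This makes each edge, and hence the path, unitary between
  corners.\<close>

lemma path_adj_path_on_cycle:
  "on_cycle u \<Longrightarrow> awalk u \<gamma> w \<Longrightarrow> path_el \<gamma> w \<otimes> adj A (path_el \<gamma> w) = p u"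
proof (induction \<gamma> arbitrary: u)
  case (Cons e \<gamma>)
  then have e: "e \<in> arcs G" "tail G e = u" "awalk (head G e) \<gamma> w" by (auto simp: awalk_simps)
  have "on_cycle (head G e)"
    using on_cycle_walk(1)[OF Cons.prems(1), of "[e]"] arc_implies_awalk[OF e(1)] e(2) by auto
  then have IH: "path_el \<gamma> w \<otimes> adj A (path_el \<gamma> w) = p (head G e)" using Cons.IH e by blast
  have "path_el (e # \<gamma>) w \<otimes> adj A (path_el (e # \<gamma>) w)
      = s e \<otimes> (path_el \<gamma> w \<otimes> adj A (path_el \<gamma> w)) \<otimes> adj A (s e)"
    using e by (simp add: adj_mult mult_assoc)
  also have "\<dots> = s e \<otimes> adj A (s e)" using e by (simp add: IH s_p)
  also have "\<dots> = p u"
    using p_on_cycle_step[OF e(1)] on_cycle_out_arcs[OF Cons.prems(1) e(1,2)] e(2) by simp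
  finally show ?case .
qed (auto simp: awalk_simps)

lemma on_cycle_walk_arcs: "on_cycle u \<Longrightarrow> awalk u \<gamma> w \<Longrightarrow> set \<gamma> \<subseteq> cycle_closure F"
proof (induction \<gamma> arbitrary: u)
  case (Cons e \<gamma>)
  then have e: "e \<in> arcs G" "tail G e = u" "awalk (head G e) \<gamma> w" by (auto simp: awalk_simps)
  have "on_cycle (head G e)"
    using on_cycle_walk(1)[OF Cons.prems(1), of "[e]"] arc_implies_awalk[OF e(1)] e(2) by auto
  then show ?case using Cons e by (auto simp: cycle_closure_def)
qed simp

definition cycle_pow :: "'e list \<Rightarrow> 'v \<Rightarrow> nat \<Rightarrow> 'a" where
  "cycle_pow c u n = path_el (concat (replicate n c)) u"

text \<open>Integer powers of the loop \<open>c\<close>, which is a unitary of the corner at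
  \<open>u\<close>, so that the adjoint serves as inverse.\<close>

definition cycle_powi :: "'e list \<Rightarrow> 'v \<Rightarrow> int \<Rightarrow> 'a" where
  "cycle_powi c u k = (if k \<ge> 0 then cycle_pow c u (nat k) else adj A (cycle_pow c u (nat (- k))))"

context
  fixes u :: 'v and c :: "'e list" assumes c: "awalk u c u" "c \<noteq> []"
begin

lemma on_cycle_u: "on_cycle u" and verts_u [simp]: "u \<in> verts G"
  using c by (auto simp: on_cycle_def)

lemma awalk_cycle_pow: "awalk u (concat (replicate n c)) u"
  using c by (induction n) (auto simp: awalk_simps intro: awalk_appendI simp del: awalk_append_iff)

lemma cycle_pow_closed [simp]: "cycle_pow c u n \<in> carrier A"
  unfolding cycle_pow_def using path_el_closed[OF awalk_cycle_pow] .

lemma cycle_pow_0: "cycle_pow c u 0 = p u"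
  by (simp add: cycle_pow_def)

lemma cycle_pow_add: "cycle_pow c u (m + n) = cycle_pow c u m \<otimes> cycle_pow c u n"
  unfolding cycle_pow_def replicate_add concat_append
  by (rule path_append[OF awalk_cycle_pow awalk_cycle_pow])

lemma cycle_pow_1: "cycle_pow c u 1 = path_el c u"
  by (simp add: cycle_pow_def)

lemma cycle_pow_p: "cycle_pow c u n \<otimes> p u = cycle_pow c u n"
  unfolding cycle_pow_def using path_p[OF awalk_cycle_pow] by simp

lemma p_adj_cycle_pow: "p u \<otimes> adj A (cycle_pow c u n) = adj A (cycle_pow c u n)"
  unfolding cycle_pow_def using p_adj_path[OF awalk_cycle_pow] by simp

lemma adj_cycle_pow: "adj A (cycle_pow c u n) \<otimes> cycle_pow c u n = p u"
  unfolding cycle_pow_def by (rule adj_path_path[OF awalk_cycle_pow])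

lemma cycle_pow_adj: "cycle_pow c u n \<otimes> adj A (cycle_pow c u n) = p u"
  unfolding cycle_pow_def by (rule path_adj_path_on_cycle[OF on_cycle_u awalk_cycle_pow])

lemma cycle_powi_closed [simp]: "cycle_powi c u k \<in> carrier A"
  by (simp add: cycle_powi_def)

lemma cycle_pow_mult_adj: "cycle_pow c u i \<otimes> adj A (cycle_pow c u j) = cycle_powi c u (int i - int j)"
proof (cases "j \<le> i")
  case True
  then obtain k where k: "i = k + j" by (metis le_add_diff_inverse2)
  have "cycle_pow c u i \<otimes> adj A (cycle_pow c u j) = cycle_pow c u k \<otimes> (cycle_pow c u j \<otimes> adj A (cycle_pow c u j))"
    by (simp add: k cycle_pow_add mult_assoc)
  then show ?thesis by (simp add: k cycle_pow_adj cycle_pow_p cycle_powi_def)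
next
  case False
  then obtain k where k: "j = k + i" "k > 0" by (metis le_add_diff_inverse2 nat_le_linear zero_less_diff not_le)
  have "cycle_pow c u i \<otimes> adj A (cycle_pow c u j) = (cycle_pow c u i \<otimes> adj A (cycle_pow c u i)) \<otimes> adj A (cycle_pow c u k)"
    by (simp add: k cycle_pow_add adj_mult mult_assoc)
  then show ?thesis using k by (simp add: cycle_pow_adj p_adj_cycle_pow cycle_powi_def)
qed

lemma norm_cycle_powi: "cnorm A (cycle_powi c u k) \<le> 1"
proof -
  have p1: "cnorm A (p u) \<le> 1"
    using norm_projection[of "p u"] by (cases "p u = \<zero>") (auto simp: projection_def)
  have "cnorm A (cycle_pow c u n) \<le> 1" for n
  proof -
    have "(cnorm A (cycle_pow c u n))\<^sup>2 \<le> 1" using norm_cstar[of "cycle_pow c u n"] p1 by (simp add: adj_cycle_pow)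
    then show ?thesis using norm_nonneg[of "cycle_pow c u n"] by (simp add: power2_le_iff_abs_le abs_le_square_iff power_le_one_iff)
  qed
  then show ?thesis by (simp add: cycle_powi_def norm_adj)
qed

text \<open>For the loop C and p = \<open>p u\<close>, C^(n+1) - z^(n+1) p splits as C (C^n - z^n p)
  + z^n (C - z p), and \<open>\<rho>\<close> is submultiplicative. Negative powers follow by
  adjoints, since the conjugate of \<open>z\<close> is its inverse.\<close>

lemma seminorm_cycle_powi:
  assumes \<rho>: "cstar_seminorm A \<rho>" and z: "cmod z = 1" and c0: "\<rho> (path_el c u \<ominus> z \<odot> p u) = 0"
  shows "\<rho> (cycle_powi c u k \<ominus> (z powi k) \<odot> p u) = 0"
proof -
  have pow: "\<rho> (cycle_pow c u n \<ominus> (z ^ n) \<odot> p u) = 0" for n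
  proof (induction n)
    case 0
    then show ?case by (simp add: cycle_pow_0 seminorm_zero[OF \<rho>])
  next
    case (Suc n)
    let ?C = "cycle_pow c u 1"
    have "cycle_pow c u (Suc n) \<ominus> (z ^ Suc n) \<odot> p u
        = (?C \<otimes> cycle_pow c u n \<ominus> (z ^ n) \<odot> ?C) \<oplus> ((z ^ n) \<odot> ?C \<ominus> (z ^ n) \<odot> (z \<odot> p u))"
      using cycle_pow_add[of 1 n] by (simp add: minus_add_minus smult_smult mult.commute)
    also have "\<dots> = ?C \<otimes> (cycle_pow c u n \<ominus> (z ^ n) \<odot> p u) \<oplus> (z ^ n) \<odot> (?C \<ominus> z \<odot> p u)"
      by (simp add: mult_minus_right mult_smult_right cycle_pow_p smult_minus)
    finally have eq: "cycle_pow c u (Suc n) \<ominus> (z ^ Suc n) \<odot> p u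
        = ?C \<otimes> (cycle_pow c u n \<ominus> (z ^ n) \<odot> p u) \<oplus> (z ^ n) \<odot> (?C \<ominus> z \<odot> p u)" .
    have "\<rho> (cycle_pow c u (Suc n) \<ominus> (z ^ Suc n) \<odot> p u)
        \<le> \<rho> (?C \<otimes> (cycle_pow c u n \<ominus> (z ^ n) \<odot> p u)) + \<rho> ((z ^ n) \<odot> (?C \<ominus> z \<odot> p u))"
      unfolding eq by (intro seminorm_add[OF \<rho>]) auto
    moreover have "\<rho> ((z ^ n) \<odot> (?C \<ominus> z \<odot> p u)) = 0"
      using c0 by (subst seminorm_smult[OF \<rho>]) (auto simp: cycle_pow_1[symmetric])
    moreover have "\<rho> (?C \<otimes> (cycle_pow c u n \<ominus> (z ^ n) \<odot> p u)) \<le> \<rho> ?C * \<rho> (cycle_pow c u n \<ominus> (z ^ n) \<odot> p u)"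
      by (intro seminorm_mult[OF \<rho>]) auto
    ultimately have "\<rho> (cycle_pow c u (Suc n) \<ominus> (z ^ Suc n) \<odot> p u) \<le> 0"
      unfolding Suc.IH by linarith
    moreover have "0 \<le> \<rho> (cycle_pow c u (Suc n) \<ominus> (z ^ Suc n) \<odot> p u)"
      by (intro seminorm_nonneg[OF \<rho>]) auto
    ultimately show ?case by linarith
  qed
  show ?thesis
  proof (cases "k \<ge> 0")
    case True
    then show ?thesis using pow[of "nat k"] by (simp add: cycle_powi_def power_int_def)
  next
    case False
    let ?n = "nat (- k)"
    have "cnj z * z = 1" using z complex_norm_square[of z] by (simp add: mult.commute)
    then have "inverse z = cnj z" by (metis inverse_unique mult.commute)
    then have "z powi k = cnj (z ^ ?n)" using False by (simp add: power_int_def)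
    then have "cycle_powi c u k \<ominus> (z powi k) \<odot> p u = adj A (cycle_pow c u ?n \<ominus> (z ^ ?n) \<odot> p u)"
      using False by (simp add: cycle_powi_def adj_minus adj_smult)
    then show ?thesis using pow[of ?n] by (simp add: seminorm_adj[OF \<rho>])
  qed
qed

lemma Laurent_closed [simp]: "(\<Oplus>k\<in>I. f k \<odot> cycle_powi c u k) \<in> carrier A"
  by (intro M.finsum_closed) auto

text \<open>Such a seminorm sees a Laurent polynomial in the loop only through its value at
  \<open>z\<close>.\<close>

lemma seminorm_Laurent:
  assumes \<rho>: "cstar_seminorm A \<rho>" and z: "cmod z = 1" and c0: "\<rho> (path_el c u \<ominus> z \<odot> p u) = 0"
    and I: "finite I"
  shows "\<rho> ((\<Oplus>k\<in>I. f k \<odot> cycle_powi c u k) \<ominus> (\<Sum>k\<in>I. f k * z powi k) \<odot> p u) = 0"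
  using I
proof (induction I rule: finite_induct)
  case empty
  then show ?case by (simp add: seminorm_zero[OF \<rho>])
next
  case (insert a I)
  have 1: "(\<Oplus>k\<in>insert a I. f k \<odot> cycle_powi c u k) = f a \<odot> cycle_powi c u a \<oplus> (\<Oplus>k\<in>I. f k \<odot> cycle_powi c u k)"
    using insert by (intro M.finsum_insert) auto
  have "(\<Oplus>k\<in>insert a I. f k \<odot> cycle_powi c u k) \<ominus> (\<Sum>k\<in>insert a I. f k * z powi k) \<odot> p u
      = f a \<odot> (cycle_powi c u a \<ominus> (z powi a) \<odot> p u)
        \<oplus> ((\<Oplus>k\<in>I. f k \<odot> cycle_powi c u k) \<ominus> (\<Sum>k\<in>I. f k * z powi k) \<odot> p u)"
    unfolding 1 using insert by (simp add: smult_add_left smult_minus smult_smult add_minus_add)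
  then have "\<rho> ((\<Oplus>k\<in>insert a I. f k \<odot> cycle_powi c u k) \<ominus> (\<Sum>k\<in>insert a I. f k * z powi k) \<odot> p u)
      \<le> \<rho> (f a \<odot> (cycle_powi c u a \<ominus> (z powi a) \<odot> p u))
        + \<rho> ((\<Oplus>k\<in>I. f k \<odot> cycle_powi c u k) \<ominus> (\<Sum>k\<in>I. f k * z powi k) \<odot> p u)"
    by (simp add: seminorm_add[OF \<rho>])
  also have "\<dots> = 0"
    using insert.IH seminorm_cycle_powi[OF \<rho> z c0] by (simp add: seminorm_smult[OF \<rho>])
  finally show ?case using seminorm_nonneg[OF \<rho>, of "(\<Oplus>k\<in>insert a I. f k \<odot> cycle_powi c u k) \<ominus> (\<Sum>k\<in>insert a I. f k * z powi k) \<odot> p u"]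
    by simp
qed

end

text \<open>Appending to both paths a return walk from \<open>w\<close> to \<open>u\<close> does not
  change the monomial, because that walk is unitary. Both paths are then closed at \<open>u\<close>,
  hence powers of the loop, and the monomial is the quotient of these powers.\<close>

lemma corner_monomial:
  assumes c: "awalk u (e # \<nu>) u" "u \<notin> tail G ` set \<nu>"
    and m: "awalk x \<alpha> w" "awalk x' \<beta> w" "length \<alpha> + length \<beta> \<le> D"
  obtains "p u \<otimes> monomial \<alpha> w \<beta> \<otimes> p u = \<zero>"
    | k where "k \<in> {-int D..int D}" "p u \<otimes> monomial \<alpha> w \<beta> \<otimes> p u = cycle_powi (e # \<nu>) u k"
proof (cases "x = u \<and> x' = u")
  case False
  have u: "u \<in> verts G" using c by blast
  have "p u \<otimes> monomial \<alpha> w \<beta> \<otimes> p u = (p u \<otimes> path_el \<alpha> w) \<otimes> (adj A (path_el \<beta> w) \<otimes> p u)"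
    using m u by (simp add: monomial_def mult_assoc)
  also have "\<dots> = \<zero>" using False m u by (auto simp: p_path adj_path_p)
  finally show ?thesis using that by blast
next
  case True
  then have x: "x = u" "x' = u" by auto
  have u: "u \<in> verts G" and cyc: "on_cycle u" using c by (auto simp: on_cycle_def)
  let ?c = "e # \<nu>"
  obtain \<gamma> where \<gamma>: "awalk w \<gamma> u" using on_cycle_walk(2)[OF cyc] m(1) x by blast
  have w: "on_cycle w" using on_cycle_walk(1)[OF cyc] m(1) x by blast
  have a: "awalk u (\<alpha> @ \<gamma>) u" "awalk u (\<beta> @ \<gamma>) u" using m x \<gamma> by (auto intro: awalk_appendI simp del: awalk_append_iff)
  obtain i where i: "\<alpha> @ \<gamma> = concat (replicate i ?c)" using closed_walk_power[OF c a(1)] by blast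
  obtain j where j: "\<beta> @ \<gamma> = concat (replicate j ?c)" using closed_walk_power[OF c a(2)] by blast
  have "p u \<otimes> monomial \<alpha> w \<beta> \<otimes> p u = (p u \<otimes> path_el \<alpha> w) \<otimes> (adj A (path_el \<beta> w) \<otimes> p u)"
    using m u by (simp add: monomial_def mult_assoc)
  also have "\<dots> = path_el \<alpha> w \<otimes> adj A (path_el \<beta> w)"
    using m u x by (simp add: p_path adj_path_p)
  also have "\<dots> = (path_el \<alpha> w \<otimes> p w) \<otimes> adj A (path_el \<beta> w)"
    using m path_p[OF m(1)] by (simp add: awalk_last_in_verts)
  also have "\<dots> = (path_el \<alpha> w \<otimes> path_el \<gamma> u) \<otimes> adj A (path_el \<beta> w \<otimes> path_el \<gamma> u)"
    using m \<gamma> by (simp add: path_adj_path_on_cycle[OF w \<gamma>, symmetric] adj_mult mult_assoc)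
  also have "\<dots> = cycle_pow ?c u i \<otimes> adj A (cycle_pow ?c u j)"
    using path_append[OF m(1) \<gamma>] path_append[OF m(2) \<gamma>] i j by (simp add: cycle_pow_def)
  also have "\<dots> = cycle_powi ?c u (int i - int j)"
    by (rule cycle_pow_mult_adj[OF c(1)]) simp
  finally have eq: "p u \<otimes> monomial \<alpha> w \<beta> \<otimes> p u = cycle_powi ?c u (int i - int j)" .
  have len: "length (concat (replicate k ?c)) = k * length ?c" for k
    by (induction k) auto
  \<comment> \<open>The length of the return walk is not controlled, but it cancels in the
    difference; this keeps the exponent within \<open>D\<close>.\<close>
  have "int (length \<alpha>) - int (length \<beta>) = (int i - int j) * int (length ?c)"
  proof -
    have "length \<alpha> + length \<gamma> = i * length ?c" "length \<beta> + length \<gamma> = j * length ?c"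
      using arg_cong[OF i, of length] arg_cong[OF j, of length] unfolding len by auto
    then have "int (length \<alpha>) + int (length \<gamma>) = int i * int (length ?c)"
      "int (length \<beta>) + int (length \<gamma>) = int j * int (length ?c)"
      unfolding of_nat_add[symmetric] of_nat_mult[symmetric] by (simp_all only:)
    then show ?thesis unfolding left_diff_distrib by linarith
  qed
  then have "\<bar>int i - int j\<bar> * int (length ?c) \<le> int D" using m(3) by (simp add: abs_mult[symmetric])
  moreover have "\<bar>int i - int j\<bar> * 1 \<le> \<bar>int i - int j\<bar> * int (length ?c)"
    by (rule mult_left_mono) auto
  ultimately have "\<bar>int i - int j\<bar> \<le> int D" by simp
  then have "int i - int j \<in> {-int D..int D}" by auto
  then show ?thesis using that(2) eq by blast
qed

lemma corner_span:
  assumes c: "awalk u (e # \<nu>) u" "u \<notin> tail G ` set \<nu>" and y: "y \<in> mono_span E D"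
  shows "\<exists>f. p u \<otimes> y \<otimes> p u = (\<Oplus>k\<in>{-int D..int D}. f k \<odot> cycle_powi (e # \<nu>) u k)"
  using y
proof (induction rule: mono_span.induct)
  case zero
  have u: "u \<in> verts G" using c by blast
  have "(\<Oplus>k\<in>{-int D..int D}. 0 \<odot> cycle_powi (e # \<nu>) u k) = \<zero>"
    using cycle_powi_closed[OF c(1)] by (intro finsum_all_zero) simp
  then show ?case using u by (intro exI[of _ "\<lambda>_. 0"]) simp
next
  case (step y x \<alpha> w x' \<beta> d)
  have u: "u \<in> verts G" using c by blast
  let ?U = "cycle_powi (e # \<nu>) u" and ?I = "{-int D..int D}"
  have U: "?U k \<in> carrier A" for k using cycle_powi_closed[OF c(1)] by simp
  obtain f where f: "p u \<otimes> y \<otimes> p u = (\<Oplus>k\<in>?I. f k \<odot> ?U k)" using step by blast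
  have fc: "(\<Oplus>k\<in>?I. g k \<odot> ?U k) \<in> carrier A" for g using U by (intro M.finsum_closed) auto
  have eq: "p u \<otimes> (d \<odot> monomial \<alpha> w \<beta> \<oplus> y) \<otimes> p u
      = d \<odot> (p u \<otimes> monomial \<alpha> w \<beta> \<otimes> p u) \<oplus> (\<Oplus>k\<in>?I. f k \<odot> ?U k)"
    using step u by (simp add: mult_add_left mult_add_right mult_smult_left mult_smult_right flip: f)
  show ?case
  proof (rule corner_monomial[OF c step.hyps(2,3,6)])
    assume "p u \<otimes> monomial \<alpha> w \<beta> \<otimes> p u = \<zero>"
    then show ?thesis using eq fc by auto
  next
    fix k assume k: "k \<in> ?I" "p u \<otimes> monomial \<alpha> w \<beta> \<otimes> p u = ?U k"
    have "(\<Oplus>j\<in>?I. (if j = k then d else 0) \<odot> ?U j) = d \<odot> ?U k"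
      using k U by (intro finsum_single[of _ k]) auto
    then have "d \<odot> ?U k \<oplus> (\<Oplus>j\<in>?I. f j \<odot> ?U j)
        = (\<Oplus>j\<in>?I. (if j = k then d else 0) \<odot> ?U j) \<oplus> (\<Oplus>j\<in>?I. f j \<odot> ?U j)" by simp
    also have "\<dots> = (\<Oplus>j\<in>?I. (if j = k then d else 0) \<odot> ?U j \<oplus> f j \<odot> ?U j)"
      using U by (intro M.finsum_addf[symmetric]) auto
    also have "\<dots> = (\<Oplus>j\<in>?I. ((if j = k then d else 0) + f j) \<odot> ?U j)"
      using U by (intro M.finsum_cong') (auto simp: smult_add_left)
    finally show ?thesis using eq k by (intro exI[of _ "\<lambda>j. (if j = k then d else 0) + f j"]) simp
  qed
qed

lemma tame_cycle:
  assumes u: "on_cycle u" shows "tame E (p u) (p u)"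
proof -
  obtain e \<nu> where c: "awalk u (e # \<nu>) u" "u \<notin> tail G ` set \<nu>" using first_return_walk[OF u] .
  let ?U = "cycle_powi (e # \<nu>) u"
  have uv: "u \<in> verts G" using c by blast
  have pu: "projection A (p u)" using uv by (simp add: projection_def)
  have U: "?U k \<in> carrier A" for k using cycle_powi_closed[OF c(1)] by simp
  show ?thesis
  \<comment> \<open>There are 2D + 1 coefficients, hence at most 2 (D + 1).\<close>
  proof (rule tameI[of 2])
    fix D y M assume y: "y \<in> mono_span E D" "0 \<le> M" "\<And>\<rho>. \<rho> \<in> S \<Longrightarrow> \<rho> y \<le> M"
    let ?I = "{-int D..int D}"
    obtain f where f: "p u \<otimes> y \<otimes> p u = (\<Oplus>k\<in>?I. f k \<odot> ?U k)" using corner_span[OF c y(1)] by blast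
    have "cmod (\<Sum>k\<in>?I. f k * z powi k) \<le> M" if z: "cmod z = 1" for z
    proof -
      obtain \<rho> where \<rho>: "\<rho> \<in> S" "\<rho> (p u) \<noteq> 0" "\<rho> (path_el (e # \<nu>) u \<ominus> z \<odot> p u) = 0"
        using S_cycle[OF c z] by blast
      note sn = S[OF \<rho>(1)]
      have \<rho>1: "\<rho> (p u) = 1" using seminorm_projection[OF sn pu \<rho>(2)] .
      have "\<rho> ((\<Oplus>k\<in>?I. f k \<odot> ?U k) \<ominus> (\<Sum>k\<in>?I. f k * z powi k) \<odot> p u) = 0"
        using seminorm_Laurent[OF c(1) _ sn z \<rho>(3), of ?I f] by simp
      moreover have "(\<Oplus>k\<in>?I. f k \<odot> ?U k) \<in> carrier A" using U by (intro M.finsum_closed) auto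
      ultimately have "\<rho> ((\<Sum>k\<in>?I. f k * z powi k) \<odot> p u) \<le> \<rho> (p u \<otimes> y \<otimes> p u)"
        unfolding f using uv by (intro seminorm_le_if_minus_null[OF sn]) auto
      also have "\<dots> \<le> \<rho> (p u \<otimes> y) * \<rho> (p u)" using y uv by (intro seminorm_mult[OF sn]) auto
      also have "\<dots> \<le> \<rho> (p u) * \<rho> y" using seminorm_mult[OF sn, of "p u" y] y uv by (simp add: \<rho>1)
      also have "\<dots> \<le> M" using y(3)[OF \<rho>(1)] by (simp add: \<rho>1)
      finally show ?thesis using uv by (simp add: seminorm_smult[OF sn] \<rho>1)
    qed
    then have fM: "cmod (f k) \<le> M" if "k \<in> ?I" for k
      using that by (rule Laurent_coeff_bound)
    have "cnorm A (p u \<otimes> y \<otimes> p u) \<le> (\<Sum>k\<in>?I. cnorm A (f k \<odot> ?U k))"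
      unfolding f using U by (intro norm_finsum) auto
    also have "\<dots> \<le> (\<Sum>k\<in>?I. M)"
    proof (rule sum_mono)
      fix k assume k: "k \<in> ?I"
      have "cnorm A (f k \<odot> ?U k) = cmod (f k) * cnorm A (?U k)" using U by (simp add: norm_smult)
      also have "\<dots> \<le> M * 1"
        using fM[OF k] norm_cycle_powi[OF c(1)] U y(2) by (intro mult_mono) (auto intro: norm_nonneg)
      finally show "cnorm A (f k \<odot> ?U k) \<le> M" by simp
    qed
    also have "\<dots> = (2 * real D + 1) * M" by (simp add: nat_add_distrib nat_mult_distrib)
    also have "\<dots> \<le> 2 * (real D + 1) * M" using y(2) by (intro mult_right_mono) auto
    finally show "cnorm A (p u \<otimes> y \<otimes> p u) \<le> 2 * (real D + 1) * M" .
  qed simp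
qed

text \<open>A surviving monomial consists of walks from \<open>u\<close> and from \<open>u'\<close>
  to a common vertex; walks from the cycle vertex \<open>u\<close> have a way back, so
  \<open>u'\<close> would reach \<open>u\<close>.\<close>

lemma corner_disjoint_cycles:
  assumes u: "on_cycle u" "u \<in> verts G" and u': "on_cycle u'" "u' \<in> verts G"
    and no: "\<nexists>\<gamma>. awalk u' \<gamma> u" and y: "y \<in> mono_span E D"
  shows "p u \<otimes> y \<otimes> p u' = \<zero>"
  using y
proof (induction rule: mono_span.induct)
  case (step y x \<alpha> w x' \<beta> d)
  have "p u \<otimes> monomial \<alpha> w \<beta> \<otimes> p u' = (p u \<otimes> path_el \<alpha> w) \<otimes> (adj A (path_el \<beta> w) \<otimes> p u')"
    using step u u' by (simp add: monomial_def mult_assoc)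
  also have "\<dots> = \<zero>"
  proof (cases "x = u \<and> x' = u'")
    case True
    then obtain \<gamma> where "awalk w \<gamma> u" using on_cycle_walk(2)[OF u(1)] step by blast
    then have "awalk u' (\<beta> @ \<gamma>) u" using step True awalk_appendI by blast
    then show ?thesis using no by blast
  next
    case False
    then show ?thesis using step u u' by (auto simp: p_path adj_path_p)
  qed
  finally show ?case using step u u'
    by (simp add: mult_add_left mult_add_right mult_smult_left mult_smult_right)
qed (use u u' in simp)

text \<open>A walk from \<open>u'\<close> to \<open>u\<close> is unitary between the two corners,
  and conjugating by it carries \<open>p u\<close> to \<open>p u'\<close>.\<close>

lemma tame_cycle_cycle:
  assumes u: "on_cycle u" "u \<in> verts G" and u': "on_cycle u'" "u' \<in> verts G"
  shows "tame (cycle_closure F) (p u') (p u)"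
proof (cases "\<exists>\<gamma>. awalk u' \<gamma> u")
  case False
  then show ?thesis
    using corner_disjoint_cycles[OF u u'] on_cycle_walk(2)[OF u(1)] corner_disjoint_cycles[OF u' u]
    by (intro tame_null) blast
next
  case True
  then obtain \<gamma> where \<gamma>: "awalk u' \<gamma> u" by blast
  have "adj A (path_el \<gamma> u) \<in> mono_span (cycle_closure F) (length \<gamma>)"
    using span_path[OF \<gamma> on_cycle_walk_arcs[OF u'(1) \<gamma>]] by (rule span_adj)
  then have "tame (cycle_closure F) (path_el \<gamma> u \<otimes> p u \<otimes> adj A (path_el \<gamma> u)) (p u)"
    using u \<gamma> by (intro tame_mult_left[OF tame_cycle[OF u(1)]]) auto
  moreover have "path_el \<gamma> u \<otimes> p u \<otimes> adj A (path_el \<gamma> u) = p u'"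
    using path_p[OF \<gamma>] u path_adj_path_on_cycle[OF u'(1) \<gamma>] by simp
  ultimately show ?thesis by simp
qed

section \<open>Compressions by arbitrary vertex projections\<close>

context
  fixes F :: "'e set" assumes F: "finite F" "F \<subseteq> arcs G"
begin

text \<open>Induction along the edges of \<open>F\<close> off the cycles, which form a finite acyclic relation:
  \<open>p v\<close> is the gap at \<open>v\<close> plus the sum of \<open>s e \<otimes> p (head G e) \<otimes> adj A (s e)\<close> over the edges in \<open>F\<close>
  with source \<open>v\<close>.\<close>

lemma tame_vertex_induct:
  assumes r: "r \<in> carrier A"
    and gap: "\<And>v. v \<in> verts G \<Longrightarrow> \<not> on_cycle v \<Longrightarrow> tame (cycle_closure F) (gap F v) r"
    and cyc: "\<And>v. v \<in> verts G \<Longrightarrow> on_cycle v \<Longrightarrow> tame (cycle_closure F) (p v) r"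
    and v: "v \<in> verts G"
  shows "tame (cycle_closure F) (p v) r"
proof -
  define R where "R = {(head G e, tail G e) | e. e \<in> F \<and> \<not> on_cycle (tail G e)}"
  have "R = (\<lambda>e. (head G e, tail G e)) ` {e\<in>F. \<not> on_cycle (tail G e)}" by (auto simp: R_def)
  then have finR: "finite R" using F by simp
  have walk: "\<exists>\<gamma>. \<gamma> \<noteq> [] \<and> awalk b \<gamma> a" if "(a, b) \<in> R\<^sup>+" for a b
    using that
  proof (induction rule: trancl_induct)
    case (base b)
    then obtain e where "e \<in> F" "a = head G e" "b = tail G e" by (auto simp: R_def)
    then show ?case using arc_implies_awalk[of e] F by blast
  next
    case (step b c)
    then obtain e \<gamma> where "e \<in> F" "b = head G e" "c = tail G e" "awalk b \<gamma> a" by (auto simp: R_def)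
    then have "awalk c (e # \<gamma>) a" using F by (auto simp: awalk_simps)
    then show ?case by blast
  qed
  \<comment> \<open>A loop of \<open>R\<close> would put on a cycle the source of one of its edges,
    which \<open>R\<close> excludes.\<close>
  have "acyclic R"
  proof (rule acyclicI, rule allI, rule notI)
    fix a assume a: "(a, a) \<in> R\<^sup>+"
    then have "on_cycle a" using walk by (auto simp: on_cycle_def)
    moreover obtain b where "(b, a) \<in> R" using a by (metis tranclE)
    ultimately show False by (auto simp: R_def)
  qed
  then have wf: "wf R" using finR by (rule finite_acyclic_wf[rotated])
  show ?thesis using v
  proof (induction v rule: wf_induct_rule[OF wf])
    case (1 v)
    show ?case
    proof (cases "on_cycle v")
      case False
      let ?f = "\<lambda>e. s e \<otimes> adj A (s e)"
      have t: "tame (cycle_closure F) (\<Oplus>e\<in>F \<inter> out_arcs G v. ?f e) r"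
      proof (rule tame_finsum)
        fix e assume e: "e \<in> F \<inter> out_arcs G v"
        then have ea: "e \<in> arcs G" "tail G e = v" by auto
        then have "(head G e, v) \<in> R" using e False by (auto simp: R_def)
        then have "tame (cycle_closure F) (p (head G e)) r" using 1 ea by simp
        moreover have "adj A (s e) \<in> mono_span (cycle_closure F) 1"
          using e ea by (intro span_adj span_s) (auto simp: cycle_closure_def)
        ultimately have "tame (cycle_closure F) (s e \<otimes> p (head G e) \<otimes> adj A (s e)) r"
          using ea r by (intro tame_mult_left) auto
        then show "tame (cycle_closure F) (?f e) r" using ea by (simp add: s_p)
      qed (use F r in auto)
      have "tame (cycle_closure F) (gap F v \<oplus> (\<Oplus>e\<in>F \<inter> out_arcs G v. ?f e)) r"
        using gap[OF 1(2) False] t 1(2) r F by (intro tame_add) auto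
      moreover have "gap F v \<oplus> (\<Oplus>e\<in>F \<inter> out_arcs G v. ?f e) = p v"
        unfolding gap_def using 1(2) F by (intro minus_add_cancel) auto
      ultimately show ?thesis by simp
    qed (use cyc 1 in blast)
  qed
qed

text \<open>The induction moves only the left factor. It is run first with a gap or a cycle vertex
  on the right; adjoints turn the results into the base cases of a second run with
  \<open>p w\<close> on the right.\<close>

lemma tame_p_p:
  assumes "v \<in> verts G" "w \<in> verts G" shows "tame (cycle_closure F) (p v) (p w)"
proof -
  let ?E = "cycle_closure F"
  have gp: "tame ?E (gap F x) (p u)" if "x \<in> verts G" "\<not> on_cycle x" "on_cycle u" "u \<in> verts G" for x u
    using gap_span_p_null[OF F that] by (intro tame_null)
  have pg: "tame ?E (p u) (gap F x)" if "x \<in> verts G" "\<not> on_cycle x" "on_cycle u" "u \<in> verts G" for x u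
    using tame_adj[OF gp[OF that]] that F by simp
  have left_gap: "tame ?E (p v) (gap F x)" if "v \<in> verts G" "x \<in> verts G" "\<not> on_cycle x" for v x
    by (rule tame_vertex_induct[OF _ tame_gap_gap[OF F _ _ that(2,3)] pg[OF that(2,3)] that(1)])
      (use that F in auto)
  have left_cyc: "tame ?E (p v) (p u)" if "v \<in> verts G" "u \<in> verts G" "on_cycle u" for v u
    by (rule tame_vertex_induct[OF _ gp[OF _ _ that(3,2)] tame_cycle_cycle[OF that(3,2)] that(1)])
      (use that in auto)
  have 1: "tame ?E (gap F x) (p w)" if "x \<in> verts G" "\<not> on_cycle x" for x
    using tame_adj[OF left_gap[OF assms(2) that]] that assms F by simp
  have 2: "tame ?E (p u) (p w)" if "u \<in> verts G" "on_cycle u" for u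
    using tame_adj[OF left_cyc[OF assms(2) that]] that assms by simp
  show ?thesis using assms by (intro tame_vertex_induct[OF _ 1 2]) auto
qed

end

text \<open>The two sides are summed in turn, and the adjoint exchanges them in between.\<close>

lemma tame_unit:
  assumes F: "finite F" "F \<subseteq> arcs G" and V: "finite V" "V \<subseteq> verts G"
  shows "tame (cycle_closure F) (\<Oplus>v\<in>V. p v) (\<Oplus>v\<in>V. p v)"
proof -
  let ?one = "\<Oplus>v\<in>V. p v"
  have c: "?one \<in> carrier A" using V by (intro M.finsum_closed) auto
  have "adj A ?one = ?one" using V by (subst adj_finsum) (auto intro!: M.finsum_cong')
  moreover have "tame (cycle_closure F) ?one (p w)" if "w \<in> V" for w
    using V that tame_p_p[OF F] by (intro tame_finsum) auto
  then have "tame (cycle_closure F) (adj A (p w)) (adj A ?one)" if "w \<in> V" for w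
    using V c that by (intro tame_adj) auto
  ultimately have "tame (cycle_closure F) (p w) ?one" if "w \<in> V" for w using V that by (metis adj_p subsetD)
  then show ?thesis using V c by (intro tame_finsum) auto
qed

text \<open>One constant must serve all powers. A finite edge set and a local unit are therefore
  fixed for \<open>a\<close>; all iterated squares of \<open>h\<close> stay in the span of the same
  closure, and their degree doubles at each step.\<close>

theorem norm_le_of_seminorms:
  assumes a: "a \<in> mono_span (arcs G) d" and M: "0 \<le> M" "\<And>\<rho>. \<rho> \<in> S \<Longrightarrow> \<rho> a \<le> M"
  shows "cnorm A a \<le> M"
proof -
  obtain F where F: "finite F" "F \<subseteq> arcs G" "a \<in> mono_span F d" using span_finite_arcs[OF a] by blast
  let ?E = "cycle_closure F"
  have aE: "a \<in> mono_span ?E d" using F(3) by (rule span_mono) (auto simp: cycle_closure_def)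
  have ac [simp]: "a \<in> carrier A" using a by simp
  obtain V where V: "finite V" "V \<subseteq> verts G" "a \<otimes> (\<Oplus>v\<in>V. p v) = a" using span_unit[OF a] by blast
  let ?one = "\<Oplus>v\<in>V. p v"
  have c [simp]: "?one \<in> carrier A" using V by (intro M.finsum_closed) auto
  have one_adj: "adj A ?one = ?one" using V by (subst adj_finsum) (auto intro!: M.finsum_cong')
  define h where "h = adj A a \<otimes> a"
  have h [simp]: "h \<in> carrier A" "adj A h = h" by (simp_all add: h_def adj_mult adj_adj)
  have "h \<otimes> ?one = h" unfolding h_def using V(3) by (simp add: mult_assoc)
  moreover from arg_cong[OF this, of "adj A"] have "?one \<otimes> h = h" by (simp add: adj_mult one_adj)
  ultimately have "?one \<otimes> sq_iter h n = sq_iter h n \<and> sq_iter h n \<otimes> ?one = sq_iter h n" for n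
    by (induction n) (auto simp: mult_assoc, simp add: mult_assoc[symmetric])
  then have unit: "?one \<otimes> sq_iter h n \<otimes> ?one = sq_iter h n" for n by simp
  have span: "sq_iter h n \<in> mono_span ?E (2 * d * 2 ^ n)" for n
  proof (induction n)
    case 0
    have "h \<in> mono_span ?E (d + d)" unfolding h_def by (intro span_mult span_adj aE)
    then show ?case by (simp add: mult_2)
  next
    case (Suc n)
    have "sq_iter h n \<otimes> sq_iter h n \<in> mono_span ?E (2 * d * 2 ^ n + 2 * d * 2 ^ n)"
      by (intro span_mult Suc)
    moreover have "2 * d * 2 ^ n + 2 * d * 2 ^ n = 2 * d * 2 ^ Suc n" by simp
    ultimately show ?case by (simp only: sq_iter.simps)
  qed
  have norm_h: "cnorm A h = (cnorm A a)\<^sup>2" unfolding h_def by (simp add: norm_cstar)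
  obtain K where K: "0 \<le> K" "\<And>D y M. \<lbrakk>y \<in> mono_span ?E D; 0 \<le> M; \<And>\<rho>. \<rho> \<in> S \<Longrightarrow> \<rho> y \<le> M\<rbrakk> \<Longrightarrow>
    cnorm A (?one \<otimes> y \<otimes> ?one) \<le> K * (real D + 1) * M"
    using tame_unit[OF F(1,2) V(1,2)] by (rule tameE) blast
  have "cnorm A h \<le> M\<^sup>2"
  proof (rule le_if_power_le_linear)
    fix n
    have "\<rho> (sq_iter h n) \<le> (M\<^sup>2) ^ (2 ^ n)" if "\<rho> \<in> S" for \<rho>
    proof -
      have "\<rho> h = (\<rho> a)\<^sup>2" unfolding h_def by (rule seminorm_cstar[OF S[OF that] ac])
      also have "\<dots> \<le> M\<^sup>2" using M(2)[OF that] seminorm_nonneg[OF S[OF that] ac] by (intro power_mono)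
      finally show ?thesis
        using seminorm_nonneg[OF S[OF that] h(1)] by (simp add: seminorm_sq_iter[OF S[OF that]] power_mono)
    qed
    then have "cnorm A (?one \<otimes> sq_iter h n \<otimes> ?one) \<le> K * (real (2 * d * 2 ^ n) + 1) * (M\<^sup>2) ^ (2 ^ n)"
      using M(1) by (intro K span) auto
    then show "cnorm A h ^ (2 ^ n) \<le> K * (real (2 * d) * 2 ^ n + 1) * (M\<^sup>2) ^ (2 ^ n)"
      unfolding unit by (simp add: norm_sq_iter)
  qed simp
  then show ?thesis unfolding norm_h using M(1) by (rule power2_le_imp_le)
qed

lemma span_closure_subalgebra:
  "cstar_subalgebra A {a \<in> carrier A. \<forall>\<epsilon>>0. \<exists>D. \<exists>y\<in>mono_span (arcs G) D. cnorm A (a \<ominus> y) < \<epsilon>}"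
  (is "cstar_subalgebra A ?C")
proof -
  let ?L = "mono_span (arcs G)"
  have approx: "\<exists>D. \<exists>y\<in>?L D. cnorm A (a \<ominus> y) < \<epsilon>" if "a \<in> ?C" "\<epsilon> > 0" for a \<epsilon>
    using that by blast
  show ?thesis
    unfolding cstar_subalgebra_def
  proof (intro conjI ballI allI impI)
    show "\<zero> \<in> ?C" by (auto intro!: exI[of _ 0] bexI[of _ \<zero>] mono_span.zero)
    fix a assume a: "a \<in> ?C"
    then have ac: "a \<in> carrier A" by blast
    show "adj A a \<in> ?C"
    proof (intro CollectI conjI allI impI)
      fix \<epsilon> :: real assume "\<epsilon> > 0"
      then obtain D y where y: "y \<in> ?L D" "cnorm A (a \<ominus> y) < \<epsilon>" using approx[OF a] by blast
      have "cnorm A (adj A a \<ominus> adj A y) < \<epsilon>"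
        using y ac norm_adj[of "a \<ominus> y"] by (simp add: adj_minus)
      then show "\<exists>D. \<exists>y\<in>?L D. cnorm A (adj A a \<ominus> y) < \<epsilon>" using span_adj[OF y(1)] by blast
    qed (use ac in simp)
    show "c \<odot> a \<in> ?C" for c
    proof (intro CollectI conjI allI impI)
      fix \<epsilon> :: real assume e: "\<epsilon> > 0"
      then have "\<epsilon> / (cmod c + 1) > 0" by (simp add: add_nonneg_pos)
      then obtain D y where y: "y \<in> ?L D" "cnorm A (a \<ominus> y) < \<epsilon> / (cmod c + 1)" using approx[OF a] by blast
      have pos: "cmod c + 1 > 0" by (simp add: add_nonneg_pos)
      have "cnorm A (c \<odot> a \<ominus> c \<odot> y) = cmod c * cnorm A (a \<ominus> y)"
        using y ac by (simp add: smult_minus[symmetric] norm_smult)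
      also have "\<dots> \<le> (cmod c + 1) * cnorm A (a \<ominus> y)"
        using norm_nonneg[of "a \<ominus> y"] ac y by (intro mult_right_mono) auto
      also have "\<dots> < \<epsilon>" using y(2) pos by (simp add: field_simps)
      finally show "\<exists>D. \<exists>y\<in>?L D. cnorm A (c \<odot> a \<ominus> y) < \<epsilon>" using span_smult[OF y(1)] by blast
    qed (use ac in simp)
    fix b assume b: "b \<in> ?C"
    then have bc: "b \<in> carrier A" by blast
    show "a \<oplus> b \<in> ?C"
    proof (intro CollectI conjI allI impI)
      fix \<epsilon> :: real assume "\<epsilon> > 0"
      then obtain D y D' z where y: "y \<in> ?L D" "cnorm A (a \<ominus> y) < \<epsilon> / 2"
        and z: "z \<in> ?L D'" "cnorm A (b \<ominus> z) < \<epsilon> / 2" using approx[OF a] approx[OF b] by (metis half_gt_zero)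
      have "y \<oplus> z \<in> ?L (D + D')" using y z by (intro span_add) (auto intro: span_mono)
      moreover have "cnorm A ((a \<oplus> b) \<ominus> (y \<oplus> z)) < \<epsilon>"
        using y z ac bc norm_triangle[of "a \<ominus> y" "b \<ominus> z"] by (simp add: add_minus_add)
      ultimately show "\<exists>D. \<exists>y\<in>?L D. cnorm A (a \<oplus> b \<ominus> y) < \<epsilon>" by blast
    qed (use ac bc in simp)
    show "a \<otimes> b \<in> ?C"
    proof (intro CollectI conjI allI impI)
      fix \<epsilon> :: real assume e: "\<epsilon> > 0"
      have na: "0 \<le> cnorm A a" using ac by (rule norm_nonneg)
      then have e1: "\<epsilon> / (2 * (cnorm A a + 1)) > 0" using e by simp
      \<comment> \<open>The approximant of \<open>b\<close> is chosen first, because the precision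
        required for \<open>a\<close> depends on the norm of \<open>z\<close>; adding 1 avoids
        division by 0.\<close>
      obtain D' z where z: "z \<in> ?L D'" "cnorm A (b \<ominus> z) < \<epsilon> / (2 * (cnorm A a + 1))"
        using approx[OF b e1] by blast
      have nz: "0 \<le> cnorm A z" using z by (intro norm_nonneg) auto
      then have e2: "\<epsilon> / (2 * (cnorm A z + 1)) > 0" using e by simp
      obtain D y where y: "y \<in> ?L D" "cnorm A (a \<ominus> y) < \<epsilon> / (2 * (cnorm A z + 1))"
        using approx[OF a e2] by blast
      have "cnorm A (a \<otimes> b \<ominus> y \<otimes> z) \<le> cnorm A (a \<otimes> b \<ominus> a \<otimes> z) + cnorm A (a \<otimes> z \<ominus> y \<otimes> z)"
        using ac bc y z by (intro norm_minus_triangle) auto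
      also have "\<dots> = cnorm A (a \<otimes> (b \<ominus> z)) + cnorm A ((a \<ominus> y) \<otimes> z)"
        using ac bc y z by (simp add: mult_minus_left mult_minus_right)
      also have "\<dots> \<le> cnorm A a * cnorm A (b \<ominus> z) + cnorm A (a \<ominus> y) * cnorm A z"
        using ac bc y z by (intro add_mono norm_mult) auto
      also have "\<dots> \<le> (cnorm A a + 1) * cnorm A (b \<ominus> z) + cnorm A (a \<ominus> y) * (cnorm A z + 1)"
        using ac bc y z by (intro add_mono mult_right_mono mult_left_mono) (auto intro: norm_nonneg)
      also have "\<dots> < \<epsilon> / 2 + \<epsilon> / 2"
        using y(2) z(2) na nz by (intro add_strict_mono) (auto simp: field_simps add_nonneg_pos)
      finally have "cnorm A (a \<otimes> b \<ominus> y \<otimes> z) < \<epsilon>" by simp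
      then show "\<exists>D. \<exists>y\<in>?L D. cnorm A (a \<otimes> b \<ominus> y) < \<epsilon>" using span_mult[OF y(1) z(1)] by blast
    qed (use ac bc in simp)
  next
    fix w a assume a: "a \<in> carrier A" and w: "range w \<subseteq> ?C \<and> cstar_limit A w a"
    show "a \<in> ?C"
    proof (intro CollectI conjI allI impI a)
      fix \<epsilon> :: real assume "\<epsilon> > 0"
      then obtain n where n: "norm (cnorm A (w n \<ominus> a) - 0) < \<epsilon> / 2"
        using w LIMSEQ_D[of "\<lambda>n. cnorm A (w n \<ominus> a)" 0 "\<epsilon> / 2"] by (auto simp: cstar_limit_def)
      have wn: "w n \<in> ?C" using w by blast
      then obtain D y where y: "y \<in> ?L D" "cnorm A (w n \<ominus> y) < \<epsilon> / 2"
        using approx[OF wn, of "\<epsilon> / 2"] \<open>\<epsilon> > 0\<close> by auto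
      have "cnorm A (a \<ominus> y) \<le> cnorm A (a \<ominus> w n) + cnorm A (w n \<ominus> y)"
        using a wn y by (intro norm_minus_triangle) auto
      also have "\<dots> < \<epsilon>" using n y wn a norm_minus_commute[of a "w n"] by simp
      finally show "\<exists>D. \<exists>y\<in>?L D. cnorm A (a \<ominus> y) < \<epsilon>" using y by blast
    qed
  qed auto
qed

text \<open>The estimate is available only on the span, which is dense. An approximant within half
  the norm of \<open>a\<close> has all seminorms at most that half, because they are dominated by
  the norm; so its norm is at most that half as well, and \<open>a\<close> would have norm less than
  itself.\<close>

theorem eq_zero_if_seminorms_vanish:
  assumes gen: "cstar_generated_by A (p ` verts G \<union> s ` arcs G)"
    and a: "a \<in> carrier A" "\<And>\<rho>. \<rho> \<in> S \<Longrightarrow> \<rho> a = 0"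
  shows "a = \<zero>"
proof (rule ccontr)
  assume "a \<noteq> \<zero>"
  then have na: "cnorm A a > 0" using a norm_nonneg[of a] norm_eq_0_iff[of a] by simp
  let ?C = "{a \<in> carrier A. \<forall>\<epsilon>>0. \<exists>D. \<exists>y\<in>mono_span (arcs G) D. cnorm A (a \<ominus> y) < \<epsilon>}"
  have "p ` verts G \<union> s ` arcs G \<subseteq> ?C"
  proof
    fix x assume x: "x \<in> p ` verts G \<union> s ` arcs G"
    then have "x \<in> mono_span (arcs G) 1" using span_p span_s by auto
    then show "x \<in> ?C" by (auto intro!: exI[of _ 1] bexI[of _ x])
  qed
  then have "?C = carrier A"
    using gen span_closure_subalgebra unfolding cstar_generated_by_def by blast
  with a(1) have "a \<in> ?C" by simp
  then obtain D y where y: "y \<in> mono_span (arcs G) D" "cnorm A (a \<ominus> y) < cnorm A a / 2"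
    using half_gt_zero[OF na] by blast
  have "\<rho> y \<le> cnorm A a / 2" if "\<rho> \<in> S" for \<rho>
  proof -
    have "y = a \<ominus> (a \<ominus> y)"
      using a y by (simp add: minus_conv smult_add_right smult_smult M.a_assoc[symmetric])
        (simp add: M.r_neg uminus_conv[symmetric])
    then have "\<rho> y \<le> \<rho> a + \<rho> (a \<ominus> y)"
      using seminorm_minus_le[OF S[OF that], of a "a \<ominus> y"] a y by simp
    also have "\<dots> \<le> cnorm A (a \<ominus> y)" using seminorm_le[OF S[OF that], of "a \<ominus> y"] a(1) a(2)[OF that] y by simp
    finally show ?thesis using y by simp
  qed
  then have "cnorm A y \<le> cnorm A a / 2" using na by (intro norm_le_of_seminorms[OF y(1)]) auto
  moreover have "cnorm A a \<le> cnorm A (a \<ominus> y) + cnorm A y" using a y by (intro norm_le_minus) auto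
  ultimately show False using y by simp
qed

end

section \<open>Representations from branching systems\<close>

definition unit_op :: "nat \<Rightarrow> nat \<Rightarrow> nat \<Rightarrow> nat \<Rightarrow> complex" where
  "unit_op a b = (\<lambda>i j. if i = a \<and> j = b then 1 else 0)"

lemma (in branching_system) rep_s_unit:
  assumes B: "countable B" and e: "e \<in> arcs G" "x \<in> B" "src x = head G e"
  shows "op_mult (ent (rep_s e)) (unit_op (to_nat_on B x) b)
    = (\<lambda>i j. wt e x * unit_op (to_nat_on B (act e x)) b i j)"
proof (intro ext)
  fix i j
  have x: "from_nat_into B (to_nat_on B x) = x" using B e(2) by (rule from_nat_into_to_nat_on)
  have "to_nat_on B x \<in> proj_at (head G e)" using e by (auto simp: proj_at_def)
  then show "op_mult (ent (rep_s e)) (unit_op (to_nat_on B x) b) i j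
    = wt e x * unit_op (to_nat_on B (act e x)) b i j"
    by (subst op_mult_single[where a = "to_nat_on B x"])
      (auto simp: unit_op_def rep_s_def wperm_def nat_act_def x)
qed

lemma (in branching_system) rep_p_unit:
  assumes "{y\<in>B. src y = src x} = {x}"
  shows "ent (rep_p (src x)) = unit_op (to_nat_on B x) (to_nat_on B x)"
  using assms by (auto simp: rep_p_def proj_at_def unit_op_def diag_op_def fun_eq_iff)

lemma star_hom_seminorm:
  assumes A: "cstar_algebra A" and \<phi>: "star_hom A (Bop I) \<phi>"
  shows "cstar_seminorm A (\<lambda>x. op_norm (ent (\<phi> x)))"
proof -
  interpret A: cstar_algebra A by (rule A)
  have b: "bounded_op (ent (\<phi> y))" if "y \<in> carrier A" for y
    using \<phi> that by (auto simp: star_hom_def Bop_simps)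
  show ?thesis
    using \<phi> b unfolding cstar_seminorm_def
    by (auto simp: star_hom_def Bop_simps op_norm_nonneg op_norm_add op_norm_smult op_norm_mult
        op_norm_cstar star_hom_Bop_contractive[OF A \<phi>] A.adj_closed)
qed

lemma star_hom_zero:
  assumes A: "cstar_algebra A" and \<phi>: "star_hom A (Bop I) \<phi>"
  shows "\<phi> \<zero>\<^bsub>A\<^esub> = \<zero>\<^bsub>Bop I\<^esub>"
proof -
  interpret A: cstar_algebra A by (rule A)
  have "\<phi> (0 \<odot>\<^bsub>A\<^esub> \<zero>\<^bsub>A\<^esub>) = 0 \<odot>\<^bsub>Bop I\<^esub> \<phi> \<zero>\<^bsub>A\<^esub>"
    using \<phi> A.M.zero_closed unfolding star_hom_def by blast
  then show ?thesis by (simp add: Bop_simps)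
qed

lemma graph_cstar_rep:
  assumes G: "graph_cstar_algebra G A p s" and br: "branching_system G B src act wt" and B: "countable B"
  obtains \<phi> where "star_hom A (Bop (to_nat_on B ` B)) \<phi>"
    "\<And>v. v \<in> verts G \<Longrightarrow> \<phi> (p v) = branching_system.rep_p B src v"
    "\<And>e. e \<in> arcs G \<Longrightarrow> \<phi> (s e) = branching_system.rep_s G B src act wt e"
  using branching_system.rep_ck_family[OF br B] cstar_algebra_Bop G
  unfolding graph_cstar_algebra_def by metis

text \<open>The branching system has basis \<open>verts G \<times> \<nat>\<close>; at each vertex \<open>u\<close> that emits edges, \<open>\<nat>\<close> is
  identified with \<open>out_arcs G u \<times> \<nat>\<close>.\<close>

lemma vertex_projection_nonzero:
  assumes G: "graph_cstar_algebra G A p s" and c: "countable_digraph G" and v: "v \<in> verts G"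
  shows "p v \<noteq> \<zero>\<^bsub>A\<^esub>"
proof
  assume z: "p v = \<zero>\<^bsub>A\<^esub>"
  interpret countable_digraph G by (rule c)
  define B where "B = verts G \<times> (UNIV :: nat set)"
  define D where "D = (\<lambda>u. out_arcs G u \<times> (UNIV :: nat set))"
  define act where "act = (\<lambda>e (x :: 'a \<times> nat). (tail G e, to_nat_on (D (tail G e)) (e, snd x)))"
  have cD: "countable (D u)" for u
    unfolding D_def using countable_arcs by (intro countable_SIGMA) (auto intro: countable_subset simp: out_arcs_def)
  \<comment> \<open>The coding is a bijection at each vertex that emits edges: injectivity makes the
    ranges of distinct edges disjoint, surjectivity makes them fill the vertex.\<close>
  have bij: "bij_betw (to_nat_on (D u)) (D u) UNIV" if "out_arcs G u \<noteq> {}" for u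
    using cD that by (intro to_nat_on_infinite) (auto simp: D_def finite_cartesian_product_iff)
  interpret br: branching_system G B fst act "\<lambda>_ _. 1"
  proof
    fix e f x y assume e: "e \<in> arcs G" "f \<in> arcs G" and xy: "x \<in> B" "y \<in> B" "fst x = head G e" "fst y = head G f"
      and eq: "act e x = act f y"
    have t: "tail G e = tail G f" using eq by (simp add: act_def)
    have "inj_on (to_nat_on (D (tail G e))) (D (tail G e))" using cD by (rule inj_on_to_nat_on)
    then have "(e, snd x) = (f, snd y)"
      by (rule inj_onD) (use eq t e in \<open>auto simp: act_def D_def\<close>)
    then show "e = f \<and> x = y" using xy by (auto intro: prod_eqI)
  next
    fix x assume x: "x \<in> B" "out_arcs G (fst x) \<noteq> {}"
    have "snd x \<in> to_nat_on (D (fst x)) ` D (fst x)"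
      using bij[OF x(2)] by (simp add: bij_betw_def)
    then obtain e n where en: "e \<in> out_arcs G (fst x)" "snd x = to_nat_on (D (fst x)) (e, n)"
      by (auto simp: D_def)
    then have "act e (head G e, n) = x" by (auto simp: act_def intro: prod_eqI)
    moreover have "(head G e, n) \<in> B" using en by (auto simp: B_def)
    ultimately show "\<exists>e\<in>arcs G. \<exists>y\<in>B. fst y = head G e \<and> act e y = x"
      using en by (intro bexI[of _ e] bexI[of _ "(head G e, n)"]) auto
  qed (auto simp: act_def B_def)
  have cB: "countable B" unfolding B_def using countable_verts by (intro countable_SIGMA) auto
  obtain \<phi> where \<phi>: "star_hom A (Bop (to_nat_on B ` B)) \<phi>"
    "\<And>v. v \<in> verts G \<Longrightarrow> \<phi> (p v) = br.rep_p v" "\<And>e. e \<in> arcs G \<Longrightarrow> \<phi> (s e) = br.rep_s e"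
    using graph_cstar_rep[OF G br.branching_system_axioms cB] by blast
  have "cstar_algebra A" using G by (simp add: graph_cstar_algebra_def)
  then have "br.rep_p v = \<zero>\<^bsub>Bop (to_nat_on B ` B)\<^esub>" using star_hom_zero[OF _ \<phi>(1)] \<phi>(2)[OF v] z by simp
  moreover have "(v, 0) \<in> B" using v by (simp add: B_def)
  ultimately show False using br.rep_p_nonzero[OF cB, of "(v, 0)" "to_nat_on B ` B"] by simp
qed

text \<open>\<open>p w\<close> acts with rank one, on the empty walk. The path element of a first
  walk \<open>\<nu>\<close> carries the empty walk to \<open>\<nu>\<close>, and the edge closing the
  loop brings it back with weight \<open>z\<close>; so the loop acts as \<open>z\<close> times
  \<open>p w\<close>.\<close>

lemma first_walk_rep:
  assumes G: "graph_cstar_algebra G A p s" and x: "exitless_digraph G"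
    and w: "w \<in> verts G" "out_arcs G w = {} \<or> infinite (out_arcs G w) \<or> wf_digraph.on_cycle G w"
    and fin: "finite (wf_digraph.first_walks G w)" and z: "cmod z = 1"
  obtains I \<phi> where "finite I" "star_hom A (Bop I) \<phi>" "op_norm (ent (\<phi> (p w))) \<noteq> 0"
    "\<And>e \<nu>. \<lbrakk>pre_digraph.awalk G w (e # \<nu>) w; w \<notin> tail G ` set \<nu>\<rbrakk> \<Longrightarrow>
      op_norm (ent (\<phi> (ck_algebra.path_el A p s (e # \<nu>) w \<ominus>\<^bsub>A\<^esub> z \<odot>\<^bsub>A\<^esub> p w))) = 0"
proof -
  interpret exitless_digraph G by (rule x)
  interpret cstar_algebra A using G by (simp add: graph_cstar_algebra_def)
  interpret ck_algebra G A p s using G by unfold_locales (simp add: graph_cstar_algebra_def)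
  let ?B = "first_walks w"
  have cB: "countable ?B" using fin by (rule countable_finite)
  interpret br: branching_system G ?B "walk_source w" "\<lambda>e \<mu>. if tail G e = w then [] else e # \<mu>"
    "\<lambda>e \<mu>. if tail G e = w then z else 1"
    by (rule branching_first_walks[OF w z])
  let ?I = "to_nat_on ?B ` ?B" and ?n = "to_nat_on ?B"
  obtain \<phi> where \<phi>: "star_hom A (Bop ?I) \<phi>" "\<And>v. v \<in> verts G \<Longrightarrow> \<phi> (p v) = br.rep_p v"
    "\<And>e. e \<in> arcs G \<Longrightarrow> \<phi> (s e) = br.rep_s e"
    using graph_cstar_rep[OF G br.branching_system_axioms cB] by blast
  interpret Bp: cstar_algebra "Bop ?I" by (rule cstar_algebra_Bop)
  have nil: "[] \<in> ?B" "walk_source w [] = w" using w by (auto simp: first_walks_def walk_source_def awalk_simps)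
  \<comment> \<open>A nonempty first walk never starts at \<open>w\<close>.\<close>
  have only: "{\<mu>\<in>?B. walk_source w \<mu> = walk_source w []} = {[]}"
    using nil by (auto simp: walk_source_def first_walks_def)
  have pw: "ent (\<phi> (p w)) = unit_op (?n []) (?n [])"
    using br.rep_p_unit[OF only] \<phi>(2)[OF w(1)] nil(2) by simp
  have hom: "\<phi> (a \<otimes>\<^bsub>A\<^esub> b) = \<phi> a \<otimes>\<^bsub>Bop ?I\<^esub> \<phi> b" if "a \<in> carrier A" "b \<in> carrier A" for a b
    using \<phi>(1) that by (simp add: star_hom_def)
  have path: "ent (\<phi> (path_el \<nu> w)) = unit_op (?n \<nu>) (?n [])"
    if "awalk v \<nu> w" "w \<notin> tail G ` set \<nu>" for v \<nu>
    using that
  proof (induction \<nu> arbitrary: v)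
    case (Cons e \<nu>)
    then have e: "e \<in> arcs G" "awalk (head G e) \<nu> w" "tail G e \<noteq> w" "w \<notin> tail G ` set \<nu>"
      by (auto simp: awalk_simps)
    have "\<nu> \<in> ?B" using e by (auto simp: first_walks_def)
    moreover have "walk_source w \<nu> = head G e" using awalk_source[OF e(2)] by simp
    ultimately show ?case
      using Cons.IH[OF e(2,4)] br.rep_s_unit[OF cB e(1), of \<nu> "?n []"] e \<phi>(3)[OF e(1)]
      by (simp add: hom Bop_simps)
  qed (simp add: pw)
  show ?thesis
  proof (rule that[OF _ \<phi>(1)])
    show "finite ?I" using fin by simp
    have pc: "\<phi> (p w) \<in> carrier (Bop ?I)" using \<phi>(1) w by (simp add: star_hom_def)
    have "\<phi> (p w) \<noteq> \<zero>\<^bsub>Bop ?I\<^esub>" using br.rep_p_nonzero[OF cB nil(1)] \<phi>(2)[OF w(1)] nil(2) by simp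
    then show "op_norm (ent (\<phi> (p w))) \<noteq> 0" using Bp.norm_eq_0_iff[OF pc] by (simp add: Bop_simps(7))
    fix e \<nu> assume "awalk w (e # \<nu>) w" "w \<notin> tail G ` set \<nu>"
    then have e: "e \<in> arcs G" "tail G e = w" "awalk (head G e) \<nu> w" "w \<notin> tail G ` set \<nu>"
      by (auto simp: awalk_simps)
    have "\<nu> \<in> ?B" using e by (auto simp: first_walks_def)
    moreover have "walk_source w \<nu> = head G e" using awalk_source[OF e(3)] by simp
    ultimately have "ent (\<phi> (path_el (e # \<nu>) w)) = (\<lambda>i j. z * ent (\<phi> (p w)) i j)"
      using path[OF e(3,4)] br.rep_s_unit[OF cB e(1), of \<nu> "?n []"] e \<phi>(3)[OF e(1)]
      by (simp add: hom Bop_simps pw)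
    then have eq: "\<phi> (path_el (e # \<nu>) w) = z \<odot>\<^bsub>Bop ?I\<^esub> \<phi> (p w)"
      by (metis Bop_simps(5) mk_ent)
    have c: "path_el (e # \<nu>) w \<in> carrier A" using e by simp
    have "\<phi> (path_el (e # \<nu>) w \<ominus>\<^bsub>A\<^esub> z \<odot>\<^bsub>A\<^esub> p w)
        = \<phi> (path_el (e # \<nu>) w) \<oplus>\<^bsub>Bop ?I\<^esub> (-1) \<odot>\<^bsub>Bop ?I\<^esub> (z \<odot>\<^bsub>Bop ?I\<^esub> \<phi> (p w))"
      using \<phi>(1) c w by (simp add: minus_conv star_hom_def del: path_el.simps)
    also have "\<dots> = \<zero>\<^bsub>Bop ?I\<^esub>"
      unfolding eq using pc by (simp add: Bp.minus_conv[symmetric])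
    finally show "op_norm (ent (\<phi> (path_el (e # \<nu>) w \<ominus>\<^bsub>A\<^esub> z \<odot>\<^bsub>A\<^esub> p w))) = 0"
      by (simp add: Bop_simps)
  qed
qed

section \<open>From operators on finite index sets to matrices\<close>

lemma mat_adjoint_index:
  fixes M :: "complex mat"
  assumes "M \<in> carrier_mat n n" "i < n" "j < n"
  shows "mat_adjoint M $$ (i, j) = cnj (M $$ (j, i))"
  using assms by (simp add: mat_adjoint_def mat_of_rows_index)

text \<open>All entries outside a large enough square vanish, so truncation loses nothing and turns
  the product series into matrix products.\<close>

lemma fd_representation_of_star_hom:
  assumes \<phi>: "star_hom A (Bop I) \<phi>" and I: "finite I"
  obtains n \<pi> where "fd_representation A n \<pi>"
    "\<And>x. x \<in> carrier A \<Longrightarrow> \<phi> x \<noteq> \<zero>\<^bsub>Bop I\<^esub> \<Longrightarrow> \<pi> x \<noteq> 0\<^sub>m n n"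
proof -
  obtain n where n: "I \<subseteq> {..<n}" using I by (meson finite_nat_iff_bounded)
  define \<pi> where "\<pi> = (\<lambda>x. mat n n (\<lambda>(i, j). ent (\<phi> x) i j))"
  have mem: "supported_on I (ent (\<phi> x))" if "x \<in> carrier A" for x
    using \<phi> that by (simp add: star_hom_def Bop_simps)
  have out: "ent (\<phi> x) i j = 0" if "x \<in> carrier A" "\<not> (i < n \<and> j < n)" for x i j
    using mem[OF that(1)] n that(2) unfolding supported_on_def by blast
  have mult: "op_mult (ent (\<phi> x)) (ent (\<phi> y)) i j = (\<Sum>k<n. ent (\<phi> x) i k * ent (\<phi> y) k j)"
    if "x \<in> carrier A" "y \<in> carrier A" for x y i j
    unfolding op_mult_def using out[OF that(1)] by (intro suminf_finite) auto
  have "fd_representation A n \<pi>"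
    unfolding fd_representation_def
  proof (intro conjI ballI allI)
    fix x assume x: "x \<in> carrier A"
    show "\<pi> x \<in> carrier_mat n n" by (simp add: \<pi>_def)
    show "\<pi> (c \<odot>\<^bsub>A\<^esub> x) = c \<cdot>\<^sub>m \<pi> x" for c
      using \<phi> x by (intro eq_matI) (auto simp: \<pi>_def star_hom_def Bop_simps)
    show "\<pi> (adj A x) = mat_adjoint (\<pi> x)"
    proof (rule eq_matI)
      show "dim_row (\<pi> (adj A x)) = dim_row (mat_adjoint (\<pi> x))"
        "dim_col (\<pi> (adj A x)) = dim_col (mat_adjoint (\<pi> x))"
        by (simp_all add: \<pi>_def mat_adjoint_def)
      fix i j assume "i < dim_row (mat_adjoint (\<pi> x))" "j < dim_col (mat_adjoint (\<pi> x))"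
      then have ij: "i < n" "j < n" by (simp_all add: \<pi>_def mat_adjoint_def)
      then show "\<pi> (adj A x) $$ (i, j) = mat_adjoint (\<pi> x) $$ (i, j)"
        using \<phi> x by (subst mat_adjoint_index[where n = n]) (auto simp: \<pi>_def star_hom_def Bop_simps op_adj_def)
    qed
    fix y assume y: "y \<in> carrier A"
    show "\<pi> (x \<oplus>\<^bsub>A\<^esub> y) = \<pi> x + \<pi> y"
      using \<phi> x y by (intro eq_matI) (auto simp: \<pi>_def star_hom_def Bop_simps)
    show "\<pi> (x \<otimes>\<^bsub>A\<^esub> y) = \<pi> x * \<pi> y"
      using \<phi> x y mult[OF x y]
      by (intro eq_matI) (auto simp: \<pi>_def star_hom_def Bop_simps scalar_prod_def lessThan_atLeast0)
  qed
  moreover have "\<pi> x \<noteq> 0\<^sub>m n n" if x: "x \<in> carrier A" "\<phi> x \<noteq> \<zero>\<^bsub>Bop I\<^esub>" for x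
  proof
    assume z: "\<pi> x = 0\<^sub>m n n"
    have "ent (\<phi> x) i j = 0" for i j
    proof (cases "i < n \<and> j < n")
      case True
      then have "\<pi> x $$ (i, j) = 0" using z by simp
      then show ?thesis using True by (simp add: \<pi>_def)
    qed (use out x in blast)
    then have "ent (\<phi> x) = (\<lambda>i j. 0)" by blast
    then have "\<phi> x = mk (\<lambda>i j. 0)" by (metis mk_ent)
    then show False using x by (simp add: Bop_simps)
  qed
  ultimately show ?thesis using that by blast
qed

lemma RFD_if_graph_conditions:
  assumes c: "countable_digraph G" and G: "graph_cstar_algebra G A p s"
    and recv: "\<not> (\<exists>v. infinite_receiver G v)"
    and exit: "\<not> (\<exists>\<mu>. graph_cycle G \<mu> \<and> has_exit G \<mu>)"
    and chain: "\<not> (\<exists>I e. infinite_backward_chain G I e)"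
    and ends: "\<forall>v\<in>verts G. \<exists>\<nu> w. pre_digraph.awalk G v \<nu> w \<and>
       (sink G w \<or> (\<exists>\<mu>. graph_cycle G \<mu> \<and> w \<in> cycle_verts G \<mu>) \<or> infinite_emitter G w)"
  shows "RFD A"
proof -
  interpret countable_digraph G by (rule c)
  have xG: "exitless_digraph G" using exit by unfold_locales blast
  interpret exitless_digraph G by (rule xG)
  have A: "cstar_algebra A" using G by (simp add: graph_cstar_algebra_def)
  interpret cstar_algebra A by (rule A)
  interpret ck_algebra G A p s using G by unfold_locales (simp add: graph_cstar_algebra_def)
  define S where "S = {(\<lambda>x. op_norm (ent (\<phi> x))) | I \<phi>. finite I \<and> star_hom A (Bop I) \<phi>}"
  have fin: "finite (first_walks w)" if "w \<in> verts G" for w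
    using that recv by (intro finite_first_walks[OF _ chain]) (auto simp: infinite_receiver_def)
  have sn: "cstar_seminorm A \<rho>" if "\<rho> \<in> S" for \<rho>
    using that star_hom_seminorm[OF A] by (auto simp: S_def)
  have end_rep: "\<exists>\<rho>\<in>S. \<rho> (p w) \<noteq> 0 \<and> (\<forall>e \<nu>. awalk w (e # \<nu>) w \<longrightarrow> w \<notin> tail G ` set \<nu> \<longrightarrow>
        \<rho> (path_el (e # \<nu>) w \<ominus>\<^bsub>A\<^esub> z \<odot>\<^bsub>A\<^esub> p w) = 0)"
    if w: "w \<in> verts G" "out_arcs G w = {} \<or> infinite (out_arcs G w) \<or> on_cycle w" and z: "cmod z = 1" for w z
  proof -
    obtain I \<phi> where \<phi>: "finite I" "star_hom A (Bop I) \<phi>" "op_norm (ent (\<phi> (p w))) \<noteq> 0"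
      "\<And>e \<nu>. \<lbrakk>awalk w (e # \<nu>) w; w \<notin> tail G ` set \<nu>\<rbrakk> \<Longrightarrow>
        op_norm (ent (\<phi> (path_el (e # \<nu>) w \<ominus>\<^bsub>A\<^esub> z \<odot>\<^bsub>A\<^esub> p w))) = 0"
      using first_walk_rep[OF G xG w fin[OF w(1)] z] by blast
    then show ?thesis by (intro bexI[of _ "\<lambda>x. op_norm (ent (\<phi> x))"]) (auto simp: S_def)
  qed
  interpret exitless_ck_algebra G A p s S
  proof
    fix v assume v: "v \<in> verts G"
    then obtain \<nu> w where w: "awalk v \<nu> w"
      "sink G w \<or> (\<exists>\<mu>. graph_cycle G \<mu> \<and> w \<in> cycle_verts G \<mu>) \<or> infinite_emitter G w"
      using ends by blast
    then have "out_arcs G w = {} \<or> infinite (out_arcs G w) \<or> on_cycle w"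
      using graph_cycle_on_cycle by (auto simp: sink_def infinite_emitter_def)
    then obtain \<rho> where \<rho>: "\<rho> \<in> S" "\<rho> (p w) \<noteq> 0"
      using end_rep[of w 1] w(1) by (metis awalk_last_in_verts norm_one)
    have wv: "w \<in> verts G" using w(1) by blast
    have "\<rho> (p v) \<noteq> 0"
    proof
      assume z: "\<rho> (p v) = 0"
      \<comment> \<open>The walk compresses \<open>p v\<close> to \<open>p w\<close>, so a seminorm
        that sees the end of the walk sees its start.\<close>
      have eq: "p w = adj A (path_el \<nu> w) \<otimes>\<^bsub>A\<^esub> (p v \<otimes>\<^bsub>A\<^esub> path_el \<nu> w)"
        using p_path[OF w(1) v] adj_path_path[OF w(1)] by simp
      have "\<rho> (p w) \<le> \<rho> (adj A (path_el \<nu> w)) * \<rho> (p v \<otimes>\<^bsub>A\<^esub> path_el \<nu> w)"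
        unfolding eq using w v by (intro seminorm_mult[OF sn[OF \<rho>(1)]]) auto
      also have "\<dots> \<le> \<rho> (adj A (path_el \<nu> w)) * (\<rho> (p v) * \<rho> (path_el \<nu> w))"
        using w v by (intro mult_left_mono seminorm_mult[OF sn[OF \<rho>(1)]] seminorm_nonneg[OF sn[OF \<rho>(1)]]) auto
      finally have "\<rho> (p w) \<le> 0" using z by simp
      then show False using \<rho>(2) seminorm_nonneg[OF sn[OF \<rho>(1)], of "p w"] wv by simp
    qed
    then show "\<exists>\<rho>\<in>S. \<rho> (p v) \<noteq> 0" using \<rho> by blast
  next
    fix u e \<nu> z assume u: "awalk u (e # \<nu>) u" "u \<notin> tail G ` set \<nu>" "cmod z = 1"
    then have "on_cycle u" "u \<in> verts G" by (auto simp: on_cycle_def)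
    then show "\<exists>\<rho>\<in>S. \<rho> (p u) \<noteq> 0 \<and> \<rho> (path_el (e # \<nu>) u \<ominus>\<^bsub>A\<^esub> z \<odot>\<^bsub>A\<^esub> p u) = 0"
      using end_rep[of u z] u by blast
  qed (rule sn)
  have gen: "cstar_generated_by A (p ` verts G \<union> s ` arcs G)" using G by (simp add: graph_cstar_algebra_def)
  show ?thesis
    unfolding RFD_def
  proof (intro exI[of _ "{(n, \<pi>). fd_representation A n \<pi>}"] conjI ballI impI)
    fix a assume a: "a \<in> carrier A" "a \<noteq> \<zero>\<^bsub>A\<^esub>"
    then obtain \<rho> where "\<rho> \<in> S" "\<rho> a \<noteq> 0" using eq_zero_if_seminorms_vanish[OF gen a(1)] by blast
    then obtain I \<phi> where \<phi>: "finite I" "star_hom A (Bop I) \<phi>" "op_norm (ent (\<phi> a)) \<noteq> 0"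
      by (auto simp: S_def)
    then have "\<phi> a \<noteq> \<zero>\<^bsub>Bop I\<^esub>" by (auto simp: Bop_simps)
    then show "\<exists>(n, \<pi>)\<in>{(n, \<pi>). fd_representation A n \<pi>}. \<pi> a \<noteq> 0\<^sub>m n n"
      using fd_representation_of_star_hom[OF \<phi>(2,1)] a(1) by (metis (mono_tags, lifting) case_prodI mem_Collect_eq)
  qed auto
qed

section \<open>Traces in finite-dimensional representations\<close>

locale fd_rep = cstar_algebra A for A :: "('a, 'b) cstar_scheme" (structure) +
  fixes n :: nat and \<pi> :: "'a \<Rightarrow> complex mat"
  assumes rep: "fd_representation A n \<pi>"
begin

definition ment :: "'a \<Rightarrow> nat \<Rightarrow> nat \<Rightarrow> complex" where
  "ment x i j = \<pi> x $$ (i, j)"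

definition tr :: "'a \<Rightarrow> real" where
  "tr x = Re (\<Sum>i<n. ment x i i)"

lemma \<pi>_carrier: "x \<in> carrier A \<Longrightarrow> \<pi> x \<in> carrier_mat n n"
  using rep by (simp add: fd_representation_def)

lemma ment_mult:
  assumes "x \<in> carrier A" "y \<in> carrier A" "i < n" "j < n"
  shows "ment (x \<otimes> y) i j = (\<Sum>k<n. ment x i k * ment y k j)"
proof -
  have "\<pi> (x \<otimes> y) = \<pi> x * \<pi> y" using rep assms by (simp add: fd_representation_def)
  then show ?thesis
    using assms \<pi>_carrier[of x] \<pi>_carrier[of y]
    by (simp add: ment_def scalar_prod_def lessThan_atLeast0)
qed

lemma ment_adj: "x \<in> carrier A \<Longrightarrow> i < n \<Longrightarrow> j < n \<Longrightarrow> ment (adj A x) i j = cnj (ment x j i)"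
  using rep mat_adjoint_index[OF \<pi>_carrier[of x]] by (simp add: ment_def fd_representation_def)

lemma tr_add: "x \<in> carrier A \<Longrightarrow> y \<in> carrier A \<Longrightarrow> tr (x \<oplus> y) = tr x + tr y"
proof -
  assume c: "x \<in> carrier A" "y \<in> carrier A"
  then have "\<pi> (x \<oplus> y) = \<pi> x + \<pi> y" using rep by (simp add: fd_representation_def)
  then have "ment (x \<oplus> y) i i = ment x i i + ment y i i" if "i < n" for i
    using that \<pi>_carrier[OF c(1)] \<pi>_carrier[OF c(2)] by (simp add: ment_def)
  then show ?thesis by (simp add: tr_def sum.distrib)
qed

lemma tr_zero [simp]: "tr \<zero> = 0"
  using tr_add[of \<zero> \<zero>] by simp

lemma tr_mult_commute: "x \<in> carrier A \<Longrightarrow> y \<in> carrier A \<Longrightarrow> tr (x \<otimes> y) = tr (y \<otimes> x)"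
  unfolding tr_def by (simp add: ment_mult) (subst sum.swap, simp add: mult.commute)

lemma tr_finsum:
  "finite F \<Longrightarrow> (\<And>i. i \<in> F \<Longrightarrow> f i \<in> carrier A) \<Longrightarrow> tr (\<Oplus>i\<in>F. f i) = (\<Sum>i\<in>F. tr (f i))"
proof (induction F rule: finite_induct)
  case (insert a F)
  have "(\<Oplus>i\<in>insert a F. f i) = f a \<oplus> (\<Oplus>i\<in>F. f i)"
    using insert by (intro M.finsum_insert) auto
  moreover have "(\<Oplus>i\<in>F. f i) \<in> carrier A" using insert by (intro M.finsum_closed) auto
  ultimately show ?case using insert by (simp add: tr_add)
qed simp

text \<open>For a selfadjoint idempotent matrix the product formula for a diagonal entry is the
  squared norm of its row; summed over the diagonal, this gives the squared Frobenius norm.\<close>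

lemma ment_projection_diag:
  assumes "projection A x" "i < n"
  shows "ment x i i = of_real (\<Sum>k<n. (cmod (ment x i k))\<^sup>2)"
proof -
  have x: "x \<in> carrier A" "x \<otimes> x = x" "adj A x = x" using assms by (auto simp: projection_def)
  have "ment x i i = (\<Sum>k<n. ment x i k * ment x k i)" using ment_mult[OF x(1,1) assms(2,2)] x by simp
  also have "\<dots> = (\<Sum>k<n. of_real ((cmod (ment x i k))\<^sup>2))"
  proof (rule sum.cong[OF refl])
    fix k assume "k \<in> {..<n}"
    then have "ment x k i = cnj (ment x i k)" using ment_adj[OF x(1), of k i] x assms by simp
    then show "ment x i k * ment x k i = of_real ((cmod (ment x i k))\<^sup>2)"
      by (simp only: complex_norm_square)
  qed
  finally show ?thesis by simp
qed

lemma tr_projection: "projection A x \<Longrightarrow> tr x = (\<Sum>i<n. \<Sum>k<n. (cmod (ment x i k))\<^sup>2)"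
  unfolding tr_def by (simp add: ment_projection_diag)

lemma tr_projection_nonneg: "projection A x \<Longrightarrow> 0 \<le> tr x"
  by (simp add: tr_projection sum_nonneg)

text \<open>A diagonal entry is both the squared norm of its row and an entry of that row, so its
  square is at most itself, and it is at most 1.\<close>

lemma tr_projection_le: assumes x: "projection A x" shows "tr x \<le> real n"
proof -
  have "(\<Sum>k<n. (cmod (ment x i k))\<^sup>2) \<le> 1" if i: "i < n" for i
  proof -
    let ?t = "\<Sum>k<n. (cmod (ment x i k))\<^sup>2"
    have t0: "0 \<le> ?t" by (intro sum_nonneg) auto
    have "(cmod (ment x i i))\<^sup>2 \<le> ?t" using i by (intro member_le_sum) auto
    moreover have "cmod (ment x i i) = ?t"
      unfolding ment_projection_diag[OF x i] norm_of_real using t0 by simp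
    ultimately have "?t * ?t \<le> ?t" by (simp add: power2_eq_square)
    then have "\<not> 1 < ?t" using mult_strict_right_mono[of 1 ?t ?t] by linarith
    then show ?thesis by simp
  qed
  then have "tr x \<le> (\<Sum>i<n. 1)" unfolding tr_projection[OF x] by (intro sum_mono) auto
  then show ?thesis by simp
qed

text \<open>The trace of a projection is its squared Frobenius norm, which is submultiplicative.\<close>

lemma tr_projection_ge_1: assumes x: "projection A x" "tr x \<noteq> 0" shows "1 \<le> tr x"
proof -
  have xc: "x \<in> carrier A" "x \<otimes> x = x" using x by (auto simp: projection_def)
  have "tr x = (\<Sum>i<n. \<Sum>j<n. (cmod (ment x i j))\<^sup>2)" by (rule tr_projection[OF x(1)])
  also have "\<dots> \<le> (\<Sum>i<n. \<Sum>j<n. (\<Sum>k<n. (cmod (ment x i k))\<^sup>2) * (\<Sum>k<n. (cmod (ment x k j))\<^sup>2))"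
  proof (intro sum_mono)
    fix i j assume "i \<in> {..<n}" "j \<in> {..<n}"
    then have "ment x i j = (\<Sum>k<n. ment x i k * ment x k j)" using ment_mult[OF xc(1,1), of i j] xc by simp
    then have "cmod (ment x i j) \<le> vnorm n (\<lambda>k. ment x i k) * vnorm n (\<lambda>k. ment x k j)"
      by (simp only: vnorm_Cauchy_Schwarz)
    then have "(cmod (ment x i j))\<^sup>2 \<le> (vnorm n (\<lambda>k. ment x i k) * vnorm n (\<lambda>k. ment x k j))\<^sup>2"
      by (intro power_mono) auto
    then show "(cmod (ment x i j))\<^sup>2 \<le> (\<Sum>k<n. (cmod (ment x i k))\<^sup>2) * (\<Sum>k<n. (cmod (ment x k j))\<^sup>2)"
      by (simp add: power_mult_distrib vnorm_power2)
  qed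
  also have "\<dots> = (\<Sum>i<n. \<Sum>k<n. (cmod (ment x i k))\<^sup>2) * (\<Sum>j<n. \<Sum>k<n. (cmod (ment x k j))\<^sup>2)"
    by (simp add: sum_product)
  also have "(\<Sum>j<n. \<Sum>k<n. (cmod (ment x k j))\<^sup>2) = tr x"
    unfolding tr_projection[OF x(1)] by (rule sum.swap)
  also have "(\<Sum>i<n. \<Sum>k<n. (cmod (ment x i k))\<^sup>2) = tr x" using tr_projection[OF x(1)] by simp
  finally have "tr x \<le> tr x * tr x" .
  then show ?thesis using tr_projection_nonneg[OF x(1)] x(2) by (simp add: mult_le_cancel_left1)
qed

lemma \<pi>_zero_if_tr_zero:
  assumes x: "projection A x" "tr x = 0" shows "\<pi> x = 0\<^sub>m n n"
proof (rule eq_matI)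
  have c: "\<pi> x \<in> carrier_mat n n" using \<pi>_carrier x by (simp add: projection_def)
  show "dim_row (\<pi> x) = dim_row (0\<^sub>m n n)" "dim_col (\<pi> x) = dim_col (0\<^sub>m n n)" using c by auto
  fix i j assume ij: "i < dim_row (0\<^sub>m n n)" "j < dim_col (0\<^sub>m n n)"
  have "(\<Sum>i<n. \<Sum>k<n. (cmod (ment x i k))\<^sup>2) = 0" using x tr_projection by simp
  then have "(\<Sum>k<n. (cmod (ment x i k))\<^sup>2) = 0"
    using ij by (simp add: sum_nonneg_eq_0_iff sum_nonneg)
  then show "\<pi> x $$ (i, j) = 0\<^sub>m n n $$ (i, j)"
    using ij by (simp add: sum_nonneg_eq_0_iff ment_def)
qed

lemma finsum_orthogonal_projection:
  assumes "finite J" "\<And>j. j \<in> J \<Longrightarrow> projection A (f j)"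
    "\<And>i j. i \<in> J \<Longrightarrow> j \<in> J \<Longrightarrow> i \<noteq> j \<Longrightarrow> f i \<otimes> f j = \<zero>"
  shows "projection A (\<Oplus>j\<in>J. f j)"
proof -
  have f: "f j \<in> carrier A" "f j \<otimes> f j = f j" "adj A (f j) = f j" if "j \<in> J" for j
    using assms(2)[OF that] by (auto simp: projection_def)
  have c: "(\<Oplus>j\<in>J. f j) \<in> carrier A" using f by (intro M.finsum_closed) auto
  have "f i \<otimes> (\<Oplus>j\<in>J. f j) = f i" if i: "i \<in> J" for i
  proof -
    have "f i \<otimes> (\<Oplus>j\<in>J. f j) = (\<Oplus>j\<in>J. f i \<otimes> f j)" using assms(1) f i by (intro finsum_mult_left) auto
    also have "\<dots> = f i" using assms(1,3) f i by (intro finsum_single[of J i]) auto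
    finally show ?thesis .
  qed
  then have "(\<Oplus>i\<in>J. f i \<otimes> (\<Oplus>j\<in>J. f j)) = (\<Oplus>i\<in>J. f i)" using f by (intro M.finsum_cong') auto
  then have "(\<Oplus>j\<in>J. f j) \<otimes> (\<Oplus>j\<in>J. f j) = (\<Oplus>j\<in>J. f j)"
    using finsum_mult_right[OF assms(1), of f "\<Oplus>j\<in>J. f j"] f c by simp
  moreover have "adj A (\<Oplus>j\<in>J. f j) = (\<Oplus>j\<in>J. f j)"
    using f assms(1) by (subst adj_finsum) (auto intro!: M.finsum_cong')
  ultimately show ?thesis using c by (simp add: projection_def)
qed

text \<open>Otherwise n + 1 members would add up to a projection of trace at least n + 1.\<close>

lemma infinite_orthogonal_family_tr:
  assumes J: "infinite J" "\<And>j. j \<in> J \<Longrightarrow> projection A (f j)"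
    "\<And>i j. i \<in> J \<Longrightarrow> j \<in> J \<Longrightarrow> i \<noteq> j \<Longrightarrow> f i \<otimes> f j = \<zero>"
  shows "\<exists>j\<in>J. tr (f j) = 0"
proof (rule ccontr)
  assume no: "\<not> (\<exists>j\<in>J. tr (f j) = 0)"
  obtain F where F: "finite F" "card F = Suc n" "F \<subseteq> J" using infinite_arbitrarily_large[OF J(1)] by blast
  have proj: "projection A (\<Oplus>j\<in>F. f j)"
    by (rule finsum_orthogonal_projection[OF F(1) J(2) J(3)]) (use F(3) in auto)
  have "real (Suc n) = (\<Sum>j\<in>F. 1)" using F by simp
  also have "\<dots> \<le> (\<Sum>j\<in>F. tr (f j))" using F no J(2) by (intro sum_mono tr_projection_ge_1) auto
  also have "\<dots> = tr (\<Oplus>j\<in>F. f j)" using F J(2) by (intro tr_finsum[symmetric]) (auto simp: projection_def)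
  also have "\<dots> \<le> real n" using proj by (rule tr_projection_le)
  finally show False by simp
qed

end

section \<open>Traces of Cuntz-Krieger families\<close>

locale fd_ck_rep = ck_algebra G A p s + fd_rep A n \<pi>
  for G :: "('v, 'e) pre_digraph" and A :: "('a, 'b) cstar_scheme" (structure)
    and p :: "'v \<Rightarrow> 'a" and s :: "'e \<Rightarrow> 'a" and n and \<pi> :: "'a \<Rightarrow> complex mat"
begin

lemma projection_p: "v \<in> verts G \<Longrightarrow> projection A (p v)"
  by (simp add: projection_def)

lemma projection_range: "e \<in> arcs G \<Longrightarrow> projection A (s e \<otimes> adj A (s e))"
  using s_adj_s[of e] by (simp add: projection_def adj_mult adj_adj mult_assoc[symmetric])

lemma range_orth: "e \<in> arcs G \<Longrightarrow> f \<in> arcs G \<Longrightarrow> e \<noteq> f \<Longrightarrow>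
    (s e \<otimes> adj A (s e)) \<otimes> (s f \<otimes> adj A (s f)) = \<zero>"
  using ck unfolding ck_family_def range_proj_def by blast

lemma tr_range: "e \<in> arcs G \<Longrightarrow> tr (s e \<otimes> adj A (s e)) = tr (p (head G e))"
  using tr_mult_commute[of "s e" "adj A (s e)"] by (simp add: adj_s_s)

text \<open>The two sides differ by the trace of the gap of \<open>F\<close> at \<open>v\<close>,
  which is a projection.\<close>

lemma tr_vertex_ge:
  assumes F: "finite F" "F \<subseteq> arcs G" and v: "v \<in> verts G" and t: "\<And>e. e \<in> F \<Longrightarrow> tail G e = v"
  shows "(\<Sum>e\<in>F. tr (p (head G e))) \<le> tr (p v)"
proof -
  have int: "F \<inter> out_arcs G v = F" using F t by auto
  let ?e = "\<Oplus>e\<in>F. s e \<otimes> adj A (s e)"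
  have c: "?e \<in> carrier A" using F by (intro M.finsum_closed) auto
  have "p v = gap F v \<oplus> ?e"
    unfolding gap_def int using v c by (simp add: minus_add_cancel)
  then have "tr (p v) = tr (gap F v) + tr ?e"
    using tr_add[of "gap F v" ?e] c v F gap_closed by simp
  moreover have "0 \<le> tr (gap F v)" using gap_projection[OF F v] by (rule tr_projection_nonneg)
  moreover have "tr ?e = (\<Sum>e\<in>F. tr (p (head G e)))"
    using F by (subst tr_finsum) (auto intro!: sum.cong simp: tr_range)
  ultimately show ?thesis by simp
qed

lemma tr_walk_le: "awalk u \<alpha> v \<Longrightarrow> tr (p v) \<le> tr (p u)"
proof (induction \<alpha> arbitrary: u)
  case (Cons e \<alpha>)
  then have e: "e \<in> arcs G" "u = tail G e" "awalk (head G e) \<alpha> v" by (auto simp: awalk_simps)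
  have "(\<Sum>f\<in>{e}. tr (p (head G f))) \<le> tr (p u)" using e by (intro tr_vertex_ge) auto
  then show ?case using Cons.IH[OF e(3)] by simp
qed (auto simp: awalk_simps)

text \<open>The range projections of the edges into \<open>v\<close> are orthogonal, and each has
  the trace of \<open>p v\<close>.\<close>

lemma in_arcs_finite:
  assumes "v \<in> verts G" "tr (p v) \<noteq> 0" shows "finite (in_arcs G v)"
proof (rule ccontr)
  assume "infinite (in_arcs G v)"
  then obtain e where "e \<in> in_arcs G v" "tr (s e \<otimes> adj A (s e)) = 0"
    using infinite_orthogonal_family_tr[of "in_arcs G v" "\<lambda>e. s e \<otimes> adj A (s e)"]
      projection_range range_orth by (metis in_in_arcs_conv)
  then show False using assms tr_range by auto
qed

text \<open>Traces weakly decrease along walks, so they are constant around a cycle. At the source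
  of the exit the next vertex of the cycle already uses up the whole trace, which leaves nothing for
  \<open>f\<close>.\<close>

lemma cycle_exit_tr:
  assumes \<mu>: "graph_cycle G \<mu>" and f: "f \<in> arcs G" "f \<notin> set \<mu>" "tail G f \<in> cycle_verts G \<mu>"
  shows "tr (p (head G f)) = 0"
proof -
  obtain v where v: "awalk v \<mu> v" using \<mu> by (auto simp: graph_cycle_def)
  obtain e where e: "e \<in> set \<mu>" "tail G f = tail G e" using f(3) by (auto simp: cycle_verts_def)
  obtain x y where xy: "\<mu> = x @ e # y" using e(1) by (meson split_list)
  then have w: "awalk v x (tail G e)" "e \<in> arcs G" "awalk (head G e) y v"
    using v by (auto simp: awalk_append_ex awalk_Cons_iff simp del: awalk_append_iff)
  then have "tr (p (tail G e)) \<le> tr (p (head G e))" using tr_walk_le awalk_appendI by blast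
  moreover have "(\<Sum>g\<in>{e, f}. tr (p (head G g))) \<le> tr (p (tail G e))"
    using w(2) f e by (intro tr_vertex_ge) auto
  moreover have "e \<noteq> f" using e f by auto
  ultimately have "tr (p (head G f)) \<le> 0" by simp
  then show ?thesis using tr_projection_nonneg[OF projection_p, of "head G f"] f by simp
qed

text \<open>As the edges are distinct, some edge of nonpositive index has a range projection of
  trace 0. Its head then has trace 0, and so have all later vertices up to the head of
  \<open>e 0\<close>.\<close>

lemma backward_chain_tr:
  assumes ch: "infinite_backward_chain G I e" shows "tr (p (head G (e 0))) = 0"
proof -
  have I: "{..0} \<subseteq> I" using ch by (auto simp: infinite_backward_chain_def)
  then have arc: "e i \<in> arcs G" if "i \<le> 0" for i
    using ch that unfolding infinite_backward_chain_def by auto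
  have inj: "inj_on e {..0}" using ch I unfolding infinite_backward_chain_def by (meson inj_on_subset)
  have step: "head G (e i) = tail G (e (i + 1))" if "i + 1 \<le> 0" for i
    using ch that I unfolding infinite_backward_chain_def by force
  obtain j :: int where j: "j \<le> 0" "tr (s (e j) \<otimes> adj A (s (e j))) = 0"
    using infinite_orthogonal_family_tr[of "{..0::int}" "\<lambda>i. s (e i) \<otimes> adj A (s (e i))"]
      projection_range range_orth arc inj_onD[OF inj] by (fastforce simp: infinite_Iic)
  have "tr (p (head G (e i))) \<le> 0" if "j \<le> i" "i \<le> 0" for i
    using that
  proof (induction i rule: int_ge_induct)
    case base
    then show ?case using j tr_range arc by simp
  next
    case (step i)
    then have "tr (p (head G (e (i + 1)))) \<le> tr (p (tail G (e (i + 1))))"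
      using tr_walk_le arc_implies_awalk arc by blast
    then show ?case using step \<open>\<And>i. i + 1 \<le> 0 \<Longrightarrow> head G (e i) = tail G (e (i + 1))\<close>[of i] by simp
  qed
  from this[of 0] show ?thesis
    using j(1) tr_projection_nonneg[OF projection_p, of "head G (e 0)"] arc[of 0] by simp
qed

text \<open>If \<open>v\<close> reaches no such end, every vertex reached is regular, so a nonzero
  trace passes on along some edge. The resulting infinite path has distinct vertices, as a
  repetition would be a cycle; but infinitely many orthogonal projections cannot all have nonzero
  trace.\<close>

lemma walk_to_end:
  assumes v: "v \<in> verts G" "tr (p v) \<noteq> 0"
  shows "\<exists>\<nu> w. awalk v \<nu> w \<and> (sink G w \<or> (\<exists>\<mu>. graph_cycle G \<mu> \<and> w \<in> cycle_verts G \<mu>) \<or> infinite_emitter G w)"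
proof (rule ccontr)
  assume no: "\<not> ?thesis"
  define Q where "Q = (\<lambda>x. (\<exists>\<nu>. awalk v \<nu> x) \<and> tr (p x) \<noteq> 0)"
  have Qv: "Q v" unfolding Q_def using v by (auto simp: awalk_simps intro!: exI[of _ "[]"])
  have Qverts: "x \<in> verts G" if "Q x" for x using that by (auto simp: Q_def)
  have step: "\<exists>e\<in>arcs G. tail G e = x \<and> Q (head G e)" if x: "Q x" for x
  proof -
    obtain \<nu> where \<nu>: "awalk v \<nu> x" using x by (auto simp: Q_def)
    have fin: "finite (out_arcs G x)" "out_arcs G x \<noteq> {}"
      using no \<nu> Qverts[OF x] by (auto simp: sink_def infinite_emitter_def)
    have "tr (p x) = (\<Sum>e\<in>out_arcs G x. tr (s e \<otimes> adj A (s e)))"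
      unfolding p_regular[OF Qverts[OF x] fin(2,1)] using fin by (intro tr_finsum) auto
    then have "(\<Sum>e\<in>out_arcs G x. tr (s e \<otimes> adj A (s e))) \<noteq> 0" using x by (simp add: Q_def)
    then obtain e where "e \<in> out_arcs G x" "tr (s e \<otimes> adj A (s e)) \<noteq> 0"
      by (rule sum.not_neutral_contains_not_neutral)
    then have e: "e \<in> arcs G" "tail G e = x" "tr (p (head G e)) \<noteq> 0" using tr_range by auto
    then have "awalk v (\<nu> @ [e]) (head G e)" using \<nu> arc_implies_awalk awalk_appendI by blast
    then show ?thesis unfolding Q_def using e by blast
  qed
  have "\<exists>g. g 0 = v \<and> (\<forall>k. Q (g k) \<and> (\<exists>e\<in>arcs G. tail G e = g k \<and> head G e = g (Suc k)))"
  proof -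
    \<comment> \<open>The successor is arbitrary outside \<open>Q\<close>, which makes it a total
      function that can be iterated.\<close>
    have "\<forall>x. \<exists>y. Q x \<longrightarrow> Q y \<and> (\<exists>e\<in>arcs G. tail G e = x \<and> head G e = y)"
      using step by blast
    from choice[OF this] obtain nx
      where nx: "\<forall>x. Q x \<longrightarrow> Q (nx x) \<and> (\<exists>e\<in>arcs G. tail G e = x \<and> head G e = nx x)"
      by (rule exE)
    have "Q ((nx ^^ k) v)" for k by (induction k) (use Qv nx in auto)
    then show ?thesis using nx by (intro exI[of _ "\<lambda>k. (nx ^^ k) v"]) simp
  qed
  then obtain g where g: "\<And>k. Q (g k)" "\<And>k. \<exists>e\<in>arcs G. tail G e = g k \<and> head G e = g (Suc k)" by blast
  have walk: "\<exists>\<alpha>. length \<alpha> = d \<and> awalk (g k) \<alpha> (g (k + d))" for k d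
  proof (induction d)
    case 0
    then show ?case using Qverts[OF g(1)] by (auto simp: awalk_simps intro!: exI[of _ "[]"])
  next
    case (Suc d)
    then obtain \<alpha> where \<alpha>: "length \<alpha> = d" "awalk (g k) \<alpha> (g (k + d))" by blast
    obtain e where "e \<in> arcs G" "tail G e = g (k + d)" "head G e = g (Suc (k + d))" using g(2) by blast
    then have "awalk (g k) (\<alpha> @ [e]) (g (k + Suc d))"
      using \<alpha>(2) arc_implies_awalk[of e] awalk_appendI by fastforce
    then show ?case using \<alpha>(1) by (intro exI[of _ "\<alpha> @ [e]"]) simp
  qed
  have neq: "g k \<noteq> g l" if kl: "k < l" for k l
  proof
    assume eq: "g k = g l"
    obtain \<alpha> where "length \<alpha> = l - k" "awalk (g k) \<alpha> (g l)" using walk[of "l - k" k] kl by auto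
    then have "on_cycle (g k)" using eq kl unfolding on_cycle_def by (intro exI[of _ \<alpha>]) auto
    then obtain \<mu> where "graph_cycle G \<mu>" "g k \<in> cycle_verts G \<mu>" using on_cycle_graph_cycle by blast
    then show False using no g(1)[of k] by (auto simp: Q_def)
  qed
  have ninj: "g k \<noteq> g l" if "k \<noteq> l" for k l using that neq by (metis nat_neq_iff)
  have "\<exists>k\<in>(UNIV :: nat set). tr (p (g k)) = 0"
  proof (rule infinite_orthogonal_family_tr)
    show "projection A (p (g k))" for k by (rule projection_p[OF Qverts[OF g(1)]])
    show "p (g k) \<otimes> p (g l) = \<zero>" if "k \<noteq> l" for k l
      by (rule p_orth[OF Qverts[OF g(1)] Qverts[OF g(1)] ninj[OF that]])
  qed simp
  then obtain k where "tr (p (g k)) = 0" by blast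
  then show False using g(1)[of k] by (simp add: Q_def)
qed

end

theorem theorem3p10:
  fixes G :: "('v, 'e) pre_digraph"
    and A :: "'a cstar" and p :: "'v \<Rightarrow> 'a" and s :: "'e \<Rightarrow> 'a"
  assumes "countable_digraph G"
    and "graph_cstar_algebra G A p s"
  shows "RFD A \<longleftrightarrow>
    (\<not> (\<exists>v. infinite_receiver G v)) \<and>
    (\<not> (\<exists>\<mu>. graph_cycle G \<mu> \<and> has_exit G \<mu>)) \<and>
    (\<not> (\<exists>I e. infinite_backward_chain G I e)) \<and>
    (\<forall>v\<in>verts G. \<exists>\<nu> w. pre_digraph.awalk G v \<nu> w \<and>
       (sink G w \<or> (\<exists>\<mu>. graph_cycle G \<mu> \<and> w \<in> cycle_verts G \<mu>) \<or> infinite_emitter G w))"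
proof
  assume RFD: "RFD A"
  interpret countable_digraph G by (rule assms(1))
  interpret cstar_algebra A using assms(2) by (simp add: graph_cstar_algebra_def)
  interpret ck_algebra G A p s using assms(2) by unfold_locales (simp add: graph_cstar_algebra_def)
  \<comment> \<open>The representation depends on the vertex, so this takes the form of an
    elimination rule: a claim may be proved inside any representation in which the given vertex has
    nonzero trace.\<close>
  have sees: thesis if v: "v \<in> verts G"
    and that: "\<And>n \<pi>. fd_ck_rep G A p s n \<pi> \<Longrightarrow> fd_rep.tr n \<pi> (p v) \<noteq> 0 \<Longrightarrow> thesis" for v thesis
  proof -
    have "p v \<noteq> \<zero>\<^bsub>A\<^esub>" using vertex_projection_nonzero[OF assms(2,1) v] .
    then obtain n \<pi> where \<pi>: "fd_representation A n \<pi>" "\<pi> (p v) \<noteq> 0\<^sub>m n n"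
      using RFD p_closed[OF v] unfolding RFD_def by fast
    interpret fd_ck_rep G A p s n \<pi> by unfold_locales (rule \<pi>(1))
    have "tr (p v) \<noteq> 0" using \<pi>_zero_if_tr_zero[OF projection_p[OF v]] \<pi>(2) by blast
    then show ?thesis by (rule that[OF fd_ck_rep_axioms])
  qed
  have "finite (in_arcs G v)" if "v \<in> verts G" for v
    by (rule sees[OF that]) (rule fd_ck_rep.in_arcs_finite[OF _ that])
  moreover have "\<not> has_exit G \<mu>" if "graph_cycle G \<mu>" for \<mu>
  proof
    assume "has_exit G \<mu>"
    then obtain f where f: "f \<in> arcs G" "f \<notin> set \<mu>" "tail G f \<in> cycle_verts G \<mu>"
      by (auto simp: has_exit_def)
    then have "head G f \<in> verts G" by simp
    then show False by (rule sees) (use fd_ck_rep.cycle_exit_tr[OF _ that f] in blast)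
  qed
  moreover have "\<not> infinite_backward_chain G I e" for I e
  proof
    assume ch: "infinite_backward_chain G I e"
    then have "e 0 \<in> arcs G" by (auto simp: infinite_backward_chain_def)
    then have "head G (e 0) \<in> verts G" by simp
    then show False by (rule sees) (use fd_ck_rep.backward_chain_tr[OF _ ch] in blast)
  qed
  moreover have "\<exists>\<nu> w. awalk v \<nu> w \<and>
       (sink G w \<or> (\<exists>\<mu>. graph_cycle G \<mu> \<and> w \<in> cycle_verts G \<mu>) \<or> infinite_emitter G w)"
    if "v \<in> verts G" for v
    by (rule sees[OF that]) (rule fd_ck_rep.walk_to_end[OF _ that])
  ultimately show "(\<not> (\<exists>v. infinite_receiver G v)) \<and>
    (\<not> (\<exists>\<mu>. graph_cycle G \<mu> \<and> has_exit G \<mu>)) \<and>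
    (\<not> (\<exists>I e. infinite_backward_chain G I e)) \<and>
    (\<forall>v\<in>verts G. \<exists>\<nu> w. awalk v \<nu> w \<and>
       (sink G w \<or> (\<exists>\<mu>. graph_cycle G \<mu> \<and> w \<in> cycle_verts G \<mu>) \<or> infinite_emitter G w))"
    unfolding infinite_receiver_def by blast
qed (use RFD_if_graph_conditions[OF assms] in blast)

end
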